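(* Let $K$ be a field of characteristic $0$, let $X=\{x_1,\ldots,x_d\}$, and let $\Omega$ be a set of multilinear operations as in the context. Let $KX$ have a polynomial $GL_2(K)$-module structure $$KX\cong W(\lambda_1^{(1)},\lambda_2^{(1)})\oplus\cdots\oplus W(\lambda_1^{(k)},\lambda_2^{(k)}).$$ Then the Hilbert series of the algebra of $SL_2(K)$-invariants in $K\{X\}_{\Omega}$ is $$H(K\{X\}_{\Omega}^{SL_2(K)},z)=2\int_0^1 \sin^2(2\pi u)\,H\left(K\{x\}_{\Omega},\,z\sum_{i=1}^ks_{(\lambda_1^{(i)},\lambda_2^{(i)})}(e^{2\pi iu},e^{-2\pi iu})\right)du$$ $$=2\int_0^1\sin^2(2\pi u)\,H\left(K\{x\}_{\Omega},\,z\sum_{i=1}^k\frac{\sin(2\pi (\lambda_1^{(i)}-\lambda_2^{(i)}+1)u)}{\sin(2\pi u)}\right)du.$$ (In the exponents $e^{\pm2\pi i u}$, $i$ is the imaginary unit; elsewhere $i$ is the summation index.)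
   Context: $\Omega=\bigcup_{n\ge 2}\Omega_n$, where $\Omega_n=\{\nu_{ni}\mid i=1,\ldots,p_n\}$ is a finite set (possibly empty) of $n$-ary operation symbols. For a set $X$, the free $\Omega$-magma $\{X\}_{\Omega}$ is the smallest set of formal expressions containing $X$ and containing $\nu_{ni}(u_1,\ldots,u_n)$ whenever $\nu_{ni}\in\Omega$ and $u_1,\ldots,u_n\in\{X\}_{\Omega}$. The (nonunitary) free $\Omega$-algebra $K\{X\}_{\Omega}$ is the $K$-vector space with basis $\{X\}_{\Omega}$, with the operations of $\Omega$ extended multilinearly. It is graded by $\deg(x_j)=1$ and $\deg\nu_{ni}(u_1,\ldots,u_n)=\sum_j\deg(u_j)$. For a graded subspace $V=\bigoplus_{k\ge1}V^{(k)}$ the Hilbert series is $H(V,t)=\sum_{k\ge 1}\dim(V^{(k)})t^k$. $K\{x\}_{\Omega}$ denotes the free $\Omega$-algebra on one generator $x$, and $H(K\{x\}_{\Omega},w)$ denotes the substitution of $w$ for $t$ in $H(K\{x\}_{\Omega},t)$. For integers $\lambda_1\ge\lambda_2\ge0$, $W(\lambda_1,\lambda_2)$ is the irreducible polynomial $GL_2(K)$-module corresponding to the partition $(\lambda_1,\lambda_2)$; its character is the Schur function $s_{(\lambda_1,\lambda_2)}(u_1,u_2)=(u_1u_2)^{\lambda_2}\frac{u_1^{\lambda_1-\lambda_2+1}-u_2^{\lambda_1-\lambda_2+1}}{u_1-u_2}$ (a polynomial), i.e. an element of $GL_2(K)$ with eigenvalues $\xi_1,\xi_2$ has trace $s_{(\lambda_1,\lambda_2)}(\xi_1,\xi_2)$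 on it. $KX$ is the vector space with basis $X$. The action of $GL_2(K)$ on $KX$ is extended to $K\{X\}_{\Omega}$ by $g(u(x_1,\ldots,x_d))=u(g(x_1),\ldots,g(x_d))$, and restricted to $SL_2(K)\subset GL_2(K)$; $K\{X\}_{\Omega}^{SL_2(K)}$ is the subalgebra of elements fixed by all of $SL_2(K)$. The right-hand sides are formal power series in $z$, integrated coefficientwise, and the quotient of sines is extended by continuity to the zeros of $\sin(2\pi u)$. *)

theory Defs
  imports
    "HOL-Analysis.Analysis"
    "HOL-Library.Poly_Mapping"
    "HOL-Computational_Algebra.Formal_Power_Series"
begin

section \<open>Free vector spaces\<close>

text \<open>The type \<open>'b \<Rightarrow>\<^sub>0 'k\<close> of finitely supported functions is the \<open>'k\<close>-vector space with basis
  \<open>'b\<close>; the basis vector \<open>b\<close> is \<open>Poly_Mapping.single b 1\<close>.\<close>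

definition pscale :: "'k::field \<Rightarrow> ('b \<Rightarrow>\<^sub>0 'k) \<Rightarrow> ('b \<Rightarrow>\<^sub>0 'k)" where
  "pscale c f = Poly_Mapping.map ((*) c) f"

lemma lookup_pscale [simp]: "Poly_Mapping.lookup (pscale c f) b = c * Poly_Mapping.lookup f b"
  by (simp add: pscale_def Poly_Mapping.map.rep_eq when_def)

lemma vector_space_pscale: "vector_space (pscale :: 'k::field \<Rightarrow> ('b \<Rightarrow>\<^sub>0 'k) \<Rightarrow> _)"
  by unfold_locales (auto intro!: poly_mapping_eqI simp: lookup_add algebra_simps)

definition lin_ext :: "('b \<Rightarrow> ('c \<Rightarrow>\<^sub>0 'k)) \<Rightarrow> ('b \<Rightarrow>\<^sub>0 'k) \<Rightarrow> ('c \<Rightarrow>\<^sub>0 'k::field)" where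
  "lin_ext h f = (\<Sum>t\<in>Poly_Mapping.keys f. pscale (Poly_Mapping.lookup f t) (h t))"

section \<open>The free magma and the free algebra\<close>

text \<open>\<open>Op n i [u\<^sub>1, \<dots>, u\<^sub>n]\<close> stands for \<open>\<nu>\<^sub>n\<^sub>i(u\<^sub>1, \<dots>, u\<^sub>n)\<close>. The signature \<open>\<Omega>\<close> is given by the
  function \<open>p\<close>, where \<open>p n\<close> is the number of \<open>n\<close>-ary symbols (only its values at \<open>n \<ge> 2\<close> matter).\<close>

datatype 'x expr = Gen 'x | Op nat nat "'x expr list"

inductive_set magma :: "(nat \<Rightarrow> nat) \<Rightarrow> 'x set \<Rightarrow> 'x expr set"
  for p :: "nat \<Rightarrow> nat" and X :: "'x set" where
  Gen: "x \<in> X \<Longrightarrow> Gen x \<in> magma p X"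
| Op: "2 \<le> n \<Longrightarrow> 1 \<le> i \<Longrightarrow> i \<le> p n \<Longrightarrow> length us = n \<Longrightarrow> \<forall>u\<in>set us. u \<in> magma p X
        \<Longrightarrow> Op n i us \<in> magma p X"

fun deg :: "'x expr \<Rightarrow> nat" where
  "deg (Gen x) = 1"
| "deg (Op n i us) = sum_list (map deg us)"

definition free_algebra :: "(nat \<Rightarrow> nat) \<Rightarrow> 'x set \<Rightarrow> ('x expr \<Rightarrow>\<^sub>0 'k::field) set" where
  "free_algebra p X = {f. Poly_Mapping.keys f \<subseteq> magma p X}"

definition KX :: "'x set \<Rightarrow> ('x expr \<Rightarrow>\<^sub>0 'k::field) set" where
  "KX X = {f. Poly_Mapping.keys f \<subseteq> Gen ` X}"

definition alg_op :: "nat \<Rightarrow> nat \<Rightarrow> ('x expr \<Rightarrow>\<^sub>0 'k) list \<Rightarrow> ('x expr \<Rightarrow>\<^sub>0 'k::field)" where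
  "alg_op n i fs = (\<Sum>us\<in>listset (map Poly_Mapping.keys fs).
      Poly_Mapping.single (Op n i us) (prod_list (map2 Poly_Mapping.lookup fs us)))"

definition graded_part :: "('x expr \<Rightarrow>\<^sub>0 'k::field) set \<Rightarrow> nat \<Rightarrow> ('x expr \<Rightarrow>\<^sub>0 'k) set" where
  "graded_part V m = {f \<in> V. \<forall>u\<in>Poly_Mapping.keys f. deg u = m}"

definition hilbert_series :: "('x expr \<Rightarrow>\<^sub>0 'k::field) set \<Rightarrow> complex fps" where
  "hilbert_series V =
     Abs_fps (\<lambda>m. if 1 \<le> m then of_nat (vector_space.dim pscale (graded_part V m)) else 0)"

section \<open>Polynomial representations of the general linear group\<close>

definition GL2 :: "('k::field ^ 2 ^ 2) set" where
  "GL2 = {g. invertible g}"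

definition SL2 :: "('k::field ^ 2 ^ 2) set" where
  "SL2 = {g. det g = 1}"

definition polynomial_on_GL2 :: "('k::field ^ 2 ^ 2 \<Rightarrow> 'k) \<Rightarrow> bool" where
  "polynomial_on_GL2 \<phi> \<longleftrightarrow> (\<exists>N. \<exists>c :: nat \<Rightarrow> nat \<Rightarrow> nat \<Rightarrow> nat \<Rightarrow> 'k. \<forall>g\<in>GL2.
     \<phi> g = (\<Sum>a\<le>N. \<Sum>b\<le>N. \<Sum>a'\<le>N. \<Sum>b'\<le>N.
       c a b a' b' * (g $ 1 $ 1) ^ a * (g $ 1 $ 2) ^ b * (g $ 2 $ 1) ^ a' * (g $ 2 $ 2) ^ b'))"

definition polynomial_GL2_module ::
    "'x set \<Rightarrow> ('k::field ^ 2 ^ 2 \<Rightarrow> ('x expr \<Rightarrow>\<^sub>0 'k) \<Rightarrow> ('x expr \<Rightarrow>\<^sub>0 'k)) \<Rightarrow> bool" where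
  "polynomial_GL2_module X \<rho> \<longleftrightarrow>
     (\<forall>g\<in>GL2. (\<forall>v\<in>KX X. \<rho> g v \<in> KX X)
        \<and> (\<forall>v\<in>KX X. \<forall>w\<in>KX X. \<rho> g (v + w) = \<rho> g v + \<rho> g w)
        \<and> (\<forall>c. \<forall>v\<in>KX X. \<rho> g (pscale c v) = pscale c (\<rho> g v)))
     \<and> (\<forall>v\<in>KX X. \<rho> (mat 1) v = v)
     \<and> (\<forall>g\<in>GL2. \<forall>h\<in>GL2. \<forall>v\<in>KX X. \<rho> (g ** h) v = \<rho> g (\<rho> h v))
     \<and> (\<forall>x\<in>X. \<forall>y\<in>X.
          polynomial_on_GL2
            (\<lambda>g. Poly_Mapping.lookup (\<rho> g (Poly_Mapping.single (Gen x) 1)) (Gen y)))"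

text \<open>\<open>W(\<lambda>\<^sub>1, \<lambda>\<^sub>2)\<close> is realized in the standard way as \<open>Sym\<^bsup>\<lambda>\<^sub>1-\<lambda>\<^sub>2\<^esup>(K\<^sup>2) \<otimes> det\<^bsup>\<lambda>\<^sub>2\<^esup>\<close>: binary forms of
  degree \<open>\<lambda>\<^sub>1 - \<lambda>\<^sub>2\<close>, regarded as functions on \<open>K\<^sup>2\<close> (no information is lost, as \<open>K\<close> is infinite). The
  transpose makes this a left action which, for \<open>(\<lambda>\<^sub>1, \<lambda>\<^sub>2) = (1, 0)\<close>, is the natural one on the span of
  the two coordinate functions. Irreducibility and the character are proved below.\<close>

definition form_monomial :: "nat \<Rightarrow> nat \<Rightarrow> ('k::field ^ 2 \<Rightarrow> 'k)" where
  "form_monomial n j = (\<lambda>v. (v $ 1) ^ (n - j) * (v $ 2) ^ j)"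

definition W :: "nat \<Rightarrow> nat \<Rightarrow> ('k::field ^ 2 \<Rightarrow> 'k) set" where
  "W l1 l2 = {f. \<exists>c. f = (\<lambda>v. \<Sum>j\<le>l1 - l2. c j * form_monomial (l1 - l2) j v)}"

definition W_act :: "nat \<Rightarrow> 'k::field ^ 2 ^ 2 \<Rightarrow> ('k ^ 2 \<Rightarrow> 'k) \<Rightarrow> ('k ^ 2 \<Rightarrow> 'k)" where
  "W_act l2 g f = (\<lambda>v. det g ^ l2 * f (transpose g *v v))"

text \<open>The finite direct sum \<open>W(l1 1, l2 1) \<oplus> \<dots> \<oplus> W(l1 k, l2 k)\<close> is taken to be the extensional product
  over \<open>{1..k}\<close>, with componentwise operations.\<close>

definition iso_sum_W ::
    "'x set \<Rightarrow> ('k::field ^ 2 ^ 2 \<Rightarrow> ('x expr \<Rightarrow>\<^sub>0 'k) \<Rightarrow> ('x expr \<Rightarrow>\<^sub>0 'k))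
      \<Rightarrow> nat \<Rightarrow> (nat \<Rightarrow> nat) \<Rightarrow> (nat \<Rightarrow> nat) \<Rightarrow> bool" where
  "iso_sum_W X \<rho> k l1 l2 \<longleftrightarrow> (\<exists>T :: ('x expr \<Rightarrow>\<^sub>0 'k) \<Rightarrow> nat \<Rightarrow> ('k ^ 2 \<Rightarrow> 'k).
     bij_betw T (KX X) (\<Pi>\<^sub>E i\<in>{1..k}. W (l1 i) (l2 i))
     \<and> (\<forall>v\<in>KX X. \<forall>w\<in>KX X. \<forall>i\<in>{1..k}. T (v + w) i = (\<lambda>a. T v i a + T w i a))
     \<and> (\<forall>c. \<forall>v\<in>KX X. \<forall>i\<in>{1..k}. T (pscale c v) i = (\<lambda>a. c * T v i a))
     \<and> (\<forall>g\<in>GL2. \<forall>v\<in>KX X. \<forall>i\<in>{1..k}. T (\<rho> g v) i = W_act (l2 i) g (T v i)))"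

section \<open>The induced action on the free algebra and its invariants\<close>

fun expr_subst :: "('x \<Rightarrow> ('x expr \<Rightarrow>\<^sub>0 'k)) \<Rightarrow> 'x expr \<Rightarrow> ('x expr \<Rightarrow>\<^sub>0 'k::field)" where
  "expr_subst \<phi> (Gen x) = \<phi> x"
| "expr_subst \<phi> (Op n i us) = alg_op n i (map (expr_subst \<phi>) us)"

definition ext_act ::
    "('k::field ^ 2 ^ 2 \<Rightarrow> ('x expr \<Rightarrow>\<^sub>0 'k) \<Rightarrow> ('x expr \<Rightarrow>\<^sub>0 'k))
      \<Rightarrow> 'k ^ 2 ^ 2 \<Rightarrow> ('x expr \<Rightarrow>\<^sub>0 'k) \<Rightarrow> ('x expr \<Rightarrow>\<^sub>0 'k)" where
  "ext_act \<rho> g = lin_ext (expr_subst (\<lambda>x. \<rho> g (Poly_Mapping.single (Gen x) 1)))"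

definition SL2_invariants ::
    "(nat \<Rightarrow> nat) \<Rightarrow> 'x set \<Rightarrow> ('k::field ^ 2 ^ 2 \<Rightarrow> ('x expr \<Rightarrow>\<^sub>0 'k) \<Rightarrow> ('x expr \<Rightarrow>\<^sub>0 'k))
      \<Rightarrow> ('x expr \<Rightarrow>\<^sub>0 'k) set" where
  "SL2_invariants p X \<rho> = {f \<in> free_algebra p X. \<forall>g\<in>SL2. ext_act \<rho> g f = f}"

section \<open>Schur functions, the quotient of sines, coefficientwise integration\<close>

definition schur :: "nat \<Rightarrow> nat \<Rightarrow> 'a::comm_ring_1 \<Rightarrow> 'a \<Rightarrow> 'a" where
  "schur l1 l2 u1 u2 = (u1 * u2) ^ l2 * (\<Sum>j\<le>l1 - l2. u1 ^ (l1 - l2 - j) * u2 ^ j)"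

lemma schur_quotient:
  fixes u1 u2 :: "'a::field"
  assumes "u1 \<noteq> u2"
  shows "schur l1 l2 u1 u2
    = (u1 * u2) ^ l2 * ((u1 ^ (l1 - l2 + 1) - u2 ^ (l1 - l2 + 1)) / (u1 - u2))"
proof -
  have "u1 ^ Suc (l1 - l2) - u2 ^ Suc (l1 - l2)
      = (u1 - u2) * (\<Sum>j\<le>l1 - l2. u1 ^ (l1 - l2 - j) * u2 ^ j)"
  proof -
    have "(\<Sum>j\<le>l1 - l2. u1 ^ (l1 - l2 - j) * u2 ^ j)
        = (\<Sum>j<Suc (l1 - l2). u2 ^ j * u1 ^ (l1 - l2 - j))"
      by (simp add: lessThan_Suc_atMost mult.commute)
    moreover have "u1 ^ Suc (l1 - l2) - u2 ^ Suc (l1 - l2)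
        = (u1 - u2) * (\<Sum>j<Suc (l1 - l2). u2 ^ j * u1 ^ (l1 - l2 - j))"
      using arg_cong[OF diff_power_eq_sum[of u2 "l1 - l2" u1], of uminus]
      by (simp only: minus_diff_eq mult_minus_left[symmetric])
    ultimately show ?thesis by simp
  qed
  with assms show ?thesis by (simp add: schur_def)
qed

text \<open>Where the denominator vanishes, the value is the limit of the quotient.\<close>

definition sin_quotient :: "nat \<Rightarrow> real \<Rightarrow> real" where
  "sin_quotient m u = (if sin (2 * pi * u) = 0
     then Lim (at u) (\<lambda>v. sin (2 * pi * real m * v) / sin (2 * pi * v))
     else sin (2 * pi * real m * u) / sin (2 * pi * u))"

definition fps_integral01 :: "(real \<Rightarrow> complex fps) \<Rightarrow> complex fps" where
  "fps_integral01 F = Abs_fps (\<lambda>m. integral {0..1} (\<lambda>u. fps_nth (F u) m))"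

section \<open>The modules \<open>W(\<lambda>\<^sub>1, \<lambda>\<^sub>2)\<close> are irreducible with character the Schur function\<close>

lemma W_act_mult: "W_act l2 (g ** h) f = W_act l2 g (W_act l2 h f)"
  by (simp add: W_act_def det_mul power_mult_distrib matrix_transpose_mul
      matrix_vector_mul_assoc[symmetric] mult_ac)

text \<open>The diagonal matrix with entries \<open>a, b\<close> acts on the basis of \<open>W(\<lambda>\<^sub>1, \<lambda>\<^sub>2)\<close> by eigenvalues
  summing to \<open>s\<^bsub>(\<lambda>\<^sub>1, \<lambda>\<^sub>2)\<^esub>(a, b)\<close>.\<close>

lemma W_act_diagonal:
  fixes g :: "'k::field ^ 2 ^ 2"
  assumes "g $ 1 $ 1 = a" "g $ 2 $ 2 = b" "g $ 1 $ 2 = 0" "g $ 2 $ 1 = 0"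
  shows "W_act l2 g (form_monomial n j)
      = (\<lambda>v. ((a * b) ^ l2 * (a ^ (n - j) * b ^ j)) * form_monomial n j v)"
  using assms
  by (simp add: W_act_def form_monomial_def det_2 matrix_vector_mult_def transpose_def sum_2
      power_mult_distrib mult_ac)

lemma schur_eq_sum: "schur l1 l2 a b
    = (\<Sum>j\<le>l1 - l2. (a * b) ^ l2 * (a ^ (l1 - l2 - j) * b ^ j))"
  by (simp add: schur_def sum_distrib_left)

lemma W_irreducible:
  fixes U :: "('k::field_char_0 ^ 2 \<Rightarrow> 'k) set"
  assumes sub: "U \<subseteq> W l1 l2"
    and add: "\<And>f h. f \<in> U \<Longrightarrow> h \<in> U \<Longrightarrow> (\<lambda>v. f v + h v) \<in> U"
    and scale: "\<And>c f. f \<in> U \<Longrightarrow> (\<lambda>v. c * f v) \<in> U"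
    and act: "\<And>g f. g \<in> GL2 \<Longrightarrow> f \<in> U \<Longrightarrow> W_act l2 g f \<in> U"
    and nz: "f0 \<in> U" "f0 \<noteq> (\<lambda>v. 0)"
  shows "U = W l1 l2"
proof -
  define n where "n = l1 - l2"
  define m :: "nat \<Rightarrow> 'k ^ 2 \<Rightarrow> 'k" where "m = form_monomial n"
  define mk :: "'k \<Rightarrow> 'k \<Rightarrow> 'k \<Rightarrow> 'k \<Rightarrow> 'k ^ 2 ^ 2"
    where "mk a b c d = vector [vector [a, b], vector [c, d]]" for a b c d
  have mk: "mk a b c d $ 1 $ 1 = a" "mk a b c d $ 1 $ 2 = b"
    "mk a b c d $ 2 $ 1 = c" "mk a b c d $ 2 $ 2 = d" for a b c d
    by (simp_all add: mk_def)
  have mkGL: "mk a b c d \<in> GL2" if "a * d - b * c \<noteq> 0" for a b c d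
    using that by (simp add: GL2_def invertible_det_nz det_2 mk)
  have zero: "(\<lambda>v. 0) \<in> U" using scale[OF nz(1), of 0] by simp
  have split: "\<forall>j\<in>S. (\<lambda>v. c j * m j v) \<in> U"
    if "finite S" "S \<subseteq> {..n}" "(\<lambda>v. \<Sum>j\<in>S. c j * m j v) \<in> U" for S c
    using that
  proof (induction S arbitrary: c rule: finite_induct)
    case (insert a S)
    define e :: "nat \<Rightarrow> 'k" where "e j = 2 ^ l2 * 2 ^ (n - j)" for j
    let ?f = "\<lambda>v. \<Sum>j\<in>insert a S. c j * m j v"
    let ?g = "mk 2 0 0 1"
    have e: "e j - e a \<noteq> 0" if "j \<in> S" for j
    proof
      assume "e j - e a = 0"
      then have "(2::'k) ^ (n - j) = 2 ^ (n - a)" by (simp add: e_def)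
      then have "of_nat (2 ^ (n - j)) = (of_nat (2 ^ (n - a)) :: 'k)" by simp
      then have "(2::nat) ^ (n - j) = 2 ^ (n - a)" unfolding of_nat_eq_iff .
      then have "n - j = n - a" by simp
      moreover have "j \<le> n" "a \<le> n" using that insert.prems by auto
      ultimately have "j = a" by linarith
      then show False using that insert.hyps by auto
    qed
    have dm: "det ?g ^ l2 * m j (transpose ?g *v v) = e j * m j v" for j v
      using fun_cong[OF W_act_diagonal[of ?g 2 1 l2 n j], of v]
      by (simp add: mk e_def m_def W_act_def)
    have "W_act l2 ?g ?f \<in> U" 
      by (rule act[OF mkGL insert.prems(2)]) simp
    also have "W_act l2 ?g ?f = (\<lambda>v. \<Sum>j\<in>insert a S. c j * (e j * m j v))"
      unfolding W_act_def sum_distrib_left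
      by (intro ext sum.cong refl) (metis dm mult.left_commute)
    finally have "(\<lambda>v. (\<Sum>j\<in>insert a S. c j * (e j * m j v)) + (- e a) * ?f v) \<in> U"
      by (rule add[OF _ scale[OF insert.prems(2)]])
    also have "(\<lambda>v. (\<Sum>j\<in>insert a S. c j * (e j * m j v)) + (- e a) * ?f v)
        = (\<lambda>v. \<Sum>j\<in>S. ((e j - e a) * c j) * m j v)"
    proof
      fix v
      have "(\<Sum>j\<in>insert a S. c j * (e j * m j v)) + (- e a) * ?f v
          = (\<Sum>j\<in>insert a S. ((e j - e a) * c j) * m j v)"
        unfolding sum_distrib_left sum.distrib[symmetric]
        by (rule sum.cong) (simp_all add: algebra_simps)
      also have "\<dots> = (\<Sum>j\<in>S. ((e j - e a) * c j) * m j v)"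
        using insert.hyps by simp
      finally show "(\<Sum>j\<in>insert a S. c j * (e j * m j v)) + (- e a) * ?f v = \<dots>" .
    qed
    finally have fU: "(\<lambda>v. \<Sum>j\<in>S. ((e j - e a) * c j) * m j v) \<in> U" .
    have SU: "\<forall>j\<in>S. (\<lambda>v. ((e j - e a) * c j) * m j v) \<in> U"
      by (rule insert.IH[OF _ fU]) (use insert.prems in auto)
    have *: "(\<lambda>v. inverse (e j - e a) * (((e j - e a) * c j) * m j v)) \<in> U" if "j \<in> S" for j
      by (rule scale[OF SU[rule_format, OF that]])
    have S: "(\<lambda>v. c j * m j v) \<in> U" if "j \<in> S" for j
    proof -
      have "(\<lambda>v. inverse (e j - e a) * (((e j - e a) * c j) * m j v)) = (\<lambda>v. c j * m j v)"
        by (simp only: mult.assoc[symmetric] left_inverse[OF e[OF that]] mult_1_left)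
      then show ?thesis using *[OF that] by (simp only:)
    qed
    have sumU: "(\<lambda>v. \<Sum>j\<in>R. c j * m j v) \<in> U" if "finite R" "R \<subseteq> S" for R
      using that by (induction R rule: finite_induct) (auto simp: zero intro!: add S)
    have "(\<lambda>v. ?f v + (- 1) * (\<Sum>j\<in>S. c j * m j v)) \<in> U"
      by (rule add[OF insert.prems(2) scale[OF sumU]]) (use insert.hyps in auto)
    then have "(\<lambda>v. c a * m a v) \<in> U" using insert.hyps by simp
    then show ?case using S by blast
  qed auto
  obtain c where f0: "f0 = (\<lambda>v. \<Sum>j\<le>n. c j * m j v)"
    using sub nz(1) by (auto simp: W_def n_def m_def)
  have "\<exists>j\<le>n. c j \<noteq> 0"
  proof (rule ccontr)
    assume "\<not> ?thesis"
    then have "f0 = (\<lambda>v. 0)" unfolding f0 by auto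
    then show False using nz(2) by simp
  qed
  then obtain j where j: "j \<le> n" "c j \<noteq> 0" by blast
  have "(\<lambda>v. c j * m j v) \<in> U"
    using split[of "{..n}" c] nz(1) j(1) by (simp add: f0)
  from scale[OF this, of "inverse (c j)"] j(2) have mj: "m j \<in> U"
    by (simp only: mult.assoc[symmetric] left_inverse[OF j(2)] mult_1_left)
  have "W_act l2 (mk 1 1 0 1) (m j) \<in> U" by (intro act mkGL mj) simp
  also have "W_act l2 (mk 1 1 0 1) (m j)
      = (\<lambda>v. \<Sum>i\<le>n. (if i \<le> j then of_nat (j choose i) else 0) * m i v)"
  proof
    fix v :: "'k ^ 2"
    have "W_act l2 (mk 1 1 0 1) (m j) v = (v$1) ^ (n - j) * (v$2 + v$1) ^ j"
      by (simp add: W_act_def m_def form_monomial_def det_2 mk matrix_vector_mult_def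
          transpose_def sum_2 add.commute)
    also have "\<dots> = (\<Sum>i\<le>j. of_nat (j choose i) * m i v)"
      unfolding binomial_ring sum_distrib_left
    proof (rule sum.cong)
      fix i assume "i \<in> {..j}"
      then have "(v$1) ^ (n - i) = (v$1) ^ (n - j) * (v$1) ^ (j - i)"
        using j(1) by (simp add: power_add[symmetric])
      then show "(v$1) ^ (n - j) * (of_nat (j choose i) * (v$2) ^ i * (v$1) ^ (j - i))
          = of_nat (j choose i) * m i v"
        by (simp add: m_def form_monomial_def mult_ac)
    qed simp
    also have "\<dots> = (\<Sum>i\<le>n. (if i \<le> j then of_nat (j choose i) else 0) * m i v)"
      using j(1) by (intro sum.mono_neutral_cong_left) auto
    finally show "W_act l2 (mk 1 1 0 1) (m j) v = \<dots>" .
  qed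
  finally have "(\<lambda>v. (if 0 \<le> j then of_nat (j choose 0) else 0) * m 0 v) \<in> U"
    using split[of "{..n}" "\<lambda>i. if i \<le> j then of_nat (j choose i) else 0"] by blast
  then have m0: "m 0 \<in> U" by simp
  have "W_act l2 (mk 1 0 1 1) (m 0) \<in> U" by (intro act mkGL m0) simp
  also have "W_act l2 (mk 1 0 1 1) (m 0) = (\<lambda>v. \<Sum>i\<le>n. of_nat (n choose i) * m i v)"
  proof
    fix v :: "'k ^ 2"
    have "W_act l2 (mk 1 0 1 1) (m 0) v = (v$2 + v$1) ^ n"
      by (simp add: W_act_def m_def form_monomial_def det_2 mk matrix_vector_mult_def
          transpose_def sum_2 add.commute)
    then show "W_act l2 (mk 1 0 1 1) (m 0) v = (\<Sum>i\<le>n. of_nat (n choose i) * m i v)"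
      by (simp add: binomial_ring m_def form_monomial_def mult_ac)
  qed
  finally have *: "(\<lambda>v. of_nat (n choose i) * m i v) \<in> U" if "i \<le> n" for i
    using split[of "{..n}" "\<lambda>i. of_nat (n choose i)"] that by auto
  have all: "(\<lambda>v. a * m i v) \<in> U" if "i \<le> n" for i a
  proof -
    have "of_nat (n choose i) \<noteq> (0 :: 'k)" using that by simp
    then have "(\<lambda>v. a / of_nat (n choose i) * (of_nat (n choose i) * m i v)) = (\<lambda>v. a * m i v)"
      by simp
    then show ?thesis using scale[OF *[OF that], of "a / of_nat (n choose i)"] by (simp only:)
  qed
  have "f \<in> U" if "f \<in> W l1 l2" for f
  proof -
    obtain b where f: "f = (\<lambda>v. \<Sum>j\<le>n. b j * m j v)"
      using \<open>f \<in> W l1 l2\<close> by (auto simp: W_def n_def m_def)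
    have "(\<lambda>v. \<Sum>j\<in>R. b j * m j v) \<in> U" if "finite R" "R \<subseteq> {..n}" for R
      using that by (induction R rule: finite_induct) (auto simp: zero intro!: add all)
    then show ?thesis unfolding f by simp
  qed
  then show ?thesis using sub by blast
qed

end

theory Submission
  imports Defs "HOL-Library.Function_Algebras"
begin

text \<open>
An expression of degree \<open>m\<close> is a tree shape with \<open>m\<close> leaves together with the word of generators
written at its leaves. Hence the degree \<open>m\<close> part of \<open>K{X}\<close> is a direct sum, indexed by the shapes
of degree \<open>m\<close>, of copies of the tensor power \<open>V\<^sup>\<otimes>\<^sup>m\<close> of \<open>V = KX\<close>, and a linear substitution of
the generators acts on each copy as a tensor power (\<open>lookup_subst_eq_tensor_act\<close>). The number
of shapes of degree \<open>m\<close> is the coefficient of \<open>t\<^sup>m\<close> in \<open>H(K{x}, t)\<close>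
(\<open>hilbert_series_free_one_generator\<close>). So the formula says that the dimension of the invariants in
\<open>V\<^sup>\<otimes>\<^sup>m\<close> is \<open>2 \<integral> sin\<^sup>2(2\<pi>u) \<chi>(u)\<^sup>m du\<close>, where \<open>\<chi>\<close> is the character of \<open>V\<close> on the
diagonal torus: the Weyl integration formula for a tensor power.

The invariants are computed infinitesimally. \<open>SL\<^sub>2(K)\<close> is generated by its upper and lower
unitriangular matrices. In the basis of \<open>V\<close> made of the monomials in the summands \<open>W(\<lambda>\<^sub>1, \<lambda>\<^sub>2)\<close>,
each of these two one-parameter groups is polynomial in its parameter, and therefore a tensor is
fixed by such a group if and only if it is annihilated by the derivative of its action at \<open>0\<close>
(\<open>tensor_act_fixed_iff_der_zero\<close>). The derivatives are the derivations of the tensor algebra that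
extend the raising operator \<open>e\<close> and the lowering operator \<open>f\<close>; they generate an action of
\<open>sl\<^sub>2\<close> in which words in the monomial basis are weight vectors with integral weights.

For a finite-dimensional \<open>sl\<^sub>2\<close>-module of this kind, the vectors annihilated by \<open>e\<close> and \<open>f\<close> are
exactly the kernel of \<open>e\<close> on the weight space \<open>0\<close>, and \<open>e\<close> maps that space onto the weight space
\<open>2\<close>; so the invariants have dimension \<open>N\<^sub>0 - N\<^sub>2\<close>, where \<open>N\<^sub>d\<close> is the multiplicity of
the weight \<open>d\<close> (\<open>sl2_module.dim_invariants_plus_dim_weight_2\<close>). Surjectivity comes from a short
computation with powers of \<open>e\<close>, which shows that \<open>e f\<close> is injective on the weight space \<open>2\<close>.

On the analytic side, \<open>N\<^sub>d\<close> is the coefficient of \<open>z\<^sup>d\<close> in the \<open>m\<close>-th power of \<open>\<chi>\<close>,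
with \<open>z = exp(2\<pi>\<i>u)\<close>, and \<open>2 sin\<^sup>2(2\<pi>u) = 1 - (z\<^sup>2 + z\<^sup>-\<^sup>2)/2\<close>. So the integral is
\<open>N\<^sub>0 - (N\<^sub>2 + N\<^sub>-\<^sub>2)/2\<close>, and reversing the monomials shows that \<open>N\<^sub>-\<^sub>2 = N\<^sub>2\<close>. The second
formula has the same integrand: the quotient of sines and the Schur function agree for every \<open>u\<close>,
including the removable singularities (\<open>schur_eq_sin_quotient\<close>).
\<close>

section \<open>Dimensions of subspaces\<close>

context vector_space
begin

text \<open>If \<open>g ` V\<close> were smaller, the image of a basis of \<open>V\<close> could be enlarged by a vector of \<open>V\<close> to an independent subset
of \<open>V\<close> with more elements than the basis.\<close>

lemma inj_on_subspace_imp_surj: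
  assumes lin: "Vector_Spaces.linear scale scale g"
    and V: "subspace V" "finite A" "V \<subseteq> span A"
    and maps: "\<And>v. v \<in> V \<Longrightarrow> g v \<in> V"
    and inj: "\<And>v. v \<in> V \<Longrightarrow> g v = 0 \<Longrightarrow> v = 0"
  shows "g ` V = V"
proof
  interpret g: Vector_Spaces.linear scale scale g by fact
  show "g ` V \<subseteq> V" using maps by blast
  obtain C where C: "C \<subseteq> V" "independent C" "V \<subseteq> span C"
    using maximal_independent_subset by blast
  have finC: "finite C"
    using independent_span_bound[OF V(2) C(2)] C(1) V(3) by blast
  have spanC: "span C = V"
    using C span_minimal[OF C(1) V(1)] by blast
  have inj_on: "inj_on g (span C)"
    unfolding spanC
  proof (rule inj_onI)
    fix a b assume "a \<in> V" "b \<in> V" "g a = g b"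
    then have "g (a - b) = 0" "a - b \<in> V"
      using V(1) by (auto simp: g.diff subspace_diff)
    then show "a = b" using inj by fastforce
  qed
  have ind: "independent (g ` C)"
    by (rule g.independent_injective_image[OF C(2) inj_on])
  have card: "card (g ` C) = card C"
    by (rule card_image[OF inj_on_subset[OF inj_on]]) (simp add: span_superset)
  have "V \<subseteq> span (g ` C)"
  proof (rule ccontr)
    assume "\<not> ?thesis"
    then obtain v where v: "v \<in> V" "v \<notin> span (g ` C)" by blast
    have "independent (insert v (g ` C))" by (rule independent_insertI[OF v(2) ind])
    moreover have "insert v (g ` C) \<subseteq> span C" using v(1) C(1) maps by (auto simp: spanC)
    ultimately have "card (insert v (g ` C)) \<le> card C"
      using independent_span_bound[OF finC] by blast
    moreover have "v \<notin> g ` C" using v(2) span_base by blast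
    ultimately show False using finC card by simp
  qed
  also have "\<dots> = g ` V" by (simp add: g.span_image spanC)
  finally show "V \<subseteq> g ` V" .
qed

text \<open>Rank and nullity relative to a finite-dimensional subspace of an arbitrary space: a basis of the
kernel and preimages of a basis of the image together form a basis of \<open>V\<close>.\<close>

lemma dim_kernel_plus_dim_image:
  assumes lin: "Vector_Spaces.linear scale scale g"
    and V: "subspace V" "finite A" "V \<subseteq> span A"
  shows "dim {v \<in> V. g v = 0} + dim (g ` V) = dim V"
proof -
  interpret g: Vector_Spaces.linear scale scale g by fact
  let ?K = "{v \<in> V. g v = 0}"
  obtain K where K: "K \<subseteq> ?K" "independent K" "?K \<subseteq> span K" "card K = dim ?K"
    using basis_exists by blast
  obtain C where C: "C \<subseteq> g ` V" "independent C" "g ` V \<subseteq> span C" "card C = dim (g ` V)"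
    using basis_exists by blast
  have finK: "finite K"
    using independent_span_bound[OF V(2) K(2)] K(1) V(3) by blast
  have "g ` V \<subseteq> span (g ` A)" using V(3) by (auto simp: g.span_image)
  then have finC: "finite C"
    using independent_span_bound[OF finite_imageI[OF V(2)] C(2)] C(1) by blast
  have "\<forall>c\<in>C. \<exists>v. v \<in> V \<and> g v = c" using C(1) by blast
  then obtain r where r: "\<And>c. c \<in> C \<Longrightarrow> r c \<in> V" "\<And>c. c \<in> C \<Longrightarrow> g (r c) = c" by metis
  have injr: "inj_on r C" by (rule inj_on_inverseI[where g = g]) (rule r)
  have nz: "c \<noteq> 0" if "c \<in> C" for c using that C(2) dependent_zero by blast
  have disj: "K \<inter> r ` C = {}" using K(1) r(2) nz by fastforce
  have gsum: "g (\<Sum>c\<in>C. a c *s r c) = (\<Sum>c\<in>C. a c *s c)" for a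
    by (simp add: g.sum g.scale r(2))
  have ind: "independent (K \<union> r ` C)"
  proof (rule independent_if_scalars_zero)
    show "finite (K \<union> r ` C)" using finK finC by simp
    fix a x assume 0: "(\<Sum>x\<in>K \<union> r ` C. a x *s x) = 0" and x: "x \<in> K \<union> r ` C"
    have split: "(\<Sum>x\<in>K. a x *s x) + (\<Sum>c\<in>C. a (r c) *s r c) = 0"
      using 0 finK finC disj injr by (simp add: sum.union_disjoint sum.reindex)
    have "g (\<Sum>x\<in>K. a x *s x) = 0"
      using K(1) by (auto simp: g.sum g.scale intro!: sum.neutral)
    with arg_cong[OF split, of g] have "(\<Sum>c\<in>C. a (r c) *s c) = 0"
      by (simp add: g.add gsum g.zero)
    then have aC: "a (r c) = 0" if "c \<in> C" for c
      using independentD[OF C(2) finC subset_refl, of "\<lambda>c. a (r c)"] that by blast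
    then have "(\<Sum>x\<in>K. a x *s x) = 0" using split by simp
    then have "a x = 0" if "x \<in> K" for x
      using independentD[OF K(2) finK subset_refl] that by blast
    then show "a x = 0" using x aC by blast
  qed
  have "V \<subseteq> span (K \<union> r ` C)"
  proof
    fix v assume v: "v \<in> V"
    then have "g v \<in> span C" using C(3) by blast
    then obtain a where a: "g v = (\<Sum>c\<in>C. a c *s c)"
      using span_finite[OF finC] by auto
    have rs: "(\<Sum>c\<in>C. a c *s r c) \<in> V"
      using r(1) V(1) by (auto intro!: subspace_sum subspace_scale)
    have "v - (\<Sum>c\<in>C. a c *s r c) \<in> ?K"
      using v rs V(1) by (auto simp: subspace_diff g.diff gsum a)
    then have 1: "v - (\<Sum>c\<in>C. a c *s r c) \<in> span (K \<union> r ` C)"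
      using K(3) span_mono[of K "K \<union> r ` C"] by blast
    have "(\<Sum>c\<in>C. a c *s r c) \<in> span (K \<union> r ` C)"
      by (intro span_sum span_scale span_base) auto
    from span_add[OF 1 this] show "v \<in> span (K \<union> r ` C)" by simp
  qed
  moreover have "K \<union> r ` C \<subseteq> V" using K(1) r(1) by blast
  ultimately have "dim V = card (K \<union> r ` C)"
    using basis_card_eq_dim[OF _ _ ind] by simp
  also have "\<dots> = card K + card C"
    using finK finC disj injr by (simp add: card_Un_disjoint card_image)
  finally show ?thesis using K(4) C(4) by simp
qed

end

lemma (in vector_space_pair) dim_image_inj_on:
  assumes lin: "Vector_Spaces.linear s1 s2 g" and V: "vs1.subspace V"
    and inj: "inj_on g V"
  shows "vs2.dim (g ` V) = vs1.dim V"
proof -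
  interpret g: Vector_Spaces.linear s1 s2 g by fact
  obtain B where B: "B \<subseteq> V" "vs1.independent B" "V \<subseteq> vs1.span B" "card B = vs1.dim V"
    using vs1.basis_exists by blast
  have spanB: "vs1.span B = V" using B vs1.span_minimal[OF B(1) V] by blast
  have "vs2.dim (g ` V) = card (g ` B)"
  proof (rule vs2.basis_card_eq_dim[symmetric])
    show "g ` B \<subseteq> g ` V" using B(1) by blast
    show "g ` V \<subseteq> vs2.span (g ` B)" by (simp add: g.span_image spanB)
    show "vs2.independent (g ` B)"
      by (rule g.independent_injective_image[OF B(2)]) (simp add: spanB inj)
  qed
  then show ?thesis using card_image[OF inj_on_subset[OF inj B(1)]] B(4) by simp
qed

section \<open>Invariants of finite-dimensional sl(2)-modules\<close>

text \<open>The commutation relations of \<open>sl\<^sub>2\<close> are required only on \<open>V\<close>, so that operators given on a larger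
space of functions can be used as they are. Nilpotency of \<open>e\<close> and \<open>f\<close> holds in the intended
application because they shift the weights of words by \<open>2\<close> and only finitely many weights occur.\<close>

locale sl2_module = vector_space scale
  for scale :: "'k::field_char_0 \<Rightarrow> 'v::ab_group_add \<Rightarrow> 'v"  (infixr "*s" 75) +
  fixes V :: "'v set" and e f h :: "'v \<Rightarrow> 'v"
  assumes subspace_V: "subspace V"
    and finite_dim: "\<exists>A. finite A \<and> V \<subseteq> span A"
    and linear_e: "Vector_Spaces.linear scale scale e"
    and linear_f: "Vector_Spaces.linear scale scale f"
    and linear_h: "Vector_Spaces.linear scale scale h"
    and e_in: "v \<in> V \<Longrightarrow> e v \<in> V"
    and f_in: "v \<in> V \<Longrightarrow> f v \<in> V"
    and ef_commutator: "v \<in> V \<Longrightarrow> e (f v) - f (e v) = h v"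
    and he_commutator: "v \<in> V \<Longrightarrow> h (e v) = e (h v) + 2 *s e v"
    and hf_commutator: "v \<in> V \<Longrightarrow> h (f v) = f (h v) - 2 *s f v"
    and nilpotent_e: "v \<in> V \<Longrightarrow> \<exists>n. (e ^^ n) v = 0"
    and nilpotent_f: "v \<in> V \<Longrightarrow> \<exists>n. (f ^^ n) v = 0"
begin

sublocale e: Vector_Spaces.linear scale scale e by (rule linear_e)
sublocale f: Vector_Spaces.linear scale scale f by (rule linear_f)
sublocale h: Vector_Spaces.linear scale scale h by (rule linear_h)

definition weight_space :: "'k \<Rightarrow> 'v set" where
  "weight_space c = {v \<in> V. h v = c *s v}"

lemma subspace_weight_space: "subspace (weight_space c)"
  using subspace_V unfolding weight_space_def subspace_def
  by (auto simp: h.add h.scale scale_right_distrib mult.commute h.zero)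

text \<open>The Weyl group symmetry of \<open>sl\<^sub>2\<close>: it turns a statement about highest weights into one about lowest
weights.\<close>

lemma swap: "sl2_module scale V f e (\<lambda>v. - h v)"
proof -
  interpret m: Vector_Spaces.linear scale scale "\<lambda>v. - h v"
    by unfold_locales (auto simp: h.add h.scale)
  show ?thesis
  proof unfold_locales
    fix v assume v: "v \<in> V"
    show "f (e v) - e (f v) = - h v" using ef_commutator[OF v] by (metis minus_diff_eq)
    show "- h (f v) = f (- h v) + 2 *s f v"
      using hf_commutator[OF v] by (simp add: f.neg)
    show "- h (e v) = e (- h v) - 2 *s e v"
      using he_commutator[OF v] by (simp add: e.neg)
  qed (use subspace_V finite_dim e_in f_in nilpotent_e nilpotent_f in \<open>auto simp: f.add f.scale\<close>)
qed

text \<open>If \<open>e (f v) = 0\<close>, then the relations force \<open>f (e\<^sup>n\<^sup>+\<^sup>1 v) = - (n + 1) (n + 2) e\<^sup>n v\<close> for all \<open>n\<close>. As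
the factor is nonzero in characteristic \<open>0\<close>, the vanishing of \<open>e\<^sup>n\<^sup>+\<^sup>1 v\<close> implies that of \<open>e\<^sup>n v\<close>;
starting from nilpotency, one descends to \<open>v = 0\<close>.\<close>

lemma ef_injective_on_weight_2:
  assumes v: "v \<in> weight_space 2" and ef: "e (f v) = 0"
  shows "v = 0"
proof -
  have V: "(e ^^ n) v \<in> V" for n
    using v by (induction n) (auto simp: weight_space_def e_in)
  have h: "h ((e ^^ n) v) = (2 + 2 * of_nat n) *s (e ^^ n) v" for n
  proof (induction n)
    case 0 then show ?case using v by (simp add: weight_space_def)
  next
    case (Suc n) then show ?case
      using he_commutator[OF V, of n]
      by (simp only: funpow.simps o_apply Suc.IH e.scale scale_left_distrib[symmetric])
        (simp add: algebra_simps)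
  qed
  have f: "f ((e ^^ Suc n) v) = - (of_nat ((n + 1) * (n + 2)) *s (e ^^ n) v)" for n
  proof (induction n)
    case 0
    have "e (f v) - f (e v) = 2 *s v" using ef_commutator v by (simp add: weight_space_def)
    then have "- f (e v) = 2 *s v" using ef by simp
    then have "f (e v) = - (2 *s v)" by (metis minus_minus)
    then show ?case by simp
  next
    case (Suc n)
    have "f ((e ^^ Suc (Suc n)) v) = e (f ((e ^^ Suc n) v)) - h ((e ^^ Suc n) v)"
      using ef_commutator[OF V, of "Suc n"] by (simp add: algebra_simps)
    also have "\<dots> = - (of_nat ((n + 1) * (n + 2)) *s (e ^^ Suc n) v)
        - (2 + 2 * of_nat (Suc n)) *s (e ^^ Suc n) v"
      unfolding Suc h by (simp add: e.neg e.scale)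
    also have "\<dots> = - ((of_nat ((n + 1) * (n + 2)) + (2 + 2 * of_nat (Suc n))) *s (e ^^ Suc n) v)"
      by (simp only: scale_left_distrib minus_add_distrib diff_conv_add_uminus)
    also have "of_nat ((n + 1) * (n + 2)) + (2 + 2 * of_nat (Suc n))
        = (of_nat ((Suc n + 1) * (Suc n + 2)) :: 'k)"
      by (simp add: algebra_simps)
    finally show ?case .
  qed
  have down: "(e ^^ n) v = 0" if "(e ^^ Suc n) v = 0" for n
  proof -
    have "of_nat ((n + 1) * (n + 2)) *s (e ^^ n) v = 0"
      using f[of n] that by (simp add: f.zero del: funpow.simps)
    then show ?thesis by (simp only: scale_eq_0_iff of_nat_eq_0_iff) simp
  qed
  have "v = 0" if "(e ^^ n) v = 0" for n
    using that by (induction n) (use down in auto)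
  then show ?thesis using nilpotent_e V[of 0] by auto
qed

text \<open>A vector annihilated by \<open>e\<close> and \<open>f\<close> has weight \<open>0\<close> because \<open>h = [e, f]\<close>. Conversely, if \<open>v\<close> has
weight \<open>0\<close> and \<open>e v = 0\<close>, then \<open>f v\<close> has weight \<open>-2\<close> and \<open>e (f v) = 0\<close>, so \<open>f v\<close> vanishes by the mirror
image of the previous lemma.\<close>

lemma invariants_eq_highest_weight_0:
  "{v \<in> V. e v = 0 \<and> f v = 0} = {v \<in> weight_space 0. e v = 0}"
proof (intro equalityI subsetI)
  fix v assume "v \<in> {v \<in> V. e v = 0 \<and> f v = 0}"
  then show "v \<in> {v \<in> weight_space 0. e v = 0}"
    using ef_commutator[of v] by (auto simp: weight_space_def e.zero f.zero)
next
  fix v assume v: "v \<in> {v \<in> weight_space 0. e v = 0}"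
  interpret s: sl2_module scale V f e "\<lambda>v. - h v" by (rule swap)
  have ef: "e (f v) = 0"
    using ef_commutator[of v] v by (auto simp: weight_space_def f.zero)
  have "h (f v) = - (2 *s f v)"
    using hf_commutator[of v] v by (auto simp: weight_space_def f.zero)
  then have "f v \<in> s.weight_space 2"
    using v f_in by (auto simp: s.weight_space_def weight_space_def)
  then have "f v = 0"
    by (rule s.ef_injective_on_weight_2) (simp add: ef f.zero)
  then show "v \<in> {v \<in> V. e v = 0 \<and> f v = 0}" using v by (simp add: weight_space_def)
qed

text \<open>Since \<open>e f\<close> is injective, hence bijective, on the weight space \<open>2\<close>, the map \<open>e\<close> from the weight space
\<open>0\<close> to the weight space \<open>2\<close> is onto; its kernel consists of the invariants.\<close>

lemma dim_invariants_plus_dim_weight_2: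
  "dim {v \<in> V. e v = 0 \<and> f v = 0} + dim (weight_space 2) = dim (weight_space 0)"
proof -
  obtain A where A: "finite A" "V \<subseteq> span A" using finite_dim by blast
  have sub: "weight_space c \<subseteq> span A" for c using A(2) by (auto simp: weight_space_def)
  have f2: "f v \<in> weight_space 0" if "v \<in> weight_space 2" for v
    using that f_in hf_commutator[of v] by (auto simp: weight_space_def f.scale)
  have e0: "e v \<in> weight_space 2" if "v \<in> weight_space 0" for v
    using that e_in he_commutator[of v] by (auto simp: weight_space_def e.zero)
  have "Vector_Spaces.linear scale scale (\<lambda>v. e (f v))"
    by unfold_locales (auto simp: e.add f.add e.scale f.scale)
  then have "(\<lambda>v. e (f v)) ` weight_space 2 = weight_space 2"
    by (rule inj_on_subspace_imp_surj[OF _ subspace_weight_space A(1) sub])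
      (use f2 e0 ef_injective_on_weight_2 in auto)
  then have "e ` weight_space 0 = weight_space 2"
    using f2 e0 by (auto simp: image_iff) (metis (no_types, lifting) image_iff)
  then show ?thesis
    using dim_kernel_plus_dim_image[OF linear_e subspace_weight_space A(1) sub, of 0]
    by (simp add: invariants_eq_highest_weight_0)
qed

end

section \<open>Tensor powers as functions of words\<close>

abbreviation words :: "'a set \<Rightarrow> nat \<Rightarrow> 'a list set" where
  "words Y m \<equiv> {w. set w \<subseteq> Y \<and> length w = m}"

lemma words_0: "words Y 0 = {[]}" by auto

lemma words_Suc: "words Y (Suc m) = (\<lambda>(y, w). y # w) ` (Y \<times> words Y m)"
  by (auto simp: length_Suc_conv image_iff)

lemma finite_words: "finite Y \<Longrightarrow> finite (words Y m)"
  by (rule finite_lists_length_eq)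

lemma sum_words_Suc:
  "(\<Sum>w\<in>words Y (Suc m). g w) = (\<Sum>y\<in>Y. \<Sum>w\<in>words Y m. g (y # w))"
  unfolding words_Suc sum.cartesian_product
  by (subst sum.reindex) (auto simp: inj_on_def case_prod_unfold)

text \<open>An element of the \<open>m\<close>-th tensor power of the free module on \<open>Y\<close> is represented by its coefficients, a
function of the words of length \<open>m\<close> over \<open>Y\<close>. If the linear map \<open>a\<close> sends \<open>y\<close> to \<open>\<Sum>\<^sub>x a y x \<cdot> x\<close>, then
\<open>tensor_act Y a v w\<close> is the coefficient at \<open>w\<close> of the image of \<open>v\<close> under the tensor power of \<open>a\<close>.\<close>

primrec tensor_act ::
    "'y set \<Rightarrow> ('y \<Rightarrow> 'x \<Rightarrow> 'k::comm_ring_1) \<Rightarrow> ('y list \<Rightarrow> 'k) \<Rightarrow> 'x list \<Rightarrow> 'k" where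
  "tensor_act Y a v [] = v []"
| "tensor_act Y a v (x # w) = (\<Sum>y\<in>Y. a y x * tensor_act Y a (\<lambda>w'. v (y # w')) w)"

text \<open>The corresponding coefficient for the derivation of the tensor algebra that extends \<open>a\<close>, that is for
the sum over all positions of \<open>a\<close> applied at one position.\<close>

primrec tensor_der ::
    "'y set \<Rightarrow> ('y \<Rightarrow> 'y \<Rightarrow> 'k::comm_ring_1) \<Rightarrow> ('y list \<Rightarrow> 'k) \<Rightarrow> 'y list \<Rightarrow> 'k" where
  "tensor_der Y a v [] = 0"
| "tensor_der Y a v (x # w)
    = (\<Sum>y\<in>Y. a y x * v (y # w)) + tensor_der Y a (\<lambda>w'. v (x # w')) w"

lemma tensor_act_add:
  "tensor_act Y a (\<lambda>w. v w + v' w) w = tensor_act Y a v w + tensor_act Y a v' w"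
  by (induction w arbitrary: v v') (simp_all add: distrib_left sum.distrib)

lemma tensor_act_scale: "tensor_act Y a (\<lambda>w. c * v w) w = c * tensor_act Y a v w"
  by (induction w arbitrary: v) (simp_all add: sum_distrib_left mult.left_commute)

lemma tensor_act_sum:
  "tensor_act Y a (\<lambda>w. \<Sum>z\<in>Z. c z * v z w) w = (\<Sum>z\<in>Z. c z * tensor_act Y a (v z) w)"
proof (induction w arbitrary: v)
  case (Cons x w)
  then show ?case
    by (simp add: sum_distrib_left mult.left_commute sum.swap[of _ Y])
qed simp

lemma tensor_act_cong:
  assumes "\<And>w'. w' \<in> words Y (length w) \<Longrightarrow> v w' = v' w'"
    and "\<And>y x. y \<in> Y \<Longrightarrow> x \<in> set w \<Longrightarrow> a y x = a' y x"
  shows "tensor_act Y a v w = tensor_act Y a' v' w"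
  using assms
proof (induction w arbitrary: v v')
  case (Cons x w)
  have "tensor_act Y a (\<lambda>w'. v (y # w')) w = tensor_act Y a' (\<lambda>w'. v' (y # w')) w" if "y \<in> Y" for y
    by (rule Cons.IH) (use Cons.prems that in auto)
  then show ?case using Cons.prems(2) by simp
qed simp

text \<open>Functoriality of the tensor power. With the convention that rows are indexed by the source, the
matrix of a composition is the product in the order of application.\<close>

lemma tensor_act_compose:
  "tensor_act Y a (tensor_act Z b v) w = tensor_act Z (\<lambda>z x. \<Sum>y\<in>Y. b z y * a y x) v w"
proof (induction w arbitrary: v)
  case (Cons x w)
  have "tensor_act Y a (tensor_act Z b v) (x # w)
      = (\<Sum>y\<in>Y. a y x * (\<Sum>z\<in>Z. b z y * tensor_act Y a (tensor_act Z b (\<lambda>w. v (z # w))) w))"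
    by (simp add: tensor_act_sum)
  also have "\<dots> = (\<Sum>z\<in>Z. (\<Sum>y\<in>Y. b z y * a y x)
      * tensor_act Y a (tensor_act Z b (\<lambda>w. v (z # w))) w)"
    unfolding sum_distrib_left sum_distrib_right sum.swap[of _ Y] by (simp add: mult_ac)
  finally show ?case by (simp add: Cons.IH)
qed simp

lemma tensor_act_id:
  assumes "finite Y" "set w \<subseteq> Y"
    and "\<And>y x. y \<in> Y \<Longrightarrow> x \<in> Y \<Longrightarrow> a y x = (if y = x then 1 else 0)"
  shows "tensor_act Y a v w = v w"
  using assms(2)
proof (induction w arbitrary: v)
  case (Cons x w)
  have "tensor_act Y a v (x # w) = (\<Sum>y\<in>Y. if y = x then v (y # w) else 0)"
    using Cons assms(3) by (auto intro!: sum.cong)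
  then show ?case using Cons.prems assms(1) by simp
qed simp

lemma tensor_act_eq_sum_words:
  "tensor_act Y a v w = (\<Sum>w'\<in>words Y (length w). v w' * prod_list (map2 a w' w))"
proof (induction w arbitrary: v)
  case Nil then show ?case by (simp add: words_0[simplified])
next
  case (Cons x w)
  then show ?case
    by (simp only: length_Cons sum_words_Suc tensor_act.simps)
      (simp add: sum_distrib_left mult_ac)
qed

lemma tensor_act_zero_letter:
  "x \<in> set w \<Longrightarrow> (\<And>y. y \<in> Y \<Longrightarrow> a y x = 0) \<Longrightarrow> tensor_act Y a v w = 0"
  by (induction w arbitrary: v) (auto intro!: sum.neutral)

lemma tensor_act_zero:
  "(\<And>w'. w' \<in> words Y (length w) \<Longrightarrow> v w' = 0) \<Longrightarrow> tensor_act Y a v w = 0"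
  by (simp add: tensor_act_eq_sum_words)

lemma tensor_der_add:
  "tensor_der Y a (\<lambda>w. v w + v' w) w = tensor_der Y a v w + tensor_der Y a v' w"
  by (induction w arbitrary: v v') (simp_all add: distrib_left sum.distrib)

lemma tensor_der_scale: "tensor_der Y a (\<lambda>w. c * v w) w = c * tensor_der Y a v w"
  by (induction w arbitrary: v) (simp_all add: sum_distrib_left mult.left_commute distrib_left)

lemma tensor_der_sum:
  "tensor_der Y a (\<lambda>w. \<Sum>z\<in>Z. c z * v z w) w = (\<Sum>z\<in>Z. c z * tensor_der Y a (v z) w)"
proof (induction w arbitrary: v)
  case (Cons x w)
  then show ?case
    by (simp add: sum_distrib_left mult.left_commute sum.swap[of _ Y] distrib_left sum.distrib)
qed simp

lemma tensor_der_cong: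
  assumes "set w \<subseteq> Y"
    and "\<And>w'. w' \<in> words Y (length w) \<Longrightarrow> v w' = v' w'"
    and "\<And>y x. y \<in> Y \<Longrightarrow> x \<in> Y \<Longrightarrow> a y x = a' y x"
  shows "tensor_der Y a v w = tensor_der Y a' v' w"
  using assms(1,2)
proof (induction w arbitrary: v v')
  case (Cons x w)
  have "tensor_der Y a (\<lambda>w'. v (x # w')) w = tensor_der Y a' (\<lambda>w'. v' (x # w')) w"
    by (rule Cons.IH) (use Cons.prems in auto)
  moreover have "(\<Sum>y\<in>Y. a y x * v (y # w)) = (\<Sum>y\<in>Y. a' y x * v' (y # w))"
    using Cons.prems assms(3) by (auto intro!: sum.cong)
  ultimately show ?case by simp
qed simp

text \<open>In the commutator the terms in which the two matrices act at different positions cancel, so that only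
the commutator of the matrices remains.\<close>

lemma tensor_der_commutator:
  "tensor_der Y a (tensor_der Y b v) w - tensor_der Y b (tensor_der Y a v) w
    = tensor_der Y (\<lambda>z x. (\<Sum>y\<in>Y. b z y * a y x) - (\<Sum>y\<in>Y. a z y * b y x)) v w"
proof (induction w arbitrary: v)
  case (Cons x w)
  have expand: "tensor_der Y a (tensor_der Y b v) (x # w)
      = (\<Sum>z\<in>Y. (\<Sum>y\<in>Y. b z y * a y x) * v (z # w))
        + ((\<Sum>y\<in>Y. a y x * tensor_der Y b (\<lambda>w. v (y # w)) w)
        + (\<Sum>y\<in>Y. b y x * tensor_der Y a (\<lambda>w. v (y # w)) w))
        + tensor_der Y a (tensor_der Y b (\<lambda>w. v (x # w))) w" for a b
  proof -
    have "(\<Sum>y\<in>Y. a y x * (\<Sum>z\<in>Y. b z y * v (z # w)))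
        = (\<Sum>z\<in>Y. (\<Sum>y\<in>Y. b z y * a y x) * v (z # w))"
      unfolding sum_distrib_left sum_distrib_right by (subst sum.swap) (simp add: mult_ac)
    then show ?thesis by (simp add: tensor_der_add tensor_der_sum distrib_left sum.distrib)
  qed
  show ?case
    unfolding expand tensor_der.simps(2)[of _ _ v] Cons.IH[symmetric]
    by (simp add: left_diff_distrib sum_subtractf)
qed simp

lemma tensor_der_diagonal:
  assumes "finite Y" "set w \<subseteq> Y"
    and "\<And>y x. y \<in> Y \<Longrightarrow> x \<in> Y \<Longrightarrow> a y x = (if y = x then c x else 0)"
  shows "tensor_der Y a v w = sum_list (map c w) * v w"
  using assms(2)
proof (induction w arbitrary: v)
  case (Cons x w)
  have "(\<Sum>y\<in>Y. a y x * v (y # w)) = (\<Sum>y\<in>Y. if y = x then c x * v (y # w) else 0)"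
    using Cons.prems assms(3) by (auto intro!: sum.cong)
  then show ?case using Cons assms(1) by (simp add: distrib_right)
qed simp

section \<open>Polynomial one-parameter groups and their derivative at zero\<close>

text \<open>A substitute for differentiation over an arbitrary field: \<open>f\<close> is given by a polynomial whose formal
derivative has the value \<open>d\<close> at \<open>0\<close>. Both are determined by \<open>f\<close>, the field being infinite.\<close>

definition poly_fun_deriv0 :: "('k::field_char_0 \<Rightarrow> 'k) \<Rightarrow> 'k \<Rightarrow> bool" where
  "poly_fun_deriv0 f d \<longleftrightarrow> (\<exists>P. (\<forall>t. f t = poly P t) \<and> poly (pderiv P) 0 = d)"

lemma poly_fun_deriv0_const: "poly_fun_deriv0 (\<lambda>_. c) 0"
  unfolding poly_fun_deriv0_def by (rule exI[of _ "[:c:]"]) auto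

lemma poly_fun_deriv0_add:
  assumes "poly_fun_deriv0 f d" "poly_fun_deriv0 g d'"
  shows "poly_fun_deriv0 (\<lambda>t. f t + g t) (d + d')"
proof -
  obtain P Q where "\<forall>t. f t = poly P t" "poly (pderiv P) 0 = d"
    "\<forall>t. g t = poly Q t" "poly (pderiv Q) 0 = d'"
    using assms unfolding poly_fun_deriv0_def by blast
  then show ?thesis unfolding poly_fun_deriv0_def
    by (intro exI[of _ "P + Q"]) (auto simp: pderiv_add)
qed

lemma poly_fun_deriv0_mult:
  assumes "poly_fun_deriv0 f d" "poly_fun_deriv0 g d'"
  shows "poly_fun_deriv0 (\<lambda>t. f t * g t) (d * g 0 + f 0 * d')"
proof -
  obtain P Q where "\<forall>t. f t = poly P t" "poly (pderiv P) 0 = d"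
    "\<forall>t. g t = poly Q t" "poly (pderiv Q) 0 = d'"
    using assms unfolding poly_fun_deriv0_def by blast
  then show ?thesis unfolding poly_fun_deriv0_def
    by (intro exI[of _ "P * Q"]) (auto simp: pderiv_mult)
qed

lemma poly_fun_deriv0_sum:
  "(\<And>y. y \<in> Y \<Longrightarrow> poly_fun_deriv0 (f y) (d y)) \<Longrightarrow>
    poly_fun_deriv0 (\<lambda>t. \<Sum>y\<in>Y. f y t) (\<Sum>y\<in>Y. d y)"
  by (induction Y rule: infinite_finite_induct)
    (auto intro: poly_fun_deriv0_const poly_fun_deriv0_add)

lemma poly_fun_deriv0_monom: "poly_fun_deriv0 (\<lambda>t. c * t ^ n) (if n = 1 then c else 0)"
  unfolding poly_fun_deriv0_def
  by (rule exI[of _ "monom c n"]) (auto simp: poly_monom pderiv_monom power_0_left)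

lemma poly_fun_deriv0_unique:
  assumes "poly_fun_deriv0 f d" "poly_fun_deriv0 f d'"
  shows "d = d'"
proof -
  obtain P Q where "\<forall>t. f t = poly P t" "poly (pderiv P) 0 = d"
    "\<forall>t. f t = poly Q t" "poly (pderiv Q) 0 = d'"
    using assms unfolding poly_fun_deriv0_def by blast
  moreover from this have "P = Q" by (metis ext poly_eq_poly_eq_iff)
  ultimately show ?thesis by simp
qed

lemma constant_if_derivative_zero:
  assumes "poly_fun_deriv0 f d0" and shift: "\<And>r. poly_fun_deriv0 (\<lambda>t. f (t + r)) 0"
  shows "f t = f 0"
proof -
  obtain P where P: "\<forall>t. f t = poly P t" using assms(1) unfolding poly_fun_deriv0_def by blast
  have "poly (pderiv P) r = 0" for r
  proof (rule poly_fun_deriv0_unique[OF _ shift[of r]])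
    show "poly_fun_deriv0 (\<lambda>t. f (t + r)) (poly (pderiv P) r)"
      unfolding poly_fun_deriv0_def
      by (rule exI[of _ "pcompose P [:r, 1:]"])
        (auto simp: P poly_pcompose pderiv_pcompose pderiv_pCons add.commute)
  qed
  then have "pderiv P = 0" using poly_all_0_iff_0 by blast
  then obtain c where "P = [:c:]" using pderiv_eq_0_iff degree_eq_zeroE by metis
  then show ?thesis using P by simp
qed

text \<open>The product rule, applied one letter at a time.\<close>

lemma tensor_act_derivative:
  assumes "finite Y" "set w \<subseteq> Y"
    and der: "\<And>y x. y \<in> Y \<Longrightarrow> x \<in> Y \<Longrightarrow> poly_fun_deriv0 (\<lambda>t. a t y x) (e y x)"
    and a0: "\<And>y x. y \<in> Y \<Longrightarrow> x \<in> Y \<Longrightarrow> a 0 y x = (if y = x then 1 else 0)"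
  shows "poly_fun_deriv0 (\<lambda>t. tensor_act Y (a t) v w) (tensor_der Y e v w)"
  using assms(2)
proof (induction w arbitrary: v)
  case Nil then show ?case by (simp add: poly_fun_deriv0_const)
next
  case (Cons x w)
  have "poly_fun_deriv0 (\<lambda>t. \<Sum>y\<in>Y. a t y x * tensor_act Y (a t) (\<lambda>w'. v (y # w')) w)
      (\<Sum>y\<in>Y. e y x * tensor_act Y (a 0) (\<lambda>w'. v (y # w')) w
        + a 0 y x * tensor_der Y e (\<lambda>w'. v (y # w')) w)"
    using Cons der by (intro poly_fun_deriv0_sum poly_fun_deriv0_mult) auto
  also have "(\<Sum>y\<in>Y. e y x * tensor_act Y (a 0) (\<lambda>w'. v (y # w')) w
        + a 0 y x * tensor_der Y e (\<lambda>w'. v (y # w')) w) = tensor_der Y e v (x # w)"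
  proof -
    have "tensor_act Y (a 0) (\<lambda>w'. v (y # w')) w = v (y # w)" for y
      by (rule tensor_act_id[OF assms(1) _ a0]) (use Cons.prems in auto)
    moreover have "(\<Sum>y\<in>Y. a 0 y x * tensor_der Y e (\<lambda>w'. v (y # w')) w)
        = (\<Sum>y\<in>Y. if y = x then tensor_der Y e (\<lambda>w'. v (y # w')) w else 0)"
      using Cons.prems by (intro sum.cong) (auto simp: a0)
    ultimately show ?thesis using Cons.prems assms(1) by (simp add: sum.distrib)
  qed
  finally show ?case by simp
qed

text \<open>For the nontrivial direction let \<open>D v = 0\<close>, where \<open>D\<close> is the derivative of the action \<open>A(t)\<close> at \<open>0\<close>. As
\<open>A(t + r) v = A(r) A(t) v\<close> and \<open>A(r)\<close> is linear, the derivative of \<open>A(t) v\<close> at every \<open>r\<close> is \<open>A(r) D v = 0\<close>.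
So each coefficient of \<open>A(t) v\<close> is a constant polynomial, with the value \<open>v\<close> at \<open>t = 0\<close>.\<close>

lemma tensor_act_fixed_iff_der_zero:
  assumes "finite Y"
    and der: "\<And>y x. y \<in> Y \<Longrightarrow> x \<in> Y \<Longrightarrow> poly_fun_deriv0 (\<lambda>t. a t y x) (e y x)"
    and a0: "\<And>y x. y \<in> Y \<Longrightarrow> x \<in> Y \<Longrightarrow> a 0 y x = (if y = x then 1 else 0)"
    and hom: "\<And>y x t r. y \<in> Y \<Longrightarrow> x \<in> Y \<Longrightarrow> a (t + r) y x = (\<Sum>z\<in>Y. a t y z * a r z x)"
  shows "(\<forall>t. \<forall>w\<in>words Y m. tensor_act Y (a t) v w = v w)
    \<longleftrightarrow> (\<forall>w\<in>words Y m. tensor_der Y e v w = 0)"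
proof (intro iffI allI ballI)
  fix w assume fixed: "\<forall>t. \<forall>w\<in>words Y m. tensor_act Y (a t) v w = v w" and w: "w \<in> words Y m"
  have "poly_fun_deriv0 (\<lambda>t. tensor_act Y (a t) v w) (tensor_der Y e v w)"
    using w by (intro tensor_act_derivative assms(1) der a0) auto
  then have "poly_fun_deriv0 (\<lambda>t. v w) (tensor_der Y e v w)" using fixed w by simp
  then show "tensor_der Y e v w = 0" by (rule poly_fun_deriv0_unique[OF _ poly_fun_deriv0_const])
next
  fix t w assume zero: "\<forall>w\<in>words Y m. tensor_der Y e v w = 0" and w: "w \<in> words Y m"
  have *: "poly_fun_deriv0 (\<lambda>t. tensor_act Y (a t) v w) (tensor_der Y e v w)"
    if "w \<in> words Y m" for w
    using that by (intro tensor_act_derivative assms(1) der a0) auto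
  have "poly_fun_deriv0 (\<lambda>t. tensor_act Y (a (t + r)) v w) 0" for r
  proof -
    have eq: "tensor_act Y (a (t + r)) v w
        = (\<Sum>w'\<in>words Y (length w). tensor_act Y (a t) v w' * prod_list (map2 (a r) w' w))" for t
    proof -
      have "tensor_act Y (a (t + r)) v w = tensor_act Y (a r) (tensor_act Y (a t) v) w"
        unfolding tensor_act_compose by (rule tensor_act_cong) (use hom w in auto)
      then show ?thesis by (simp only: tensor_act_eq_sum_words[of Y "a r"])
    qed
    have "poly_fun_deriv0 (\<lambda>t. tensor_act Y (a t) v w' * prod_list (map2 (a r) w' w)) 0"
      if "w' \<in> words Y (length w)" for w'
      using poly_fun_deriv0_mult[OF * poly_fun_deriv0_const, of w' "prod_list (map2 (a r) w' w)"]
        that w zero by simp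
    then have "poly_fun_deriv0
        (\<lambda>t. \<Sum>w'\<in>words Y (length w). tensor_act Y (a t) v w' * prod_list (map2 (a r) w' w))
        (\<Sum>w'\<in>words Y (length w). 0)"
      by (intro poly_fun_deriv0_sum)
    then show ?thesis unfolding eq by simp
  qed
  then have "tensor_act Y (a t) v w = tensor_act Y (a 0) v w"
    by (rule constant_if_derivative_zero[OF *[OF w]])
  also have "\<dots> = v w" by (rule tensor_act_id[OF assms(1) _ a0]) (use w in auto)
  finally show "tensor_act Y (a t) v w = v w" .
qed

section \<open>The action of sl(2) on tensor powers\<close>

definition fun_scale :: "'k::field \<Rightarrow> ('i \<Rightarrow> 'k) \<Rightarrow> ('i \<Rightarrow> 'k)" where
  "fun_scale c v = (\<lambda>i. c * v i)"

interpretation fun_space: vector_space "fun_scale :: 'k::field \<Rightarrow> ('i \<Rightarrow> 'k) \<Rightarrow> _"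
  by unfold_locales (auto simp: fun_scale_def fun_eq_iff algebra_simps)

definition supported :: "'i set \<Rightarrow> ('i \<Rightarrow> 'k::zero) set" where
  "supported G = {v. \<forall>i. i \<notin> G \<longrightarrow> v i = 0}"

lemma supported_0: "v \<in> supported G \<Longrightarrow> i \<notin> G \<Longrightarrow> v i = 0"
  by (simp add: supported_def)

definition indicator_vec :: "'i \<Rightarrow> 'i \<Rightarrow> 'k::field" where
  "indicator_vec i = (\<lambda>j. if j = i then 1 else 0)"

lemma subspace_supported: "fun_space.subspace (supported G)"
  by (auto simp: fun_space.subspace_def supported_def fun_scale_def)

lemma sum_fun_apply: "(\<Sum>a\<in>A. g a) i = (\<Sum>a\<in>A. (g a i :: 'k::comm_monoid_add))"
  by (induction A rule: infinite_finite_induct) auto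

lemma inj_indicator_vec: "inj (indicator_vec :: 'i \<Rightarrow> 'i \<Rightarrow> 'k::field)"
  by (rule injI) (metis indicator_vec_def zero_neq_one)

lemma sum_indicator_vec:
  assumes "finite G"
  shows "(\<Sum>i\<in>G. fun_scale (a i) (indicator_vec i)) j = (if j \<in> G then a j else (0::'k::field))"
proof -
  have "(\<Sum>i\<in>G. fun_scale (a i) (indicator_vec i)) j = (\<Sum>i\<in>G. if j = i then a i else 0)"
    unfolding sum_fun_apply by (rule sum.cong) (auto simp: fun_scale_def indicator_vec_def)
  then show ?thesis using assms by simp
qed

lemma supported_eq_sum:
  assumes "finite G" "v \<in> supported G"
  shows "v = (\<Sum>i\<in>G. fun_scale (v i) (indicator_vec i))"
  using assms by (auto simp: fun_eq_iff sum_indicator_vec supported_def)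

lemma supported_span:
  assumes "finite G"
  shows "supported G \<subseteq> fun_space.span (indicator_vec ` G :: ('i \<Rightarrow> 'k::field) set)"
proof
  fix v :: "'i \<Rightarrow> 'k" assume "v \<in> supported G"
  then have v: "v = (\<Sum>i\<in>G. fun_scale (v i) (indicator_vec i))"
    by (rule supported_eq_sum[OF assms])
  have "(\<Sum>i\<in>G. fun_scale (v i) (indicator_vec i)) \<in> fun_space.span (indicator_vec ` G)"
    by (intro fun_space.span_sum fun_space.span_scale fun_space.span_base) auto
  then show "v \<in> fun_space.span (indicator_vec ` G)" using v by simp
qed

lemma dim_supported:
  assumes "finite G"
  shows "fun_space.dim (supported G :: ('i \<Rightarrow> 'k::field) set) = card G"
proof -
  let ?B = "indicator_vec ` G :: ('i \<Rightarrow> 'k) set"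
  have ind: "fun_space.independent ?B"
  proof (rule fun_space.independent_if_scalars_zero)
    show "finite ?B" using assms by simp
    fix a :: "('i \<Rightarrow> 'k) \<Rightarrow> 'k" and b
    assume 0: "(\<Sum>x\<in>?B. fun_scale (a x) x) = 0" and "b \<in> ?B"
    then obtain g where g: "g \<in> G" "b = indicator_vec g" by blast
    have "(\<Sum>i\<in>G. fun_scale (a (indicator_vec i)) (indicator_vec i)) = (0 :: 'i \<Rightarrow> 'k)"
      using 0 by (subst (asm) sum.reindex) (auto intro: inj_on_subset[OF inj_indicator_vec])
    from fun_cong[OF this, of g] show "a b = 0" using g assms by (simp add: sum_indicator_vec)
  qed
  have "fun_space.dim (supported G :: ('i \<Rightarrow> 'k) set) = card ?B"
    by (rule fun_space.basis_card_eq_dim[symmetric, OF _ supported_span[OF assms] ind])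
      (auto simp: supported_def indicator_vec_def)
  also have "\<dots> = card G" by (rule card_image) (rule inj_on_subset[OF inj_indicator_vec subset_UNIV])
  finally show ?thesis .
qed

definition word_weight :: "('b \<Rightarrow> int) \<Rightarrow> 'b list \<Rightarrow> int" where
  "word_weight c w = sum_list (map c w)"

lemma word_weight_simps [simp]:
  "word_weight c [] = 0" "word_weight c (x # w) = c x + word_weight c w"
  by (simp_all add: word_weight_def)

lemma of_int_word_weight: "of_int (word_weight c w) = (\<Sum>x\<leftarrow>w. of_int (c x))"
  by (induction w) simp_all

text \<open>This is the relation \<open>[h, D] = d D\<close>, where \<open>h\<close> multiplies the coefficient at a word by the weight of the
word and \<open>D\<close> is the derivation of a matrix that raises weights by \<open>d\<close>.\<close>

lemma tensor_der_shifts_weight: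
  fixes a :: "'b \<Rightarrow> 'b \<Rightarrow> 'k::comm_ring_1" and c :: "'b \<Rightarrow> int"
  assumes "\<And>y x. a y x \<noteq> 0 \<Longrightarrow> c x = c y + d"
  shows "tensor_der Y a (\<lambda>w. of_int (word_weight c w) * v w) w
    = of_int (word_weight c w - d) * tensor_der Y a v w"
proof (induction w arbitrary: v)
  case (Cons x w)
  have "a y x * (of_int (c y + word_weight c w) * v (y # w))
      = of_int (c x + word_weight c w - d) * (a y x * v (y # w))" for y
    using assms[of y x] by (cases "a y x = 0") (auto simp: algebra_simps)
  moreover have "tensor_der Y a (\<lambda>w'. of_int (c x + word_weight c w') * v (x # w')) w
      = of_int (c x) * tensor_der Y a (\<lambda>w'. v (x # w')) w
        + tensor_der Y a (\<lambda>w'. of_int (word_weight c w') * v (x # w')) w"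
    by (simp add: distrib_right tensor_der_add tensor_der_scale)
  ultimately show ?case
    by (simp add: Cons.IH sum_distrib_left algebra_simps del: of_int_add of_int_diff)
      (simp add: algebra_simps)
qed simp

lemma tensor_der_support:
  fixes a :: "'b \<Rightarrow> 'b \<Rightarrow> 'k::comm_ring_1" and c :: "'b \<Rightarrow> int"
  assumes shift: "\<And>y x. a y x \<noteq> 0 \<Longrightarrow> c x = c y + d"
    and "set w \<subseteq> Y" "tensor_der Y a v w \<noteq> 0"
  shows "\<exists>w'\<in>words Y (length w). v w' \<noteq> 0 \<and> word_weight c w = word_weight c w' + d"
  using assms(2,3)
proof (induction w arbitrary: v)
  case (Cons x w)
  then consider "(\<Sum>y\<in>Y. a y x * v (y # w)) \<noteq> 0" | "tensor_der Y a (\<lambda>w'. v (x # w')) w \<noteq> 0"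
    by fastforce
  then show ?case
  proof cases
    case 1
    then obtain y where "y \<in> Y" "a y x * v (y # w) \<noteq> 0" by (meson sum.neutral)
    then have "a y x \<noteq> 0" "v (y # w) \<noteq> 0" by auto
    then show ?thesis using shift[of y x] Cons.prems(1) \<open>y \<in> Y\<close>
      by (intro bexI[of _ "y # w"]) auto
  next
    case 2
    then obtain w' where "w' \<in> words Y (length w)" "v (x # w') \<noteq> 0"
      "word_weight c w = word_weight c w' + d"
      using Cons.IH[of "\<lambda>w'. v (x # w')"] Cons.prems(1) by auto
    then show ?thesis using Cons.prems(1) by (intro bexI[of _ "x # w'"]) auto
  qed
qed simp

text \<open>\<open>S\<close> indexes the copies of the tensor power; the operator acts on each copy separately. The cut-off
keeps the result supported on the finite set \<open>S \<times> L\<close>.\<close>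

definition lift_op ::
    "'s set \<Rightarrow> 'b list set \<Rightarrow> (('b list \<Rightarrow> 'k::field) \<Rightarrow> 'b list \<Rightarrow> 'k)
      \<Rightarrow> ('s \<times> 'b list \<Rightarrow> 'k) \<Rightarrow> 's \<times> 'b list \<Rightarrow> 'k" where
  "lift_op S L T v = (\<lambda>(s, w). if s \<in> S \<and> w \<in> L then T (\<lambda>w'. v (s, w')) w else 0)"

lemma lift_op_supported: "lift_op S L T v \<in> supported (S \<times> L)"
  by (auto simp: lift_op_def supported_def)

lemma linear_lift_tensor_der:
  "Vector_Spaces.linear fun_scale fun_scale (lift_op S L (tensor_der Y a))"
  by unfold_locales
    (auto simp: lift_op_def fun_eq_iff fun_scale_def tensor_der_add tensor_der_scale)

text \<open>Each application shifts the weights by \<open>d\<close>, and words of length \<open>m\<close> over a finite alphabet have bounded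
weights.\<close>

lemma lift_tensor_der_nilpotent:
  fixes a :: "'b \<Rightarrow> 'b \<Rightarrow> 'k::field" and c :: "'b \<Rightarrow> int"
  assumes "finite Y" "d \<noteq> 0" and shift: "\<And>y x. a y x \<noteq> 0 \<Longrightarrow> c x = c y + d"
    and v: "v \<in> supported (S \<times> words Y m)"
  shows "\<exists>n. (lift_op S (words Y m) (tensor_der Y a) ^^ n) v = 0"
proof -
  let ?E = "lift_op S (words Y m) (tensor_der Y a)"
  have step: "\<exists>w'\<in>words Y m. v (s, w') \<noteq> 0 \<and> word_weight c w = word_weight c w' + int n * d"
    if "(?E ^^ n) v (s, w) \<noteq> 0" for n s w
    using that
  proof (induction n arbitrary: w)
    case 0
    then have "w \<in> words Y m" using supported_0[OF v, of "(s, w)"] by force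
    then show ?case using 0 by auto
  next
    case (Suc n)
    then have "?E ((?E ^^ n) v) (s, w) \<noteq> 0" by simp
    then have w: "w \<in> words Y m" and "tensor_der Y a (\<lambda>w'. (?E ^^ n) v (s, w')) w \<noteq> 0"
      unfolding lift_op_def[of S "words Y m" "tensor_der Y a" "(?E ^^ n) v"]
      by (simp_all split: if_splits)
    from tensor_der_support[where a = a and c = c, OF shift _ this(2)] w obtain w' where
      "(?E ^^ n) v (s, w') \<noteq> 0" "word_weight c w = word_weight c w' + d" by auto
    with Suc.IH[OF this(1)] show ?case by (auto simp: algebra_simps)
  qed
  obtain M where M: "\<forall>w\<in>words Y m. \<bar>word_weight c w\<bar> \<le> M"
    using finite_words[OF assms(1), of m] finite_imageI[of "words Y m" "\<lambda>w. \<bar>word_weight c w\<bar>"]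
    by (metis (no_types, lifting) Max_ge imageI)
  (* Two weights differ by at most 2 * M, while n applications shift by at least n. *)
  define n where "n = nat (2 * M + 1)"
  have "(?E ^^ n) v = 0"
  proof (rule ccontr)
    assume "(?E ^^ n) v \<noteq> 0"
    then obtain s w where sw: "(?E ^^ n) v (s, w) \<noteq> 0" by (auto simp: fun_eq_iff)
    then have "w \<in> words Y m"
    proof (cases n)
      case 0 then show ?thesis using supported_0[OF v, of "(s, w)"] sw by force
    next
      case (Suc n') then show ?thesis using sw by (auto simp: lift_op_def split: if_splits)
    qed
    moreover obtain w' where "w' \<in> words Y m" "word_weight c w = word_weight c w' + int n * d"
      using step[OF sw] by blast
    moreover from calculation have "\<bar>word_weight c w\<bar> \<le> M" "\<bar>word_weight c w'\<bar> \<le> M"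
      using M by blast+
    ultimately have "\<bar>int n * d\<bar> \<le> 2 * M" "0 \<le> M" by linarith+
    moreover have "int n \<le> \<bar>int n * d\<bar>" using assms(2)
        by (simp add: abs_mult mult_le_cancel_left1) arith
    ultimately show False by (simp add: n_def)
  qed
  then show ?thesis by blast
qed

text \<open>The pair \<open>(i, j)\<close> stands for the monomial \<open>v\<^sub>1\<^sup>n\<^sup>-\<^sup>j v\<^sub>2\<^sup>j\<close>, \<open>n = n i\<close>, in the \<open>i\<close>-th summand, on which
the torus acts with weight \<open>n - 2 j\<close>. On these monomials the raising operator is \<open>v\<^sub>1 \<partial>/\<partial>v\<^sub>2\<close> and the
lowering operator is \<open>v\<^sub>2 \<partial>/\<partial>v\<^sub>1\<close>.\<close>

definition weight_basis :: "nat \<Rightarrow> (nat \<Rightarrow> nat) \<Rightarrow> (nat \<times> nat) set" where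
  "weight_basis k n = (SIGMA i:{1..k}. {..n i})"

definition basis_weight :: "(nat \<Rightarrow> nat) \<Rightarrow> nat \<times> nat \<Rightarrow> int" where
  "basis_weight n y = int (n (fst y)) - 2 * int (snd y)"

definition raising :: "nat \<times> nat \<Rightarrow> nat \<times> nat \<Rightarrow> 'k::field_char_0" where
  "raising y x = (if fst y = fst x \<and> snd y = Suc (snd x) then of_nat (snd y) else 0)"

definition lowering :: "(nat \<Rightarrow> nat) \<Rightarrow> nat \<times> nat \<Rightarrow> nat \<times> nat \<Rightarrow> 'k::field_char_0" where
  "lowering n y x
    = (if fst y = fst x \<and> snd x = Suc (snd y) then of_int (int (n (fst y)) - int (snd y)) else 0)"

lemma finite_weight_basis: "finite (weight_basis k n)"
  by (simp add: weight_basis_def)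

lemma raising_shifts: "raising y x \<noteq> (0::'k::field_char_0)
    \<Longrightarrow> basis_weight n x = basis_weight n y + 2"
  by (auto simp: raising_def basis_weight_def split: if_splits)

lemma lowering_shifts: "lowering n y x \<noteq> (0::'k::field_char_0)
    \<Longrightarrow> basis_weight n x = basis_weight n y + (- 2)"
  by (auto simp: lowering_def basis_weight_def split: if_splits)

text \<open>On \<open>v\<^sub>1\<^sup>n\<^sup>-\<^sup>j v\<^sub>2\<^sup>j\<close> the two compositions act by \<open>(n - j) (j + 1)\<close> and \<open>j (n - j + 1)\<close>, whose difference is
the weight \<open>n - 2 j\<close>. At the ends \<open>j = n\<close> and \<open>j = 0\<close>, where a neighbour is missing, its coefficient is \<open>0\<close>.\<close>

lemma raising_lowering_commutator:
  assumes z: "z \<in> weight_basis k n" and x: "x \<in> weight_basis k n"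
  shows "(\<Sum>y\<in>weight_basis k n. lowering n z y * raising y x)
      - (\<Sum>y\<in>weight_basis k n. raising z y * lowering n y x)
    = (if z = x then of_int (basis_weight n x) else (0 :: 'k::field_char_0))"
proof -
  obtain i j where xij: "x = (i, j)" by (cases x)
  have ij: "i \<in> {1..k}" "j \<le> n i" using x by (auto simp: xij weight_basis_def)
  have "(\<Sum>y\<in>weight_basis k n. lowering n z y * raising y x)
      = (\<Sum>y\<in>weight_basis k n. if y = (i, Suc j) then
          (if z = x then of_int ((int (n i) - int j) * (int j + 1)) else (0::'k)) else 0)"
    by (rule sum.cong) (auto simp: lowering_def raising_def xij prod_eq_iff)
  also have "\<dots> = (if z = x then of_int ((int (n i) - int j) * (int j + 1)) else 0)"
    using ij finite_weight_basis[of k n] by (auto simp: weight_basis_def)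
  finally have 1: "(\<Sum>y\<in>weight_basis k n. lowering n z y * raising y x) = \<dots>" .
  have "(\<Sum>y\<in>weight_basis k n. raising z y * lowering n y x)
      = (\<Sum>y\<in>weight_basis k n. if y = (i, j - 1) then
          (if z = x then of_int (int j * (int (n i) - int j + 1)) else (0::'k)) else 0)"
    by (rule sum.cong) (auto simp: lowering_def raising_def xij prod_eq_iff of_nat_diff)
  also have "\<dots> = (if z = x then of_int (int j * (int (n i) - int j + 1)) else 0)"
    using ij finite_weight_basis[of k n] by (auto simp: weight_basis_def)
  finally have 2: "(\<Sum>y\<in>weight_basis k n. raising z y * lowering n y x) = \<dots>" .
  show ?thesis unfolding 1 2 by (auto simp: basis_weight_def xij algebra_simps)
qed

text \<open>The invariants of \<open>sl\<^sub>2\<close> in \<open>card S\<close> copies of the \<open>m\<close>-th tensor power: a basis of a weight space is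
given by the words of that weight, so the dimensions of weight spaces are numbers of words.\<close>

lemma dim_annihilated_tensors:
  fixes S :: "'s set" and n :: "nat \<Rightarrow> nat" and k m :: nat
  assumes "finite S"
  defines "L \<equiv> words (weight_basis k n) m"
  defines "N \<equiv> \<lambda>d. card {w \<in> L. word_weight (basis_weight n) w = d}"
  shows "fun_space.dim {v \<in> supported (S \<times> L) :: (_ \<Rightarrow> 'k::field_char_0) set.
        (\<forall>s\<in>S. \<forall>w\<in>L. tensor_der (weight_basis k n) raising (\<lambda>w. v (s, w)) w = 0)
        \<and> (\<forall>s\<in>S. \<forall>w\<in>L. tensor_der (weight_basis k n) (lowering n) (\<lambda>w. v (s, w)) w = 0)}
      + card S * N 2 = card S * N 0"
proof -
  let ?Y = "weight_basis k n"
  let ?wt = "word_weight (basis_weight n)"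
  let ?V = "supported (S \<times> L) :: (_ \<Rightarrow> 'k) set"
  define e f :: "('s \<times> (nat \<times> nat) list \<Rightarrow> 'k) \<Rightarrow> _"
    where "e = lift_op S L (tensor_der ?Y raising)" and "f
        = lift_op S L (tensor_der ?Y (lowering n))"
  define h :: "('s \<times> (nat \<times> nat) list \<Rightarrow> 'k) \<Rightarrow> _"
    where "h = (\<lambda>v (s, w). of_int (?wt w) * v (s, w))"
  have finL: "finite L" unfolding L_def by (rule finite_words[OF finite_weight_basis])
  have fin: "finite (S \<times> L)" using finL assms(1) by simp
  have cut: "tensor_der ?Y a (\<lambda>w'. lift_op S L T v (s, w')) w
      = tensor_der ?Y a (T (\<lambda>w'. v (s, w'))) w" if "s \<in> S" "w \<in> L" for a T v s w
    by (rule tensor_der_cong) (use that in \<open>auto simp: lift_op_def L_def\<close>)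
  have apply_in: "lift_op S L T u (s, w) = T (\<lambda>w'. u (s, w')) w" if "s \<in> S" "w \<in> L"
    for T and u :: "_ \<Rightarrow> 'k" and s w
    using that by (simp add: lift_op_def)
  have shift_e: "tensor_der ?Y raising (\<lambda>w. of_int (?wt w) * v w) w
      = of_int (?wt w - 2) * tensor_der ?Y raising v w" for v :: "_ \<Rightarrow> 'k" and w
    by (rule tensor_der_shifts_weight) (rule raising_shifts)
  have shift_f: "tensor_der ?Y (lowering n) (\<lambda>w. of_int (?wt w) * v w) w
      = of_int (?wt w - - 2) * tensor_der ?Y (lowering n) v w" for v :: "_ \<Rightarrow> 'k" and w
    by (rule tensor_der_shifts_weight) (rule lowering_shifts)
  interpret sl2_module fun_scale ?V e f h
  proof (intro sl2_module.intro sl2_module_axioms.intro)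
    show "vector_space (fun_scale :: 'k \<Rightarrow> ('s \<times> (nat \<times> nat) list \<Rightarrow> 'k) \<Rightarrow> _)"
      by unfold_locales
    show "\<exists>A. finite A \<and> ?V \<subseteq> fun_space.span A"
      using supported_span[OF fin] fin by blast
    show "Vector_Spaces.linear fun_scale fun_scale h"
      by unfold_locales (auto simp: h_def fun_scale_def fun_eq_iff algebra_simps)
    show "Vector_Spaces.linear fun_scale fun_scale e" "Vector_Spaces.linear fun_scale fun_scale f"
      unfolding e_def f_def by (rule linear_lift_tensor_der)+
    fix v assume v: "v \<in> ?V"
    show "e v \<in> ?V" "f v \<in> ?V" unfolding e_def f_def by (rule lift_op_supported)+
    show "\<exists>j. (e ^^ j) v = 0"
      unfolding e_def L_def
      by (rule lift_tensor_der_nilpotent[OF finite_weight_basis _ raising_shifts])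
        (use v L_def in auto)
    show "\<exists>j. (f ^^ j) v = 0"
      unfolding f_def L_def
      by (rule lift_tensor_der_nilpotent[OF finite_weight_basis _ lowering_shifts])
        (use v L_def in auto)
    show "e (f v) - f (e v) = h v"
    proof
      fix i :: "'s \<times> (nat \<times> nat) list"
      obtain s w where i: "i = (s, w)" by (cases i)
      show "(e (f v) - f (e v)) i = h v i"
      proof (cases "s \<in> S \<and> w \<in> L")
        case True
        then have sw: "s \<in> S" "w \<in> L" by auto
        have "(e (f v) - f (e v)) (s, w)
            = tensor_der ?Y raising (tensor_der ?Y (lowering n) (\<lambda>w'. v (s, w'))) w
              - tensor_der ?Y (lowering n) (tensor_der ?Y raising (\<lambda>w'. v (s, w'))) w"
          by (simp only: minus_apply e_def f_def apply_in[OF sw] cut[OF sw])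
        also have "\<dots> = of_int (?wt w) * v (s, w)"
          unfolding tensor_der_commutator
          using True tensor_der_diagonal[where w = w and v = "\<lambda>w'. v (s, w')",
            OF finite_weight_basis _ raising_lowering_commutator]
          by (simp add: L_def of_int_word_weight)
        finally show ?thesis by (simp add: i h_def)
      next
        case False
        then show ?thesis using supported_0[OF v, of "(s, w)"]
          by (auto simp: i e_def f_def lift_op_def h_def)
      qed
    qed
    show "h (e v) = e (h v) + fun_scale 2 (e v)"
      by (auto simp: h_def e_def lift_op_def fun_scale_def fun_eq_iff shift_e left_diff_distrib)
    show "h (f v) = f (h v) - fun_scale 2 (f v)"
      by (auto simp: h_def f_def lift_op_def fun_scale_def fun_eq_iff shift_f distrib_right)
  qed (rule subspace_supported)
  have weight: "fun_space.dim (weight_space (of_int d)) = card S * N d" for d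
  proof -
    have "weight_space (of_int d) = supported (S \<times> {w \<in> L. ?wt w = d})"
      unfolding weight_space_def
      by (auto simp: supported_def h_def fun_scale_def fun_eq_iff)
    then show ?thesis
      using dim_supported[of "S \<times> {w \<in> L. ?wt w = d}"] finL assms(1)
      by (simp add: N_def card_cartesian_product)
  qed
  have "{v \<in> ?V. e v = 0 \<and> f v = 0} = {v \<in> ?V.
        (\<forall>s\<in>S. \<forall>w\<in>L. tensor_der ?Y raising (\<lambda>w. v (s, w)) w = 0)
        \<and> (\<forall>s\<in>S. \<forall>w\<in>L. tensor_der ?Y (lowering n) (\<lambda>w. v (s, w)) w = 0)}"
    by (auto simp: e_def f_def lift_op_def fun_eq_iff)
  then show ?thesis
    using dim_invariants_plus_dim_weight_2 weight[of 2] weight[of 0] by simp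
qed

section \<open>Expressions as tree shapes with words of leaves\<close>

fun leaves :: "'x expr \<Rightarrow> 'x list" where
  "leaves (Gen x) = [x]"
| "leaves (Op n i us) = concat (map leaves us)"

abbreviation shape :: "'x expr \<Rightarrow> unit expr" where
  "shape \<equiv> map_expr (\<lambda>_. ())"

lemma length_leaves: "length (leaves u) = deg u"
  by (induction u) (simp_all add: length_concat comp_def cong: map_cong)

lemma deg_shape: "deg (shape u) = deg u"
  by (induction u) (simp_all add: comp_def cong: map_cong)

lemma deg_eq_if_shape_eq: "shape u = shape u' \<Longrightarrow> deg u = deg u'"
  by (metis deg_shape)

text \<open>The shapes of the arguments of an operation fix the lengths of their words of leaves, and hence how
the concatenated word is to be cut.\<close>

lemma expr_eqI: "shape u = shape u' \<Longrightarrow> leaves u = leaves u' \<Longrightarrow> u = u'"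
proof (induction u arbitrary: u')
  case (Gen x) then show ?case by (cases u') auto
next
  case (Op n i us)
  then obtain us' where u': "u' = Op n i us'" and sh: "map shape us = map shape us'"
    by (cases u') auto
  have len: "length us = length us'" using sh by (rule map_eq_imp_length_eq)
  have shn: "shape (us ! j) = shape (us' ! j)" if "j < length us" for j
    using arg_cong[OF sh, of "\<lambda>l. l ! j"] that len by simp
  have "map leaves us = map leaves us'"
  proof (rule iffD1[OF concat_eq_concat_iff])
    show "concat (map leaves us) = concat (map leaves us')" using Op.prems(2) u' by simp
    show "\<forall>(a, b)\<in>set (zip (map leaves us) (map leaves us')). length a = length b"
      using len shn by (auto simp: set_zip length_leaves intro!: deg_eq_if_shape_eq)
  qed (simp add: len)
  then have "leaves (us ! j) = leaves (us' ! j)" if "j < length us" for j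
    using that len by (metis nth_map)
  then have "us ! j = us' ! j" if "j < length us" for j
    using Op.IH[of "us ! j" "us' ! j"] shn that by auto
  then show ?case using len u' by (auto intro: nth_equalityI)
qed

lemma ex_expr: "length w = deg s \<Longrightarrow> \<exists>u. shape u = s \<and> leaves u = w"
proof (induction s arbitrary: w)
  case (Gen x)
  then obtain y where "w = [y]" by (auto simp: length_Suc_conv)
  then show ?case by (intro exI[of _ "Gen y"]) auto
next
  case (Op n i ss)
  have "\<exists>us. map shape us = ss \<and> concat (map leaves us) = w"
    using Op.IH Op.prems[unfolded deg.simps]
  proof (induction ss arbitrary: w)
    case (Cons s ss)
    obtain u where u: "shape u = s" "leaves u = take (deg s) w"
      using Cons.prems(1)[of s "take (deg s) w"] Cons.prems(2) by auto
    obtain us where us: "map shape us = ss" "concat (map leaves us) = drop (deg s) w"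
      using Cons.IH[of "drop (deg s) w"] Cons.prems by fastforce
    show ?case using u us by (intro exI[of _ "u # us"]) auto
  qed auto
  then obtain us where "map shape us = ss" "concat (map leaves us) = w" by blast
  then show ?case by (intro exI[of _ "Op n i us"]) auto
qed

definition plug :: "unit expr \<Rightarrow> 'x list \<Rightarrow> 'x expr" where
  "plug s w = (THE u. shape u = s \<and> leaves u = w)"

lemma plug_eq: "plug (shape u) (leaves u) = u"
  unfolding plug_def by (rule the_equality) (auto intro: expr_eqI)

lemma
  assumes "length w = deg s"
  shows shape_plug: "shape (plug s w) = s" and leaves_plug: "leaves (plug s w) = w"
proof -
  obtain u where "shape u = s" "leaves u = w" using ex_expr[OF assms] by blast
  then show "shape (plug s w) = s" "leaves (plug s w) = w" using plug_eq[of u] by auto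
qed

lemma magma_iff: "u \<in> magma p X \<longleftrightarrow> shape u \<in> magma p UNIV \<and> set (leaves u) \<subseteq> X"
proof (induction u)
  case (Gen x) then show ?case by (auto intro: magma.intros elim: magma.cases)
next
  case (Op n i us)
  have inv: "Op n i vs \<in> magma p Y \<longleftrightarrow>
      2 \<le> n \<and> 1 \<le> i \<and> i \<le> p n \<and> length vs = n \<and> (\<forall>v\<in>set vs. v \<in> magma p Y)"
    for vs and Y :: "'z set"
    by (auto intro: magma.intros elim: magma.cases)
  show ?case using Op by (auto simp: inv)
qed

lemma deg_pos: "u \<in> magma p X \<Longrightarrow> 1 \<le> deg u"
proof (induction rule: magma.induct)
  case (Op n i us)
  then obtain u where "u \<in> set us" by (cases us) auto
  then show ?case using Op member_le_sum_list[of "deg u" "map deg us"] by fastforce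
qed auto

text \<open>Every operation has at least two arguments and every argument has positive degree, so the arguments
of an operation have smaller degree than its value, and the arity is at most the degree.\<close>

lemma finite_magma_deg:
  assumes "finite X"
  shows "finite {u \<in> magma p X. deg u = m}"
proof (induction m rule: less_induct)
  case (less m)
  let ?U = "\<Union>m'<m. {u \<in> magma p X. deg u = m'}"
  have fin: "finite ?U" using less by auto
  have "{u \<in> magma p X. deg u = m} \<subseteq> Gen ` X
      \<union> (\<Union>n\<le>m. \<Union>i\<le>p n. Op n i ` {us. set us \<subseteq> ?U \<and> length us = n})"
  proof
    fix u assume "u \<in> {u \<in> magma p X. deg u = m}"
    then have u: "u \<in> magma p X" "deg u = m" by auto
    from u(1) show "u \<in> Gen ` X
      \<union> (\<Union>n\<le>m. \<Union>i\<le>p n. Op n i ` {us. set us \<subseteq> ?U \<and> length us = n})"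
    proof cases
      case (Op n i us)
      have pos: "1 \<le> deg v" if "v \<in> set us" for v using Op that deg_pos by blast
      have "length us \<le> sum_list (map deg us)"
        using sum_list_mono[of us "\<lambda>_. 1" deg] pos by (simp add: sum_list_triv)
      then have n: "n \<le> m" using Op u by simp
      have "deg v < m" if v: "v \<in> set us" for v
      proof -
        obtain xs ys where us: "us = xs @ v # ys" using v by (meson split_list)
        have "length xs + length ys \<le> sum_list (map deg xs) + sum_list (map deg ys)"
          using sum_list_mono[of xs "\<lambda>_. 1" deg] sum_list_mono[of ys "\<lambda>_. 1" deg] pos us
          by (simp add: sum_list_triv add_mono)
        moreover have "1 \<le> length xs + length ys" using Op us by auto
        ultimately show ?thesis using u(2) Op us by simp
      qed
      then have "set us \<subseteq> ?U" using Op by auto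
      then show ?thesis using n Op by blast
    qed auto
  qed
  moreover have "finite (Gen ` X
      \<union> (\<Union>n\<le>m. \<Union>i\<le>p n. Op n i ` {us. set us \<subseteq> ?U \<and> length us = n}))"
    using assms finite_lists_length_eq[OF fin] by auto
  ultimately show ?case by (rule finite_subset)
qed

lemma finite_listset: "\<forall>A\<in>set As. finite A \<Longrightarrow> finite (listset As)"
proof (induction As)
  case (Cons A As)
  have "set_Cons A (listset As) = (\<lambda>(x, xs). x # xs) ` (A \<times> listset As)"
    by (auto simp: set_Cons_def)
  then show ?case using Cons by simp
qed simp

lemma in_listset_iff: "us \<in> listset As \<longleftrightarrow> list_all2 (\<in>) us As"
  by (induction As arbitrary: us) (auto simp: set_Cons_def list_all2_Cons2)

lemma prod_lookup_zero:
  "length us = length fs \<Longrightarrow> us \<notin> listset (map Poly_Mapping.keys fs)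
    \<Longrightarrow> prod_list (map2 Poly_Mapping.lookup fs us) = (0 :: 'k::field)"
proof (induction us fs rule: list_induct2)
  case (Cons u us f fs)
  then show ?case by (cases "u \<in> Poly_Mapping.keys f")
      (auto simp: in_listset_iff in_keys_iff simp del: listset.simps)
qed auto

lemma lookup_alg_op:
  "Poly_Mapping.lookup (alg_op n i fs) u
    = (case u of Gen x \<Rightarrow> 0 | Op n' i' us \<Rightarrow>
        if n' = n \<and> i' = i \<and> length us = length fs
        then prod_list (map2 Poly_Mapping.lookup fs us) else (0 :: 'k::field))"
proof -
  let ?L = "listset (map Poly_Mapping.keys fs)"
  have fin: "finite ?L" by (rule finite_listset) auto
  have len: "length us = length fs" if "us \<in> ?L" for us
    using that by (auto simp: in_listset_iff dest: list_all2_lengthD)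
  have *: "Poly_Mapping.lookup (alg_op n i fs) u
      = (\<Sum>us\<in>?L. if Op n i us = u then prod_list (map2 Poly_Mapping.lookup fs us) else 0)"
    unfolding alg_op_def lookup_sum lookup_single when_def ..
  show ?thesis
  proof (cases u)
    case (Gen x) then show ?thesis unfolding * by simp
  next
    case (Op n' i' vs)
    show ?thesis
    proof (cases "n' = n \<and> i' = i")
      case True
      then have "Poly_Mapping.lookup (alg_op n i fs) u
          = (if vs \<in> ?L then prod_list (map2 Poly_Mapping.lookup fs vs) else 0)"
        unfolding * using fin Op by simp
      also have "\<dots> = (if length vs = length fs
          then prod_list (map2 Poly_Mapping.lookup fs vs) else 0)"
        using len prod_lookup_zero[of vs fs] by auto
      finally show ?thesis using True Op by simp
    next
      case False
      then show ?thesis unfolding * using Op by (auto intro!: sum.neutral)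
    qed
  qed
qed

text \<open>Substituting linear combinations of generators keeps the shape and expands the word of leaves
multilinearly.\<close>

lemma lookup_expr_subst:
  assumes "\<And>x. x \<in> set (leaves u) \<Longrightarrow> Poly_Mapping.keys (\<phi> x) \<subseteq> range Gen"
  shows "Poly_Mapping.lookup (expr_subst \<phi> u) u'
    = (if shape u = shape u'
       then prod_list (map2 (\<lambda>x y. Poly_Mapping.lookup (\<phi> x) (Gen y)) (leaves u) (leaves u'))
       else (0 :: 'k::field))"
  using assms
proof (induction u arbitrary: u')
  case (Gen x)
  show ?case
  proof (cases u')
    case (Op n i us)
    then have "u' \<notin> Poly_Mapping.keys (\<phi> x)" using Gen[of x] by auto
    then show ?thesis using Op by (simp add: in_keys_iff)
  qed auto
next
  case (Op n i us)
  let ?P = "\<lambda>w w'. prod_list (map2 (\<lambda>x y. Poly_Mapping.lookup (\<phi> x) (Gen y)) w w')"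
  show ?case
  proof (cases u')
    case (Op n' i' us')
    have *: "prod_list (map2 Poly_Mapping.lookup (map (expr_subst \<phi>) us) us')
      = (if map shape us = map shape us' then ?P (concat (map leaves us)) (concat (map leaves us')) else 0)" if "length us = length us'"
      using that Op.IH Op.prems
    proof (induction us us' rule: list_induct2)
      case (Cons u us u' us')
      have IH: "prod_list (map2 Poly_Mapping.lookup (map (expr_subst \<phi>) us) us')
        = (if map shape us = map shape us' then ?P (concat (map leaves us)) (concat (map leaves us')) else 0)"
        using Cons.prems by (intro Cons.IH) auto
      have u: "Poly_Mapping.lookup (expr_subst \<phi> u) u'
          = (if shape u = shape u' then ?P (leaves u) (leaves u') else 0)"
        using Cons.prems(1)[of u u'] Cons.prems(2) by auto
      have "length (leaves u) = length (leaves u')" if "shape u = shape u'"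
        using deg_eq_if_shape_eq[OF that] by (simp add: length_leaves)
      then show ?case using IH u by (auto simp: zip_append)
    qed auto
    show ?thesis
    proof (cases "length us = length us'")
      case True then show ?thesis using *[OF True] by (auto simp: Op lookup_alg_op)
    next
      case False
      then have "map shape us \<noteq> map shape us'" using map_eq_imp_length_eq by blast
      with False show ?thesis by (auto simp: Op lookup_alg_op)
    qed
  qed (auto simp: lookup_alg_op)
qed

lemma lookup_lin_ext:
  "Poly_Mapping.lookup (lin_ext h f) u
    = (\<Sum>t\<in>Poly_Mapping.keys f. Poly_Mapping.lookup f t * Poly_Mapping.lookup (h t) u)"
  by (simp add: lin_ext_def lookup_sum)

text \<open>The component of \<open>f\<close> at the shape \<open>s\<close>, an element of a tensor power of the space of generators.\<close>

definition coeff_tensor :: "('x expr \<Rightarrow>\<^sub>0 'k::zero) \<Rightarrow> unit expr \<Rightarrow> 'x list \<Rightarrow> 'k" where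
  "coeff_tensor f s = (\<lambda>w. Poly_Mapping.lookup f (plug s w))"

text \<open>A linear substitution of the generators acts on the component of each shape as a tensor power.\<close>

lemma lookup_subst_eq_tensor_act:
  fixes f :: "'x expr \<Rightarrow>\<^sub>0 'k::field"
  assumes X: "finite X" and f: "f \<in> free_algebra p X"
    and \<phi>: "\<And>x. x \<in> X \<Longrightarrow> \<phi> x \<in> KX X"
  shows "Poly_Mapping.lookup (lin_ext (expr_subst \<phi>) f) u
    = tensor_act X (\<lambda>x y. Poly_Mapping.lookup (\<phi> x) (Gen y)) (coeff_tensor f (shape u)) (leaves u)"
proof -
  let ?P = "\<lambda>w. prod_list (map2 (\<lambda>x y. Poly_Mapping.lookup (\<phi> x) (Gen y)) w (leaves u))"
  let ?W = "words X (length (leaves u))"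
  let ?A = "{t \<in> Poly_Mapping.keys f. shape t = shape u}"
  have plug_A: "plug (shape u) (leaves t) = t" if "t \<in> ?A" for t
    using that plug_eq[of t] by simp
  have leaves_in: "set (leaves t) \<subseteq> X" if "t \<in> Poly_Mapping.keys f" for t
  proof -
    have "t \<in> magma p X" using that f unfolding free_algebra_def by blast
    then show ?thesis by (rule conjunct2[OF iffD1[OF magma_iff]])
  qed
  have "Poly_Mapping.lookup (lin_ext (expr_subst \<phi>) f) u
      = (\<Sum>t\<in>Poly_Mapping.keys f. Poly_Mapping.lookup f t * (if shape t
          = shape u then ?P (leaves t) else 0))"
    unfolding lookup_lin_ext
  proof (rule sum.cong[OF refl])
    fix t assume t: "t \<in> Poly_Mapping.keys f"
    have "Poly_Mapping.keys (\<phi> x) \<subseteq> range Gen" if "x \<in> set (leaves t)" for x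
    proof -
      have "x \<in> X" using leaves_in[OF t] that by blast
      then have "Poly_Mapping.keys (\<phi> x) \<subseteq> Gen ` X" using \<phi>[of x] by (simp add: KX_def)
      then show ?thesis by blast
    qed
    from lookup_expr_subst[where u = t and u' = u, OF this]
        show "Poly_Mapping.lookup f t * Poly_Mapping.lookup (expr_subst \<phi> t) u
        = Poly_Mapping.lookup f t * (if shape t = shape u then ?P (leaves t) else 0)"
      by simp
  qed
  also have "\<dots> = (\<Sum>t\<in>?A. Poly_Mapping.lookup f t * ?P (leaves t))"
    by (simp add: sum.inter_filter if_distrib cong: if_cong)
  also have "\<dots> = (\<Sum>w\<in>leaves ` ?A. coeff_tensor f (shape u) w * ?P w)"
  proof (subst sum.reindex)
    show "inj_on leaves ?A" by (auto simp: inj_on_def intro: expr_eqI)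
    show "(\<Sum>t\<in>?A. Poly_Mapping.lookup f t * ?P (leaves t))
        = sum ((\<lambda>w. coeff_tensor f (shape u) w * ?P w) \<circ> leaves) ?A"
      by (rule sum.cong) (simp_all add: coeff_tensor_def plug_A)
  qed
  also have "\<dots> = (\<Sum>w\<in>?W. coeff_tensor f (shape u) w * ?P w)"
  proof (rule sum.mono_neutral_left)
    show "finite ?W" by (rule finite_words[OF X])
    show "leaves ` ?A \<subseteq> ?W"
      using leaves_in by (auto simp: length_leaves intro: deg_eq_if_shape_eq)
    show "\<forall>w\<in>?W - leaves ` ?A. coeff_tensor f (shape u) w * ?P w = 0"
    proof
      fix w assume w: "w \<in> ?W - leaves ` ?A"
      then have "shape (plug (shape u) w) = shape u" "leaves (plug (shape u) w) = w"
        by (auto simp: length_leaves deg_shape intro!: shape_plug leaves_plug)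
      then have "plug (shape u) w \<notin> Poly_Mapping.keys f" using w by force
      then show "coeff_tensor f (shape u) w * ?P w = 0" by (simp add: coeff_tensor_def in_keys_iff)
    qed
  qed
  also have "\<dots> = tensor_act X (\<lambda>x y. Poly_Mapping.lookup (\<phi> x) (Gen y)) (coeff_tensor f (shape u)) (leaves u)"
    by (simp only: tensor_act_eq_sum_words)
  finally show ?thesis .
qed

section \<open>The weight basis of the module of generators\<close>

interpretation poly_space: vector_space "pscale :: 'k::field \<Rightarrow> ('b \<Rightarrow>\<^sub>0 'k) \<Rightarrow> _"
  by (rule vector_space_pscale)

abbreviation gen :: "'x \<Rightarrow> 'x expr \<Rightarrow>\<^sub>0 'k::field" where
  "gen x \<equiv> Poly_Mapping.single (Gen x) 1"

lemma KX_iff: "v \<in> KX X \<longleftrightarrow> (\<forall>u. u \<notin> Gen ` X \<longrightarrow> Poly_Mapping.lookup v u = 0)"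
  by (auto simp: KX_def in_keys_iff)

lemma KX_add: "v \<in> KX X \<Longrightarrow> w \<in> KX X \<Longrightarrow> v + w \<in> KX X"
  and KX_scale: "v \<in> KX X \<Longrightarrow> pscale c v \<in> KX X"
  and KX_zero: "0 \<in> KX X"
  and KX_gen: "x \<in> X \<Longrightarrow> gen x \<in> KX X"
  by (auto simp: KX_iff lookup_add lookup_single when_def)

lemma KX_sum: "(\<And>y. y \<in> Y \<Longrightarrow> v y \<in> KX X) \<Longrightarrow> (\<Sum>y\<in>Y. v y) \<in> KX X"
  by (induction Y rule: infinite_finite_induct) (auto intro: KX_zero KX_add)

lemma KX_expand:
  assumes "finite X" "v \<in> KX X"
  shows "v = (\<Sum>x\<in>X. pscale (Poly_Mapping.lookup v (Gen x)) (gen x))"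
proof (rule poly_mapping_eqI)
  fix u
  show "Poly_Mapping.lookup v u
      = Poly_Mapping.lookup (\<Sum>x\<in>X. pscale (Poly_Mapping.lookup v (Gen x)) (gen x)) u"
  proof (cases "u \<in> Gen ` X")
    case True
    then obtain x where "x \<in> X" "u = Gen x" by blast
    then show ?thesis using assms(1) by (simp add: lookup_sum lookup_single when_def if_distrib cong: if_cong)
  next
    case False
    then have "Poly_Mapping.lookup v u = 0" using assms(2) by (simp add: KX_iff)
    moreover have "Poly_Mapping.lookup (gen x :: 'a expr \<Rightarrow>\<^sub>0 'b) u = 0" if "x \<in> X" for x
      using False that by (auto simp: lookup_single when_def)
    ultimately show ?thesis by (simp add: lookup_sum)
  qed
qed

definition upper :: "'k::field \<Rightarrow> 'k ^ 2 ^ 2" where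
  "upper t = vector [vector [1, t], vector [0, 1]]"

definition lower :: "'k::field \<Rightarrow> 'k ^ 2 ^ 2" where
  "lower t = vector [vector [1, 0], vector [t, 1]]"

lemma det_upper [simp]: "det (upper t) = 1" and det_lower [simp]: "det (lower t) = 1"
  by (simp_all add: upper_def lower_def det_2)

lemma SL2_subset_GL2: "SL2 \<subseteq> GL2"
  by (auto simp: SL2_def GL2_def invertible_det_nz)

lemma upper_SL2: "upper t \<in> SL2" and lower_SL2: "lower t \<in> SL2"
  by (simp_all add: SL2_def)

lemma upper_add: "upper (t + r) = upper t ** upper r"
  and lower_add: "lower (t + r) = lower t ** lower r"
  by (simp_all add: upper_def lower_def vec_eq_iff forall_2 matrix_matrix_mult_def sum_2 add.commute)

text \<open>A matrix with nonzero lower left entry \<open>c\<close> is a product of unitriangular matrices, upper, lower and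
upper. If \<open>c = 0\<close>, multiplication by \<open>lower 1\<close> leads back to this case.\<close>

lemma SL2_generated:
  fixes Q :: "'k::field ^ 2 ^ 2 \<Rightarrow> bool"
  assumes "\<And>t. Q (upper t)" "\<And>t. Q (lower t)"
    and mult: "\<And>g h. g \<in> SL2 \<Longrightarrow> h \<in> SL2 \<Longrightarrow> Q g \<Longrightarrow> Q h \<Longrightarrow> Q (g ** h)"
    and "g \<in> SL2"
  shows "Q g"
proof -
  have SL2_mult: "g ** h \<in> SL2" if "g \<in> SL2" "h \<in> SL2" for g h :: "'k ^ 2 ^ 2"
    using that by (simp add: SL2_def det_mul)
  have nz: "Q g" if g: "g \<in> SL2" and c: "g $ 2 $ 1 \<noteq> 0" for g
  proof -
    let ?c = "g $ 2 $ 1"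
    have det: "g $ 1 $ 1 * g $ 2 $ 2 - g $ 1 $ 2 * ?c = 1" using g by (simp add: SL2_def det_2)
    (* The outer factors are forced by the diagonal entries of the product; its upper right entry is
       then correct because the determinant is 1. *)
    have eq: "g = (upper ((g $ 1 $ 1 - 1) / ?c) ** lower ?c) ** upper ((g $ 2 $ 2 - 1) / ?c)"
      using c det by (simp add: upper_def lower_def vec_eq_iff forall_2 matrix_matrix_mult_def sum_2)
        (simp add: field_simps)
    show ?thesis
      by (subst eq) (intro mult SL2_mult upper_SL2 lower_SL2 assms(1,2))
  qed
  show ?thesis
  proof (cases "g $ 2 $ 1 = 0")
    case False then show ?thesis using nz assms(4) by blast
  next
    case True
    then have "g $ 1 $ 1 * g $ 2 $ 2 = 1" using assms(4) by (simp add: SL2_def det_2)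
    then have "g $ 2 $ 2 \<noteq> 0" by auto
    moreover have "(g ** lower 1) $ 2 $ 1 = g $ 2 $ 2"
      using True by (simp add: lower_def matrix_matrix_mult_def sum_2)
    ultimately have "Q (g ** lower 1)"
      by (intro nz SL2_mult assms(4) lower_SL2) auto
    then have "Q ((g ** lower 1) ** lower (- 1))"
      by (rule mult[OF SL2_mult[OF assms(4) lower_SL2] lower_SL2 _ assms(2)])
    also have "(g ** lower 1) ** lower (- 1) = g"
      by (simp add: lower_def vec_eq_iff forall_2 matrix_matrix_mult_def sum_2 algebra_simps)
    finally show ?thesis .
  qed
qed

text \<open>The matrix coefficients of \<open>upper t\<close> and \<open>lower t\<close> on monomials come from expanding
\<open>(v\<^sub>2 + t v\<^sub>1)\<^sup>j\<close> and \<open>(v\<^sub>1 + t v\<^sub>2)\<^sup>n\<^sup>-\<^sup>j\<close> by the binomial theorem; their derivatives at \<open>t = 0\<close> are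
the raising and the lowering operator.\<close>

definition upper_coeff :: "'k::field_char_0 \<Rightarrow> nat \<times> nat \<Rightarrow> nat \<times> nat \<Rightarrow> 'k" where
  "upper_coeff t y x = (if fst y = fst x \<and> snd x \<le> snd y
     then of_nat (snd y choose snd x) * t ^ (snd y - snd x) else 0)"

definition lower_coeff :: "(nat \<Rightarrow> nat) \<Rightarrow> 'k::field_char_0 \<Rightarrow> nat \<times> nat \<Rightarrow> nat \<times> nat \<Rightarrow> 'k" where
  "lower_coeff n t y x = (if fst y = fst x \<and> snd y \<le> snd x
     then of_nat ((n (fst y) - snd y) choose (snd x - snd y)) * t ^ (snd x - snd y) else 0)"

lemma upper_coeff_0: "upper_coeff 0 y x = (if y = x then 1 else 0)"
  and lower_coeff_0: "lower_coeff n 0 y x = (if y = x then 1 else 0)"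
  by (auto simp: upper_coeff_def lower_coeff_def prod_eq_iff power_0_left)

lemma upper_coeff_deriv: "poly_fun_deriv0 (\<lambda>t. upper_coeff t y x) (raising y x)"
proof (cases "fst y = fst x \<and> snd x \<le> snd y")
  case True
  then have "snd y - snd x = 1 \<longleftrightarrow> snd y = Suc (snd x)" by auto
  with True show ?thesis
    using poly_fun_deriv0_monom[of "of_nat (snd y choose snd x)" "snd y - snd x"]
    by (auto simp: upper_coeff_def raising_def)
next
  case False
  then show ?thesis using poly_fun_deriv0_const[of 0] by (auto simp: upper_coeff_def raising_def)
qed

lemma lower_coeff_deriv:
  assumes "y \<in> weight_basis k n"
  shows "poly_fun_deriv0 (\<lambda>t. lower_coeff n t y x) (lowering n y x)"
proof (cases "fst y = fst x \<and> snd y \<le> snd x")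
  case True
  then have "snd x - snd y = 1 \<longleftrightarrow> snd x = Suc (snd y)" by auto
  with True show ?thesis using assms
    poly_fun_deriv0_monom[of "of_nat ((n (fst y) - snd y) choose (snd x - snd y))" "snd x - snd y"]
    by (auto simp: lower_coeff_def lowering_def weight_basis_def of_nat_diff)
next
  case False
  then show ?thesis using poly_fun_deriv0_const[of 0] by (auto simp: lower_coeff_def lowering_def)
qed

lemma W_act_upper:
  assumes "j \<le> n"
  shows "W_act l2 (upper t) (form_monomial n j) v
    = (\<Sum>s\<le>n. upper_coeff t (i, j) (i, s) * form_monomial n s v)"
proof -
  have "W_act l2 (upper t) (form_monomial n j) v = (v$1) ^ (n - j) * (v$2 + t * v$1) ^ j"
    by (simp add: W_act_def form_monomial_def matrix_vector_mult_def transpose_def sum_2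
        add.commute) (simp add: upper_def add.commute)
  also have "\<dots> = (\<Sum>s\<le>j. upper_coeff t (i, j) (i, s) * form_monomial n s v)"
    unfolding binomial_ring sum_distrib_left
  proof (rule sum.cong)
    fix s assume "s \<in> {..j}"
    then have "(v$1) ^ (n - s) = (v$1) ^ (n - j) * (v$1) ^ (j - s)"
      using assms by (simp add: power_add[symmetric])
    then show "(v$1) ^ (n - j) * (of_nat (j choose s) * (v$2) ^ s * (t * v$1) ^ (j - s))
        = upper_coeff t (i, j) (i, s) * form_monomial n s v"
      using \<open>s \<in> {..j}\<close> by (simp add: form_monomial_def upper_coeff_def power_mult_distrib mult_ac)
  qed simp
  also have "\<dots> = (\<Sum>s\<le>n. upper_coeff t (i, j) (i, s) * form_monomial n s v)"
    using assms by (intro sum.mono_neutral_left) (auto simp: upper_coeff_def)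
  finally show ?thesis .
qed

lemma W_act_lower:
  assumes "j \<le> n i"
  shows "W_act l2 (lower t) (form_monomial (n i) j) v
    = (\<Sum>s\<le>n i. lower_coeff n t (i, j) (i, s) * form_monomial (n i) s v)"
proof -
  let ?n = "n i"
  have "W_act l2 (lower t) (form_monomial ?n j) v = (t * v$2 + v$1) ^ (?n - j) * (v$2) ^ j"
    by (simp add: W_act_def form_monomial_def matrix_vector_mult_def transpose_def sum_2
        add.commute) (simp add: lower_def add.commute)
  also have "\<dots> = (\<Sum>s\<le>?n - j. lower_coeff n t (i, j) (i, s + j) * form_monomial ?n (s + j) v)"
    unfolding binomial_ring sum_distrib_right
  proof (rule sum.cong)
    fix s assume "s \<in> {..?n - j}"
    then show "of_nat ((?n - j) choose s) * (t * v$2) ^ s * (v$1) ^ (?n - j - s) * (v$2) ^ j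
        = lower_coeff n t (i, j) (i, s + j) * form_monomial ?n (s + j) v"
      by (simp add: form_monomial_def lower_coeff_def power_mult_distrib power_add mult_ac)
        (simp add: add.commute)
  qed simp
  also have "\<dots> = (\<Sum>s\<in>{j..?n}. lower_coeff n t (i, j) (i, s) * form_monomial ?n s v)"
    using assms sum.shift_bounds_cl_nat_ivl[of
        "\<lambda>s. lower_coeff n t (i, j) (i, s) * form_monomial ?n s v" 0 j "?n - j"]
    by (simp add: atMost_atLeast0)
  also have "\<dots> = (\<Sum>s\<le>?n. lower_coeff n t (i, j) (i, s) * form_monomial ?n s v)"
    by (intro sum.mono_neutral_left) (auto simp: lower_coeff_def)
  finally show ?thesis .
qed

locale decomposed_module =
  fixes X :: "'x set"
    and \<rho> :: "'k::field_char_0 ^ 2 ^ 2 \<Rightarrow> ('x expr \<Rightarrow>\<^sub>0 'k) \<Rightarrow> ('x expr \<Rightarrow>\<^sub>0 'k)"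
    and k :: nat
    and l1 l2 :: "nat \<Rightarrow> nat"
    and T :: "('x expr \<Rightarrow>\<^sub>0 'k) \<Rightarrow> nat \<Rightarrow> ('k ^ 2 \<Rightarrow> 'k)"
  assumes finite_X: "finite X"
    and poly_module: "polynomial_GL2_module X \<rho>"
    and T_bij: "bij_betw T (KX X) (\<Pi>\<^sub>E i\<in>{1..k}. W (l1 i) (l2 i))"
    and T_add: "v \<in> KX X \<Longrightarrow> w \<in> KX X \<Longrightarrow> i \<in> {1..k} \<Longrightarrow> T (v + w) i = (\<lambda>a. T v i a + T w i a)"
    and T_scale: "v \<in> KX X \<Longrightarrow> i \<in> {1..k} \<Longrightarrow> T (pscale c v) i = (\<lambda>a. c * T v i a)"
    and T_act: "g \<in> GL2 \<Longrightarrow> v \<in> KX X \<Longrightarrow> i \<in> {1..k} \<Longrightarrow> T (\<rho> g v) i = W_act (l2 i) g (T v i)"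
begin

definition form_degree :: "nat \<Rightarrow> nat" where "form_degree i = l1 i - l2 i"

abbreviation Y :: "(nat \<times> nat) set" where "Y \<equiv> weight_basis k form_degree"

lemma \<rho>_in: "g \<in> GL2 \<Longrightarrow> v \<in> KX X \<Longrightarrow> \<rho> g v \<in> KX X"
  and \<rho>_add: "g \<in> GL2 \<Longrightarrow> v \<in> KX X \<Longrightarrow> w \<in> KX X \<Longrightarrow> \<rho> g (v + w) = \<rho> g v + \<rho> g w"
  and \<rho>_scale: "g \<in> GL2 \<Longrightarrow> v \<in> KX X \<Longrightarrow> \<rho> g (pscale c v) = pscale c (\<rho> g v)"
  and \<rho>_mult: "g \<in> GL2 \<Longrightarrow> h \<in> GL2 \<Longrightarrow> v \<in> KX X \<Longrightarrow> \<rho> (g ** h) v = \<rho> g (\<rho> h v)"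
  using poly_module unfolding polynomial_GL2_module_def by blast+

lemma \<rho>_sum:
  assumes "g \<in> GL2" "\<And>y. y \<in> Z \<Longrightarrow> v y \<in> KX X"
  shows "\<rho> g (\<Sum>y\<in>Z. pscale (c y) (v y)) = (\<Sum>y\<in>Z. pscale (c y) (\<rho> g (v y)))"
proof -
  have zero: "\<rho> g 0 = 0"
    using \<rho>_scale[OF assms(1) KX_zero, of 0] by (simp add: poly_space.scale_zero_left)
  show ?thesis
    using assms(2)
    by (induction Z rule: infinite_finite_induct)
      (simp_all add: zero \<rho>_add[OF assms(1)] \<rho>_scale[OF assms(1)] KX_sum KX_scale)
qed

lemma T_sum:
  assumes "i \<in> {1..k}" "\<And>y. y \<in> Z \<Longrightarrow> v y \<in> KX X"
  shows "T (\<Sum>y\<in>Z. pscale (c y) (v y)) i = (\<lambda>a. \<Sum>y\<in>Z. c y * T (v y) i a)"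
proof -
  have zero: "T 0 i = (\<lambda>a. 0)"
    using T_scale[OF KX_zero assms(1), of 0] by (simp add: poly_space.scale_zero_left)
  show ?thesis
    using assms(2)
    by (induction Z rule: infinite_finite_induct)
      (simp_all add: zero T_add[OF _ _ assms(1)] T_scale[OF _ assms(1)] KX_sum KX_scale)
qed

lemma T_eqI:
  assumes "v \<in> KX X" "w \<in> KX X" "\<And>i a. i \<in> {1..k} \<Longrightarrow> T v i a = T w i a"
  shows "v = w"
proof -
  have "T v \<in> (\<Pi>\<^sub>E i\<in>{1..k}. W (l1 i) (l2 i))" "T w \<in> (\<Pi>\<^sub>E i\<in>{1..k}. W (l1 i) (l2 i))"
    using T_bij assms(1,2) by (auto simp: bij_betw_def)
  then have "T v = T w" using assms(3) by (intro PiE_ext) auto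
  then show ?thesis using T_bij assms(1,2) by (auto simp: bij_betw_def inj_on_def)
qed

text \<open>The weight vector in \<open>KX\<close> that corresponds to the monomial \<open>y\<close>; these vectors form a basis in which
the torus acts diagonally.\<close>

definition basis_vec :: "nat \<times> nat \<Rightarrow> 'x expr \<Rightarrow>\<^sub>0 'k" where
  "basis_vec y = inv_into (KX X) T
     (\<lambda>i\<in>{1..k}. if i = fst y then form_monomial (form_degree i) (snd y) else (\<lambda>_. 0))"

lemma form_monomial_in_W: "j \<le> form_degree i \<Longrightarrow> form_monomial (form_degree i) j \<in> W (l1 i) (l2 i)"
  unfolding W_def form_degree_def
  by (rule CollectI, rule exI[of _ "\<lambda>s. if s = j then 1 else 0"])
    (auto simp: fun_eq_iff mult_delta_left)

lemma zero_in_W: "(\<lambda>_. 0) \<in> W (l1 i) (l2 i)"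
  unfolding W_def by (rule CollectI, rule exI[of _ "\<lambda>_. 0"]) auto

lemma
  assumes "y \<in> Y"
  shows basis_vec_in: "basis_vec y \<in> KX X"
    and T_basis_vec: "i \<in> {1..k} \<Longrightarrow> T (basis_vec y) i
      = (if i = fst y then form_monomial (form_degree i) (snd y) else (\<lambda>_. 0))"
proof -
  let ?F = "\<lambda>i\<in>{1..k}. if i = fst y then form_monomial (form_degree i) (snd y) else (\<lambda>_. 0)"
  have "?F \<in> (\<Pi>\<^sub>E i\<in>{1..k}. W (l1 i) (l2 i))"
    using assms by (auto simp: weight_basis_def form_monomial_in_W zero_in_W)
  then have F: "?F \<in> T ` KX X" using T_bij by (simp add: bij_betw_def)
  show "basis_vec y \<in> KX X" unfolding basis_vec_def by (rule inv_into_into[OF F])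
  show "T (basis_vec y) i = (if i = fst y then form_monomial (form_degree i) (snd y) else (\<lambda>_. 0))"
    if "i \<in> {1..k}"
    using fun_cong[OF f_inv_into_f[OF F], of i] that by (simp add: basis_vec_def)
qed

lemma T_combination:
  assumes "i \<in> {1..k}"
  shows "T (\<Sum>y\<in>Y. pscale (c y) (basis_vec y)) i a = (\<Sum>j\<le>form_degree i. c (i, j)
      * form_monomial (form_degree i) j a)"
proof -
  have "T (\<Sum>y\<in>Y. pscale (c y) (basis_vec y)) i a = (\<Sum>y\<in>Y. c y * T (basis_vec y) i a)"
    using T_sum[OF assms, of Y basis_vec c] basis_vec_in by simp
  also have "\<dots> = (\<Sum>i'\<in>{1..k}. \<Sum>j\<le>form_degree i'. c (i', j) * T (basis_vec (i', j)) i a)"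
    by (simp add: weight_basis_def sum.Sigma case_prod_unfold)
  also have "\<dots> = (\<Sum>i'\<in>{1..k}. if i' = i then \<Sum>j\<le>form_degree i. c (i, j)
      * form_monomial (form_degree i) j a else 0)"
  proof (rule sum.cong[OF refl])
    fix i' assume i': "i' \<in> {1..k}"
    have "T (basis_vec (i', j)) i = (if i = i' then form_monomial (form_degree i) j else (\<lambda>_. 0))"
        if "j \<le> form_degree i'" for j
      using T_basis_vec[of "(i', j)" i] assms i' that by (simp add: weight_basis_def)
    then show "(\<Sum>j\<le>form_degree i'. c (i', j) * T (basis_vec (i', j)) i a)
        = (if i' = i then \<Sum>j\<le>form_degree i. c (i, j) * form_monomial (form_degree i) j a else 0)"
      by (auto intro!: sum.neutral)
  qed
  finally show ?thesis using assms by simp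
qed

text \<open>Apply the isomorphism and restrict the resulting identity of binary forms to the line \<open>v\<^sub>1 = 1\<close>: it
becomes an identity of polynomial functions on an infinite field.\<close>

lemma basis_vec_independent:
  assumes "(\<Sum>y\<in>Y. pscale (c y) (basis_vec y)) = (\<Sum>y\<in>Y. pscale (d y) (basis_vec y))" and "y \<in> Y"
  shows "c y = d y"
proof -
  obtain i j where y: "y = (i, j)" by (cases y)
  have ij: "i \<in> {1..k}" "j \<le> form_degree i" using assms(2) by (auto simp: y weight_basis_def)
  have eval: "(\<Sum>s\<le>form_degree i. c (i, s) * form_monomial (form_degree i) s a)
      = (\<Sum>s\<le>form_degree i. d (i, s) * form_monomial (form_degree i) s a)" for a
    using T_combination[OF ij(1), of c a] T_combination[OF ij(1), of d a] assms(1) by simp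
  define pc where "pc c' = (\<Sum>s\<le>form_degree i. monom (c' (i, s)) s)" for c' :: "nat \<times> nat \<Rightarrow> 'k"
  have "poly (pc c') t = (\<Sum>s\<le>form_degree i. c' (i, s)
      * form_monomial (form_degree i) s (vector [1, t]))" for c' t
    by (simp add: pc_def poly_sum poly_monom form_monomial_def)
  then have "poly (pc c) = poly (pc d)" using eval by auto
  then have "pc c = pc d" by (simp add: poly_eq_poly_eq_iff)
  moreover have "coeff (pc c') j = c' (i, j)" for c'
    using ij(2) by (simp add: pc_def coeff_sum if_distrib cong: if_cong)
  ultimately show ?thesis by (metis y)
qed

lemma basis_vec_spans:
  assumes "v \<in> KX X"
  shows "\<exists>c. v = (\<Sum>y\<in>Y. pscale (c y) (basis_vec y))"
proof -
  have "\<forall>i\<in>{1..k}. T v i \<in> W (l1 i) (l2 i)"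
    using T_bij assms by (auto simp: bij_betw_def)
  then have "\<forall>i\<in>{1..k}. \<exists>c. T v i = (\<lambda>a. \<Sum>j\<le>form_degree i. c j * form_monomial (form_degree i) j a)"
    by (auto simp: W_def form_degree_def)
  then obtain c where c: "\<forall>i\<in>{1..k}. T v i = (\<lambda>a. \<Sum>j\<le>form_degree i. c i j
      * form_monomial (form_degree i) j a)"
    by metis
  have "v = (\<Sum>y\<in>Y. pscale ((\<lambda>(i, j). c i j) y) (basis_vec y))"
  proof (rule T_eqI[OF assms])
    show "(\<Sum>y\<in>Y. pscale ((\<lambda>(i, j). c i j) y) (basis_vec y)) \<in> KX X"
      by (intro KX_sum KX_scale basis_vec_in)
    fix i a assume i: "i \<in> {1..k}"
    show "T v i a = T (\<Sum>y\<in>Y. pscale ((\<lambda>(i, j). c i j) y) (basis_vec y)) i a"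
      unfolding T_combination[OF i] using c i by simp
  qed
  then show ?thesis by blast
qed

text \<open>\<open>gen_to_basis\<close> and \<open>basis_to_gen\<close> are the mutually inverse matrices that express the generators in the
basis \<open>basis_vec\<close> and conversely.\<close>

definition gen_to_basis :: "'x \<Rightarrow> nat \<times> nat \<Rightarrow> 'k" where
  "gen_to_basis x = (SOME c. gen x = (\<Sum>y\<in>Y. pscale (c y) (basis_vec y)))"

definition basis_to_gen :: "nat \<times> nat \<Rightarrow> 'x \<Rightarrow> 'k" where
  "basis_to_gen y x = Poly_Mapping.lookup (basis_vec y) (Gen x)"

lemma gen_eq: "x \<in> X \<Longrightarrow> gen x = (\<Sum>y\<in>Y. pscale (gen_to_basis x y) (basis_vec y))"
  unfolding gen_to_basis_def by (rule someI_ex[OF basis_vec_spans[OF KX_gen]])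

lemma basis_vec_eq: "y \<in> Y \<Longrightarrow> basis_vec y = (\<Sum>x\<in>X. pscale (basis_to_gen y x) (gen x))"
  unfolding basis_to_gen_def by (rule KX_expand[OF finite_X basis_vec_in])

lemma sum_gen_eq_sum_basis_vec:
  "(\<Sum>x\<in>X. pscale (c x) (gen x)) = (\<Sum>y\<in>Y. pscale (\<Sum>x\<in>X. c x * gen_to_basis x y) (basis_vec y))"
proof -
  have "(\<Sum>x\<in>X. pscale (c x) (gen x)) = (\<Sum>x\<in>X. pscale (c x) (\<Sum>y\<in>Y. pscale (gen_to_basis x y) (basis_vec y)))"
    by (rule sum.cong[OF refl]) (simp only: gen_eq[symmetric])
  then show ?thesis
    by (simp add: poly_space.scale_sum_right poly_space.scale_sum_left sum.swap[of _ X])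
qed

lemma basis_to_gen_to_basis: "y \<in> Y \<Longrightarrow> z \<in> Y \<Longrightarrow> (\<Sum>x\<in>X. basis_to_gen y x * gen_to_basis x z) = (if y
    = z then 1 else 0)"
proof -
  assume y: "y \<in> Y" and z: "z \<in> Y"
  have "(\<Sum>z\<in>Y. pscale (\<Sum>x\<in>X. basis_to_gen y x * gen_to_basis x z) (basis_vec z)) = basis_vec y"
    using basis_vec_eq[OF y] by (simp add: sum_gen_eq_sum_basis_vec)
  also have "\<dots> = (\<Sum>z\<in>Y. if y = z then basis_vec z else 0)"
    using y finite_weight_basis[of k form_degree] by simp
  also have "\<dots> = (\<Sum>z\<in>Y. pscale (if y = z then 1 else 0) (basis_vec z))"
    by (rule sum.cong) auto
  finally show ?thesis by (rule basis_vec_independent[OF _ z])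
qed

lemma gen_to_basis_to_gen:
  assumes "x \<in> X" "x' \<in> X"
  shows "(\<Sum>y\<in>Y. gen_to_basis x y * basis_to_gen y x') = (if x = x' then 1 else 0)"
proof -
  have "(\<Sum>y\<in>Y. gen_to_basis x y * basis_to_gen y x') = Poly_Mapping.lookup (gen x) (Gen x')"
    by (subst gen_eq[OF assms(1)]) (simp add: lookup_sum basis_to_gen_def)
  then show ?thesis by (simp add: lookup_single when_def)
qed

definition gen_matrix :: "'k ^ 2 ^ 2 \<Rightarrow> 'x \<Rightarrow> 'x \<Rightarrow> 'k" where
  "gen_matrix g x x' = Poly_Mapping.lookup (\<rho> g (gen x)) (Gen x')"

definition has_matrix :: "'k ^ 2 ^ 2 \<Rightarrow> (nat \<times> nat \<Rightarrow> nat \<times> nat \<Rightarrow> 'k) \<Rightarrow> bool" where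
  "has_matrix g A \<longleftrightarrow> (\<forall>y\<in>Y. \<rho> g (basis_vec y) = (\<Sum>z\<in>Y. pscale (A y z) (basis_vec z)))"

lemma \<rho>_gen: "g \<in> GL2 \<Longrightarrow> x \<in> X \<Longrightarrow> \<rho> g (gen x) = (\<Sum>x'\<in>X. pscale (gen_matrix g x x') (gen x'))"
  unfolding gen_matrix_def by (rule KX_expand[OF finite_X \<rho>_in[OF _ KX_gen]])

lemma gen_matrix_mult:
  assumes g: "g \<in> GL2" and h: "h \<in> GL2" and x: "x \<in> X"
  shows "gen_matrix (g ** h) x x' = (\<Sum>z\<in>X. gen_matrix h x z * gen_matrix g z x')"
proof -
  have "\<rho> (g ** h) (gen x) = (\<Sum>z\<in>X. pscale (gen_matrix h x z) (\<rho> g (gen z)))"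
    using \<rho>_mult[OF g h KX_gen[OF x]] \<rho>_gen[OF h x] \<rho>_sum[OF g, of X gen] by (simp add: KX_gen)
  then show ?thesis by (simp add: gen_matrix_def lookup_sum)
qed

lemma basis_to_gen_intertwines:
  assumes g: "g \<in> GL2" and A: "has_matrix g A" and y: "y \<in> Y"
  shows "(\<Sum>x\<in>X. basis_to_gen y x * gen_matrix g x x') = (\<Sum>z\<in>Y. A y z * basis_to_gen z x')"
proof -
  have "\<rho> g (basis_vec y) = (\<Sum>x\<in>X. pscale (basis_to_gen y x) (\<rho> g (gen x)))"
    by (subst basis_vec_eq[OF y]) (rule \<rho>_sum[OF g KX_gen])
  then have "(\<Sum>x\<in>X. pscale (basis_to_gen y x) (\<rho> g (gen x))) = (\<Sum>z\<in>Y. pscale (A y z) (basis_vec z))"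
    using A y by (simp add: has_matrix_def)
  from arg_cong[OF this, of "\<lambda>v. Poly_Mapping.lookup v (Gen x')"]
  show ?thesis by (simp add: lookup_sum gen_matrix_def basis_to_gen_def)
qed

lemma gen_to_basis_intertwines:
  assumes g: "g \<in> GL2" and A: "has_matrix g A" and x: "x \<in> X" and z: "z \<in> Y"
  shows "(\<Sum>y\<in>Y. gen_to_basis x y * A y z) = (\<Sum>x'\<in>X. gen_matrix g x x' * gen_to_basis x' z)"
proof (rule basis_vec_independent[OF _ z])
  have "\<rho> g (gen x) = (\<Sum>y\<in>Y. pscale (gen_to_basis x y) (\<rho> g (basis_vec y)))"
    by (subst gen_eq[OF x]) (rule \<rho>_sum[OF g basis_vec_in])
  also have "\<dots> = (\<Sum>y\<in>Y. pscale (gen_to_basis x y) (\<Sum>z\<in>Y. pscale (A y z) (basis_vec z)))"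
    using A by (simp add: has_matrix_def)
  also have "\<dots> = (\<Sum>z\<in>Y. pscale (\<Sum>y\<in>Y. gen_to_basis x y * A y z) (basis_vec z))"
    by (simp add: poly_space.scale_sum_right poly_space.scale_sum_left) (rule sum.swap)
  finally have "\<rho> g (gen x) = \<dots>" .
  moreover have "\<rho> g (gen x) = (\<Sum>z\<in>Y. pscale (\<Sum>x'\<in>X. gen_matrix g x x'
      * gen_to_basis x' z) (basis_vec z))"
    using \<rho>_gen[OF g x] by (simp add: sum_gen_eq_sum_basis_vec)
  ultimately show "(\<Sum>z\<in>Y. pscale (\<Sum>y\<in>Y. gen_to_basis x y * A y z) (basis_vec z))
      = (\<Sum>z\<in>Y. pscale (\<Sum>x'\<in>X. gen_matrix g x x' * gen_to_basis x' z) (basis_vec z))" by simp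
qed

lemma has_matrix_mult:
  assumes g: "g \<in> GL2" "has_matrix g A" and h: "h \<in> GL2" "has_matrix h B"
  shows "has_matrix (g ** h) (\<lambda>y x. \<Sum>z\<in>Y. B y z * A z x)"
  unfolding has_matrix_def
proof
  fix y assume y: "y \<in> Y"
  have "\<rho> (g ** h) (basis_vec y) = \<rho> g (\<Sum>z\<in>Y. pscale (B y z) (basis_vec z))"
    using \<rho>_mult[OF g(1) h(1) basis_vec_in[OF y]] h(2) y by (simp add: has_matrix_def)
  also have "\<dots> = (\<Sum>z\<in>Y. pscale (B y z) (\<rho> g (basis_vec z)))" by (rule \<rho>_sum[OF g(1) basis_vec_in])
  also have "\<dots> = (\<Sum>z\<in>Y. pscale (B y z) (\<Sum>x\<in>Y. pscale (A z x) (basis_vec x)))"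
    using g(2) by (simp add: has_matrix_def)
  also have "\<dots> = (\<Sum>x\<in>Y. pscale (\<Sum>z\<in>Y. B y z * A z x) (basis_vec x))"
    by (simp add: poly_space.scale_sum_right poly_space.scale_sum_left) (rule sum.swap)
  finally show "\<rho> (g ** h) (basis_vec y) = \<dots>" .
qed

lemma has_matrix_unique:
  assumes "has_matrix g A" "has_matrix g B" "y \<in> Y" "x \<in> Y"
  shows "A y x = B y x"
  using basis_vec_independent[of "A y" "B y" x] assms by (simp add: has_matrix_def)

lemma has_matrixI:
  assumes g: "g \<in> GL2"
    and act: "\<And>i j a. i \<in> {1..k} \<Longrightarrow> j \<le> form_degree i
        \<Longrightarrow> W_act (l2 i) g (form_monomial (form_degree i) j) a
      = (\<Sum>s\<le>form_degree i. A (i, j) (i, s) * form_monomial (form_degree i) s a)"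
    and block: "\<And>y x. fst y \<noteq> fst x \<Longrightarrow> A y x = 0"
  shows "has_matrix g A"
  unfolding has_matrix_def
proof
  fix y assume y: "y \<in> Y"
  show "\<rho> g (basis_vec y) = (\<Sum>z\<in>Y. pscale (A y z) (basis_vec z))"
  proof (rule T_eqI)
    show "\<rho> g (basis_vec y) \<in> KX X" "(\<Sum>z\<in>Y. pscale (A y z) (basis_vec z)) \<in> KX X"
      using y by (auto intro!: KX_sum KX_scale basis_vec_in \<rho>_in[OF g])
    fix i a assume i: "i \<in> {1..k}"
    have "T (\<rho> g (basis_vec y)) i a = W_act (l2 i) g (T (basis_vec y) i) a"
        using T_act[OF g basis_vec_in[OF y] i] by simp
    also have "\<dots> = (\<Sum>s\<le>form_degree i. A y (i, s) * form_monomial (form_degree i) s a)"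
    proof (cases "i = fst y")
      case True
      then have "y = (i, snd y)" "snd y \<le> form_degree i" using y by (auto simp: weight_basis_def)
      then show ?thesis using act[OF i, of "snd y" a] T_basis_vec[OF y i] True by simp
    next
      case False
      then show ?thesis using T_basis_vec[OF y i] by (simp add: block W_act_def)
    qed
    also have "\<dots> = T (\<Sum>z\<in>Y. pscale (A y z) (basis_vec z)) i a" by (simp add: T_combination[OF i])
    finally show "T (\<rho> g (basis_vec y)) i a = \<dots>" .
  qed
qed

lemma upper_GL2: "upper t \<in> GL2" and lower_GL2: "lower t \<in> GL2"
  using SL2_subset_GL2 upper_SL2 lower_SL2 by blast+

lemma has_matrix_upper: "has_matrix (upper t) (upper_coeff t)"
  by (rule has_matrixI[OF upper_GL2 W_act_upper]) (auto simp: upper_coeff_def)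

lemma has_matrix_lower: "has_matrix (lower t) (lower_coeff form_degree t)"
  by (rule has_matrixI[OF lower_GL2 W_act_lower]) (auto simp: lower_coeff_def)

text \<open>Both sides are matrices of the same group element, since \<open>upper\<close> is a homomorphism from the additive
group; independence of the basis makes them equal. The same argument applies to \<open>lower\<close>.\<close>

lemma upper_coeff_add:
  fixes t t' :: 'k
  assumes "y \<in> Y" "x \<in> Y"
  shows "upper_coeff (t + t') y x = (\<Sum>z\<in>Y. upper_coeff t y z * upper_coeff t' z x)"
proof -
  have "has_matrix (upper (t + t')) (\<lambda>y x. \<Sum>z\<in>Y. upper_coeff t y z * upper_coeff t' z x)"
    unfolding add.commute[of t] upper_add
    by (rule has_matrix_mult[OF upper_GL2 has_matrix_upper upper_GL2 has_matrix_upper])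
  from has_matrix_unique[OF has_matrix_upper this assms] show ?thesis .
qed

lemma lower_coeff_add:
  fixes t t' :: 'k
  assumes "y \<in> Y" "x \<in> Y"
  shows "lower_coeff form_degree (t + t') y x = (\<Sum>z\<in>Y. lower_coeff form_degree t y z
      * lower_coeff form_degree t' z x)"
proof -
  have "has_matrix (lower (t + t')) (\<lambda>y x. \<Sum>z\<in>Y. lower_coeff form_degree t y z
      * lower_coeff form_degree t' z x)"
    unfolding add.commute[of t] lower_add
    by (rule has_matrix_mult[OF lower_GL2 has_matrix_lower lower_GL2 has_matrix_lower])
  from has_matrix_unique[OF has_matrix_lower this assms] show ?thesis .
qed

end

section \<open>The dimension of the invariants of given degree\<close>

lemma coeff_tensor_add: "coeff_tensor (f + g) s = (\<lambda>w. coeff_tensor f s w + coeff_tensor g s w)"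
  and coeff_tensor_scale: "coeff_tensor (pscale c f) s = (\<lambda>w. c * coeff_tensor f s w)"
  by (simp_all add: coeff_tensor_def lookup_add)

lemma graded_free_eq:
  "graded_part (free_algebra p X) m
    = {f. \<forall>u. u \<notin> {u \<in> magma p X. deg u = m} \<longrightarrow> Poly_Mapping.lookup f u = (0::'k::field)}"
  unfolding graded_part_def free_algebra_def by (auto simp: in_keys_iff subset_eq)

lemma plug_in_magma: "s \<in> magma p UNIV \<Longrightarrow> w \<in> words X (deg s) \<Longrightarrow> plug s w \<in> magma p X"
  by (subst magma_iff) (simp add: shape_plug leaves_plug)

lemma dim_supported_poly:
  assumes "finite G"
  shows "poly_space.dim {f :: 'b \<Rightarrow>\<^sub>0 'k::field. Poly_Mapping.keys f \<subseteq> G} = card G"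
proof -
  let ?V = "{f :: 'b \<Rightarrow>\<^sub>0 'k. Poly_Mapping.keys f \<subseteq> G}"
  interpret vector_space_pair "pscale :: 'k \<Rightarrow> ('b \<Rightarrow>\<^sub>0 'k) \<Rightarrow> _" "fun_scale :: 'k \<Rightarrow> ('b \<Rightarrow> 'k) \<Rightarrow> _" ..
  have V: "?V = {f. \<forall>u. u \<notin> G \<longrightarrow> Poly_Mapping.lookup f u = 0}"
    by (auto simp: in_keys_iff)
  have "fun_space.dim (Poly_Mapping.lookup ` ?V) = poly_space.dim ?V"
  proof (rule dim_image_inj_on)
    show "Vector_Spaces.linear pscale fun_scale (Poly_Mapping.lookup :: ('b \<Rightarrow>\<^sub>0 'k) \<Rightarrow> _)"
      by unfold_locales (auto simp: fun_eq_iff lookup_add fun_scale_def)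
    show "poly_space.subspace ?V"
      unfolding poly_space.subspace_def V by (auto simp: lookup_add)
    show "inj_on Poly_Mapping.lookup ?V" by (auto intro!: inj_onI poly_mapping_eqI)
  qed
  moreover have "Poly_Mapping.lookup ` ?V = (supported G :: ('b \<Rightarrow> 'k) set)"
  proof (intro equalityI subsetI)
    fix v :: "'b \<Rightarrow> 'k" assume v: "v \<in> supported G"
    define f where "f = (\<Sum>u\<in>G. Poly_Mapping.single u (v u))"
    have "Poly_Mapping.lookup f u = (if u \<in> G then v u else 0)" for u
      unfolding f_def using assms by (simp add: lookup_sum lookup_single when_def)
    then have "Poly_Mapping.lookup f = v" "f \<in> ?V"
      using v V by (auto simp: fun_eq_iff supported_def)
    then show "v \<in> Poly_Mapping.lookup ` ?V" by blast
  qed (auto simp: supported_def in_keys_iff)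
  ultimately show ?thesis using dim_supported[OF assms, where 'k = 'k] by simp
qed

definition shapes :: "(nat \<Rightarrow> nat) \<Rightarrow> nat \<Rightarrow> unit expr set" where
  "shapes p m = {s \<in> magma p UNIV. deg s = m}"

lemma finite_shapes: "finite (shapes p m)"
  unfolding shapes_def by (rule finite_magma_deg) simp

text \<open>With a single generator, an expression is determined by its shape.\<close>

lemma hilbert_series_free_one_generator:
  "fps_nth (hilbert_series (free_algebra p {x} :: ('y expr \<Rightarrow>\<^sub>0 'k::field) set)) m
    = (if 1 \<le> m then of_nat (card (shapes p m)) else 0)"
proof -
  let ?G = "{u \<in> magma p {x}. deg u = m}"
  have "graded_part (free_algebra p {x} :: ('y expr \<Rightarrow>\<^sub>0 'k) set) m
      = {f. Poly_Mapping.keys f \<subseteq> ?G}"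
    by (auto simp: graded_part_def free_algebra_def)
  then have "poly_space.dim (graded_part (free_algebra p {x} :: ('y expr \<Rightarrow>\<^sub>0 'k) set) m) = card ?G"
    using dim_supported_poly[OF finite_magma_deg, of "{x}" p m, where 'k = 'k] by simp
  also have "card ?G = card (shapes p m)"
  proof (rule bij_betw_same_card)
    have one: "leaves u = replicate (deg u) x" if "set (leaves u) \<subseteq> {x}" for u
      using that by (intro replicate_eqI) (auto simp: length_leaves)
    show "bij_betw shape ?G (shapes p m)"
    proof (rule bij_betwI')
      fix u u' assume "u \<in> ?G" "u' \<in> ?G"
      then have "leaves u = leaves u'"
        using one[of u] one[of u'] magma_iff[of u p "{x}"] magma_iff[of u' p "{x}"] by simp
      then show "(shape u = shape u') = (u = u')" by (auto intro: expr_eqI)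
    next
      fix u assume "u \<in> ?G"
      then show "shape u \<in> shapes p m"
        using magma_iff[of u p "{x}"] by (simp add: shapes_def deg_shape)
    next
      fix s assume s: "s \<in> shapes p m"
      let ?u = "plug s (replicate m x)"
      have "shape ?u = s" using s by (intro shape_plug) (simp add: shapes_def)
      moreover have "?u \<in> magma p {x}"
        using s by (intro plug_in_magma) (auto simp: shapes_def)
      moreover have "deg ?u = m" using s calculation(1) deg_shape[of ?u] by (simp add: shapes_def)
      ultimately show "\<exists>u\<in>?G. s = shape u" by (intro bexI[of _ ?u]) auto
    qed
  qed
  finally show ?thesis by (simp add: hilbert_series_def)
qed

context decomposed_module
begin

text \<open>Being fixed does not depend on the coordinates: \<open>gen_to_basis\<close> and \<open>basis_to_gen\<close> intertwine the two
matrices of \<open>g\<close>, and hence so do their tensor powers.\<close>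

lemma fixed_iff_coordinates_fixed:
  assumes g: "g \<in> GL2" and A: "has_matrix g A"
  shows "(\<forall>w\<in>words X m. tensor_act X (gen_matrix g) F w = F w)
    \<longleftrightarrow> (\<forall>w\<in>words Y m. tensor_act Y A (tensor_act X gen_to_basis F) w
        = tensor_act X gen_to_basis F w)"
proof (intro iffI ballI)
  fix w assume fixed: "\<forall>w\<in>words X m. tensor_act X (gen_matrix g) F w = F w" and w: "w \<in> words Y m"
  have "tensor_act Y A (tensor_act X gen_to_basis F) w
      = tensor_act X gen_to_basis (tensor_act X (gen_matrix g) F) w"
    unfolding tensor_act_compose
    by (rule tensor_act_cong[OF refl]) (rule gen_to_basis_intertwines[OF g A], use w in auto)
  also have "\<dots> = tensor_act X gen_to_basis F w" by (rule tensor_act_cong) (use fixed w in auto)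
  finally show "tensor_act Y A (tensor_act X gen_to_basis F) w = tensor_act X gen_to_basis F w" .
next
  let ?v = "tensor_act X gen_to_basis F"
  fix w assume fixed: "\<forall>w\<in>words Y m. tensor_act Y A ?v w = ?v w" and w: "w \<in> words X m"
  have recover: "tensor_act Y basis_to_gen ?v w = F w" if "w \<in> words X m" for w
    unfolding tensor_act_compose
    by (rule tensor_act_id[OF finite_X]) (use that gen_to_basis_to_gen in auto)
  have "tensor_act X (gen_matrix g) F w = tensor_act X (gen_matrix g) (tensor_act Y basis_to_gen ?v) w"
    by (rule tensor_act_cong) (use recover w in auto)
  also have "\<dots> = tensor_act Y basis_to_gen (tensor_act Y A ?v) w"
    unfolding tensor_act_compose[of _ _ Y]
    by (rule tensor_act_cong[OF refl]) (rule basis_to_gen_intertwines[OF g A])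
  also have "\<dots> = tensor_act Y basis_to_gen ?v w" by (rule tensor_act_cong) (use fixed w in auto)
  also have "\<dots> = F w" by (rule recover[OF w])
  finally show "tensor_act X (gen_matrix g) F w = F w" .
qed

lemma fixed_mult:
  assumes g: "g \<in> GL2" and h: "h \<in> GL2"
    and "\<forall>w\<in>words X m. tensor_act X (gen_matrix g) F w = F w"
    and "\<forall>w\<in>words X m. tensor_act X (gen_matrix h) F w = F w"
  shows "\<forall>w\<in>words X m. tensor_act X (gen_matrix (g ** h)) F w = F w"
proof
  fix w assume w: "w \<in> words X m"
  have "tensor_act X (gen_matrix (g ** h)) F w = tensor_act X (gen_matrix g) (tensor_act X (gen_matrix h) F) w"
    unfolding tensor_act_compose by (rule tensor_act_cong[OF refl]) (rule gen_matrix_mult[OF g h])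
  also have "\<dots> = tensor_act X (gen_matrix g) F w" by (rule tensor_act_cong) (use assms(4) w in auto)
  finally show "tensor_act X (gen_matrix (g ** h)) F w = F w" using assms(3) w by simp
qed

lemma SL2_fixed_iff_annihilated:
  "(\<forall>g\<in>SL2. \<forall>w\<in>words X m. tensor_act X (gen_matrix g) F w = F w)
    \<longleftrightarrow> (\<forall>w\<in>words Y m. tensor_der Y raising (tensor_act X gen_to_basis F) w = 0)
      \<and> (\<forall>w\<in>words Y m. tensor_der Y (lowering form_degree) (tensor_act X gen_to_basis F) w = 0)"
proof -
  let ?Q = "\<lambda>g. \<forall>w\<in>words X m. tensor_act X (gen_matrix g) F w = F w"
  have "(\<forall>g\<in>SL2. ?Q g) \<longleftrightarrow> (\<forall>t. ?Q (upper t)) \<and> (\<forall>t. ?Q (lower t))"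
  proof
    assume Q: "(\<forall>t. ?Q (upper t)) \<and> (\<forall>t. ?Q (lower t))"
    show "\<forall>g\<in>SL2. ?Q g"
    proof
      fix g :: "'k ^ 2 ^ 2" assume g: "g \<in> SL2"
      show "?Q g"
      proof (rule SL2_generated[of ?Q, OF _ _ _ g])
        show "?Q (upper t)" "?Q (lower t)" for t using Q by blast+
        fix g h :: "'k ^ 2 ^ 2" assume "g \<in> SL2" "h \<in> SL2" "?Q g" "?Q h"
        then show "?Q (g ** h)" using SL2_subset_GL2 fixed_mult by blast
      qed
    qed
  qed (use upper_SL2 lower_SL2 in blast)
  moreover have "(\<forall>t. ?Q (upper t)) \<longleftrightarrow> (\<forall>w\<in>words Y m. tensor_der Y raising (tensor_act X gen_to_basis F) w = 0)"
    unfolding fixed_iff_coordinates_fixed[OF upper_GL2 has_matrix_upper]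
    by (rule tensor_act_fixed_iff_der_zero[OF finite_weight_basis])
      (auto intro: upper_coeff_deriv simp: upper_coeff_0 upper_coeff_add)
  moreover have "(\<forall>t. ?Q (lower t)) \<longleftrightarrow> (\<forall>w\<in>words Y m. tensor_der Y (lowering form_degree) (tensor_act X gen_to_basis F) w = 0)"
    unfolding fixed_iff_coordinates_fixed[OF lower_GL2 has_matrix_lower]
    by (rule tensor_act_fixed_iff_der_zero[OF finite_weight_basis])
      (auto intro: lower_coeff_deriv simp: lower_coeff_0 lower_coeff_add)
  ultimately show ?thesis by blast
qed

text \<open>Invariance can be tested shape by shape. Coefficients at expressions outside the free magma over \<open>X\<close>
vanish on both sides, as \<open>\<rho> g\<close> maps generators to combinations of generators.\<close>

lemma ext_act_fixed_iff:
  assumes g: "g \<in> GL2" and f: "f \<in> free_algebra ops X"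
  shows "ext_act \<rho> g f = f \<longleftrightarrow> (\<forall>s\<in>magma ops UNIV. \<forall>w\<in>words X (deg s).
    tensor_act X (gen_matrix g) (coeff_tensor f s) w = coeff_tensor f s w)"
proof -
  have look: "Poly_Mapping.lookup (ext_act \<rho> g f) u
      = tensor_act X (gen_matrix g) (coeff_tensor f (shape u)) (leaves u)" for u
    unfolding ext_act_def gen_matrix_def
    by (rule lookup_subst_eq_tensor_act[OF finite_X f]) (rule \<rho>_in[OF g KX_gen])
  have outside: "Poly_Mapping.lookup f u = 0" if "u \<notin> magma ops X" for u
    using f that by (auto simp: free_algebra_def in_keys_iff)
  show ?thesis
  proof (intro iffI ballI)
    fix s :: "unit expr" and w :: "'x list"
    assume eq: "ext_act \<rho> g f = f" and "w \<in> words X (deg s)"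
    then have "shape (plug s w) = s" "leaves (plug s w) = w"
      by (simp_all add: shape_plug leaves_plug)
    then show "tensor_act X (gen_matrix g) (coeff_tensor f s) w = coeff_tensor f s w"
      using look[of "plug s w"] eq by (simp add: coeff_tensor_def)
  next
    assume fixed: "\<forall>s\<in>magma ops UNIV. \<forall>w\<in>words X (deg s).
      tensor_act X (gen_matrix g) (coeff_tensor f s) w = coeff_tensor f s w"
    show "ext_act \<rho> g f = f"
    proof (rule poly_mapping_eqI)
      fix u
      consider "u \<in> magma ops X" | "u \<notin> magma ops X" "shape u \<notin> magma ops UNIV"
        | "u \<notin> magma ops X" "\<not> set (leaves u) \<subseteq> X"
        using magma_iff[of u ops X] by blast
      then show "Poly_Mapping.lookup (ext_act \<rho> g f) u = Poly_Mapping.lookup f u"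
      proof cases
        case 1
        then have "shape u \<in> magma ops UNIV" "leaves u \<in> words X (deg (shape u))"
          using magma_iff[of u ops X] by (auto simp: deg_shape length_leaves)
        then have "Poly_Mapping.lookup (ext_act \<rho> g f) u = coeff_tensor f (shape u) (leaves u)"
          unfolding look using fixed by blast
        then show ?thesis by (simp add: coeff_tensor_def plug_eq)
      next
        case 2
        have "coeff_tensor f (shape u) w = 0" if "w \<in> words X (length (leaves u))" for w
        proof -
          have "shape (plug (shape u) w) = shape u"
            using that by (intro shape_plug) (simp add: length_leaves deg_shape)
          then have "plug (shape u) w \<notin> magma ops X"
            using 2(2) magma_iff[of "plug (shape u) w" ops X] by auto
          then show ?thesis unfolding coeff_tensor_def by (rule outside)
        qed
        then show ?thesis unfolding look outside[OF 2(1)] by (rule tensor_act_zero)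
      next
        case 3
        then obtain x where x: "x \<in> set (leaves u)" "x \<notin> X" by blast
        have "gen_matrix g y x = 0" if "y \<in> X" for y
          using \<rho>_in[OF g KX_gen[OF that]] x(2) by (auto simp: gen_matrix_def KX_iff)
        then show ?thesis unfolding look outside[OF 3(1)] by (rule tensor_act_zero_letter[OF x(1)])
      qed
    qed
  qed
qed

text \<open>In the weight basis the torus acts diagonally on the component of each shape. The value \<open>0\<close> outside the
finite index set makes the image a space of functions with finite support.\<close>

definition coordinates ::
    "(nat \<Rightarrow> nat) \<Rightarrow> nat \<Rightarrow> ('x expr \<Rightarrow>\<^sub>0 'k) \<Rightarrow> unit expr \<times> (nat \<times> nat) list \<Rightarrow> 'k" where
  "coordinates ops m f = (\<lambda>(s, w). if s \<in> shapes ops m \<and> w \<in> words Y m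
     then tensor_act X gen_to_basis (coeff_tensor f s) w else 0)"

definition annihilated ::
    "(nat \<Rightarrow> nat) \<Rightarrow> nat \<Rightarrow> (unit expr \<times> (nat \<times> nat) list \<Rightarrow> 'k) set" where
  "annihilated ops m = {v \<in> supported (shapes ops m \<times> words Y m).
     (\<forall>s\<in>shapes ops m. \<forall>w\<in>words Y m. tensor_der Y raising (\<lambda>w. v (s, w)) w = 0)
     \<and> (\<forall>s\<in>shapes ops m. \<forall>w\<in>words Y m. tensor_der Y (lowering form_degree) (\<lambda>w. v (s, w)) w = 0)}"

lemma linear_coordinates: "Vector_Spaces.linear pscale fun_scale (coordinates ops m)"
  by unfold_locales
    (auto simp: coordinates_def fun_eq_iff fun_scale_def coeff_tensor_add coeff_tensor_scale
      tensor_act_add tensor_act_scale)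

lemma subspace_annihilated: "fun_space.subspace (annihilated ops m)"
proof -
  have der0: "tensor_der Y a (\<lambda>w. 0) w = (0::'k)" for a w
    using tensor_der_scale[of Y a 0 "\<lambda>_. 0" w] by simp
  show ?thesis
    unfolding fun_space.subspace_def annihilated_def
    by (auto simp: supported_def fun_scale_def der0 tensor_der_add tensor_der_scale)
qed

lemma subspace_graded_free: "poly_space.subspace (graded_part (free_algebra ops X) m)"
  unfolding graded_free_eq poly_space.subspace_def by (auto simp: lookup_add)

lemma coordinates_tensor_der:
  assumes "s \<in> shapes ops m" "w \<in> words Y m"
  shows "tensor_der Y a (\<lambda>w. coordinates ops m f (s, w)) w
    = tensor_der Y a (tensor_act X gen_to_basis (coeff_tensor f s)) w"
  by (rule tensor_der_cong) (use assms in \<open>auto simp: coordinates_def\<close>)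

lemma graded_invariants_eq:
  "graded_part (SL2_invariants ops X \<rho>) m
    = {f \<in> graded_part (free_algebra ops X) m. coordinates ops m f \<in> annihilated ops m}"
proof (intro equalityI subsetI)
  fix f assume "f \<in> graded_part (SL2_invariants ops X \<rho>) m"
  then have f: "f \<in> free_algebra ops X" "f \<in> graded_part (free_algebra ops X) m"
    and inv: "\<And>g. g \<in> SL2 \<Longrightarrow> ext_act \<rho> g f = f"
    by (auto simp: graded_part_def SL2_invariants_def)
  have "\<forall>g\<in>SL2. \<forall>w\<in>words X m. tensor_act X (gen_matrix g) (coeff_tensor f s) w = coeff_tensor f s w"
    if "s \<in> shapes ops m" for s
  proof
    fix g :: "'k ^ 2 ^ 2" assume g: "g \<in> SL2"
    then have "g \<in> GL2" using SL2_subset_GL2 by blast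
    moreover have s: "s \<in> magma ops UNIV" "deg s = m" using that by (auto simp: shapes_def)
    ultimately have "\<forall>w\<in>words X (deg s).
        tensor_act X (gen_matrix g) (coeff_tensor f s) w = coeff_tensor f s w"
      using iffD1[OF ext_act_fixed_iff[OF _ f(1)] inv[OF g]] by blast
    then show "\<forall>w\<in>words X m. tensor_act X (gen_matrix g) (coeff_tensor f s) w = coeff_tensor f s w"
      by (simp only: s)
  qed
  then have der: "(\<forall>w\<in>words Y m. tensor_der Y raising (tensor_act X gen_to_basis (coeff_tensor f s)) w = 0)
      \<and> (\<forall>w\<in>words Y m. tensor_der Y (lowering form_degree) (tensor_act X gen_to_basis (coeff_tensor f s)) w = 0)"
    if "s \<in> shapes ops m" for s
    using that SL2_fixed_iff_annihilated by blast
  have "coordinates ops m f \<in> annihilated ops m"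
    unfolding annihilated_def mem_Collect_eq
  proof (intro conjI ballI)
    show "coordinates ops m f \<in> supported (shapes ops m \<times> words Y m)"
      by (auto simp: supported_def coordinates_def)
    fix s w assume sw: "s \<in> shapes ops m" "w \<in> words Y m"
    show "tensor_der Y raising (\<lambda>w. coordinates ops m f (s, w)) w = 0"
      "tensor_der Y (lowering form_degree) (\<lambda>w. coordinates ops m f (s, w)) w = 0"
      unfolding coordinates_tensor_der[OF sw] using der sw by blast+
  qed
  then show "f \<in> {f \<in> graded_part (free_algebra ops X) m. coordinates ops m f \<in> annihilated ops m}"
    using f by simp
next
  fix f assume "f \<in> {f \<in> graded_part (free_algebra ops X) m. coordinates ops m f \<in> annihilated ops m}"
  then have f: "f \<in> graded_part (free_algebra ops X) m" "f \<in> free_algebra ops X"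
    and ann: "coordinates ops m f \<in> annihilated ops m" by (auto simp: graded_part_def)
  have "ext_act \<rho> g f = f" if g: "g \<in> SL2" for g
  proof -
    have "tensor_act X (gen_matrix g) (coeff_tensor f s) w = coeff_tensor f s w"
      if s: "s \<in> magma ops UNIV" and w: "w \<in> words X (deg s)" for s w
    proof (cases "deg s = m")
      case True
      then have "s \<in> shapes ops m" using s by (simp add: shapes_def)
      then have "\<forall>g\<in>SL2. \<forall>w\<in>words X m. tensor_act X (gen_matrix g) (coeff_tensor f s) w
          = coeff_tensor f s w"
        using ann unfolding SL2_fixed_iff_annihilated annihilated_def
        by (simp add: coordinates_tensor_der)
      then show ?thesis using g w True by blast
    next
      case False
      have zero: "coeff_tensor f s w' = 0" if "w' \<in> words X (deg s)" for w'
      proof -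
        have "deg (plug s w') = deg s"
          using that deg_shape[of "plug s w'"] by (simp add: shape_plug)
        then have "plug s w' \<notin> Poly_Mapping.keys f" using f(1) False by (auto simp: graded_part_def)
        then show ?thesis by (simp add: coeff_tensor_def in_keys_iff)
      qed
      have "tensor_act X (gen_matrix g) (coeff_tensor f s) w = 0"
        by (rule tensor_act_zero) (use w zero in auto)
      then show ?thesis using zero w by simp
    qed
    moreover have "g \<in> GL2" using g SL2_subset_GL2 by blast
    ultimately show ?thesis using ext_act_fixed_iff[OF _ f(2)] by blast
  qed
  then show "f \<in> graded_part (SL2_invariants ops X \<rho>) m"
    using f by (auto simp: graded_part_def SL2_invariants_def)
qed

lemma coordinates_inj_on: "inj_on (coordinates ops m) (graded_part (free_algebra ops X) m)"
proof (rule inj_onI)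
  fix f f' assume f: "f \<in> graded_part (free_algebra ops X) m"
      and f': "f' \<in> graded_part (free_algebra ops X) m"
    and eq: "coordinates ops m f = coordinates ops m f'"
  show "f = f'"
  proof (rule poly_mapping_eqI)
    fix u
    show "Poly_Mapping.lookup f u = Poly_Mapping.lookup f' u"
    proof (cases "u \<in> magma ops X \<and> deg u = m")
      case True
      then have s: "shape u \<in> shapes ops m" and w: "leaves u \<in> words X m"
        using magma_iff[of u ops X] by (auto simp: shapes_def deg_shape length_leaves)
      have recover: "Poly_Mapping.lookup f u = tensor_act Y basis_to_gen (tensor_act X gen_to_basis (coeff_tensor f (shape u))) (leaves u)" for f :: "'x expr \<Rightarrow>\<^sub>0 'k"
      proof -
        have "tensor_act Y basis_to_gen (tensor_act X gen_to_basis (coeff_tensor f (shape u))) (leaves u)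
            = coeff_tensor f (shape u) (leaves u)"
          unfolding tensor_act_compose
          by (rule tensor_act_id[OF finite_X]) (use w gen_to_basis_to_gen in auto)
        then show ?thesis by (simp add: coeff_tensor_def plug_eq)
      qed
      show ?thesis unfolding recover
      proof (rule tensor_act_cong[OF _ refl])
        fix w' assume "w' \<in> words Y (length (leaves u))"
        then show "tensor_act X gen_to_basis (coeff_tensor f (shape u)) w'
            = tensor_act X gen_to_basis (coeff_tensor f' (shape u)) w'"
          using fun_cong[OF eq, of "(shape u, w')"] s w by (simp add: coordinates_def)
      qed
    next
      case False
      then show ?thesis using f f' by (simp add: graded_free_eq)
    qed
  qed
qed

lemma coordinates_onto:
  assumes v: "v \<in> supported (shapes ops m \<times> words Y m)"
  shows "\<exists>f\<in>graded_part (free_algebra ops X) m. coordinates ops m f = v"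
proof -
  let ?G = "{u \<in> magma ops X. deg u = m}"
  define c where "c u = tensor_act Y basis_to_gen (\<lambda>w. v (shape u, w)) (leaves u)"
      for u :: "'x expr"
  define f where "f = (\<Sum>u\<in>?G. Poly_Mapping.single u (c u))"
  have lookup_f: "Poly_Mapping.lookup f u = (if u \<in> ?G then c u else 0)" for u
    unfolding f_def using finite_magma_deg[OF finite_X, of ops m]
    by (simp add: lookup_sum lookup_single when_def)
  have "f \<in> graded_part (free_algebra ops X) m"
    by (simp add: graded_free_eq lookup_f)
  moreover have "coordinates ops m f = v"
  proof
    fix i :: "unit expr \<times> (nat \<times> nat) list"
    obtain s w where i: "i = (s, w)" by (cases i)
    show "coordinates ops m f i = v i"
    proof (cases "s \<in> shapes ops m \<and> w \<in> words Y m")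
      case True
      have "coeff_tensor f s w' = tensor_act Y basis_to_gen (\<lambda>w. v (s, w)) w'"
          if "w' \<in> words X m" for w'
      proof -
        have sh: "shape (plug s w') = s" "leaves (plug s w') = w'" "plug s w' \<in> magma ops X"
          using True that by (auto simp: shapes_def shape_plug leaves_plug intro!: plug_in_magma)
        then have "deg (plug s w') = m" using that length_leaves[of "plug s w'"] by simp
        then show ?thesis using sh by (simp add: coeff_tensor_def lookup_f c_def)
      qed
      then have "tensor_act X gen_to_basis (coeff_tensor f s) w
          = tensor_act X gen_to_basis (tensor_act Y basis_to_gen (\<lambda>w. v (s, w))) w"
        using True by (intro tensor_act_cong) auto
      also have "\<dots> = v (s, w)"
        unfolding tensor_act_compose
        by (rule tensor_act_id[OF finite_weight_basis]) (use True basis_to_gen_to_basis in auto)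
      finally show ?thesis using True by (simp add: i coordinates_def)
    next
      case False
      then show ?thesis using supported_0[OF v, of "(s, w)"] by (auto simp: i coordinates_def)
    qed
  qed
  ultimately show ?thesis by blast
qed

text \<open>Passing to coordinates identifies the invariants of degree \<open>m\<close> with the tensors, one for each shape,
that are annihilated by the raising and the lowering operator.\<close>

lemma dim_graded_invariants:
  defines "N \<equiv> \<lambda>m d. card {w \<in> words Y m. word_weight (basis_weight form_degree) w = d}"
  shows "poly_space.dim (graded_part (SL2_invariants ops X \<rho>) m) + card (shapes ops m) * N m 2
    = card (shapes ops m) * N m 0"
proof -
  let ?V = "graded_part (SL2_invariants ops X \<rho>) m"
  interpret vector_space_pair "pscale :: 'k \<Rightarrow> ('x expr \<Rightarrow>\<^sub>0 'k) \<Rightarrow> _"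
    "fun_scale :: 'k \<Rightarrow> (unit expr \<times> (nat \<times> nat) list \<Rightarrow> 'k) \<Rightarrow> _" ..
  have "fun_space.dim (coordinates ops m ` ?V) = poly_space.dim ?V"
  proof (rule dim_image_inj_on[OF linear_coordinates])
    interpret c: Vector_Spaces.linear pscale fun_scale "coordinates ops m"
        by (rule linear_coordinates)
    have V: "?V = graded_part (free_algebra ops X) m \<inter> coordinates ops m -` annihilated ops m"
      unfolding graded_invariants_eq by blast
    show "poly_space.subspace ?V"
      unfolding V
      by (intro poly_space.subspace_inter subspace_graded_free c.subspace_vimage subspace_annihilated)
    show "inj_on (coordinates ops m) ?V"
      unfolding V by (rule inj_on_subset[OF coordinates_inj_on Int_lower1])
  qed
  moreover have "coordinates ops m ` ?V = annihilated ops m"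
  proof
    show "coordinates ops m ` ?V \<subseteq> annihilated ops m" unfolding graded_invariants_eq by blast
    show "annihilated ops m \<subseteq> coordinates ops m ` ?V"
    proof
      fix v assume v: "v \<in> annihilated ops m"
      then have "v \<in> supported (shapes ops m \<times> words Y m)" unfolding annihilated_def by blast
      then show "v \<in> coordinates ops m ` ?V"
        using coordinates_onto v unfolding graded_invariants_eq by blast
    qed
  qed
  moreover have "fun_space.dim (annihilated ops m) + card (shapes ops m) * N m 2
      = card (shapes ops m) * N m 0"
    unfolding annihilated_def N_def by (rule dim_annihilated_tensors[OF finite_shapes])
  ultimately show ?thesis by simp
qed

end

section \<open>Integration over the maximal torus\<close>

lemma sum_power_eq_sum_words:
  fixes g :: "'b \<Rightarrow> 'a::comm_semiring_1"
  shows "(\<Sum>b\<in>Y. g b) ^ m = (\<Sum>w\<in>words Y m. prod_list (map g w))"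
proof (induction m)
  case 0 then show ?case by (simp add: words_0[simplified])
next
  case (Suc m)
  then show ?case
    by (simp only: power_Suc sum_words_Suc) (simp add: sum_product)
qed

text \<open>The character \<open>z\<^sup>d\<close> of the circle at \<open>z = exp(2\<pi>\<i>u)\<close>.\<close>

definition char_exp :: "int \<Rightarrow> real \<Rightarrow> complex" where
  "char_exp d u = exp (2 * pi * \<i> * of_int d * u)"

lemma char_exp_0 [simp]: "char_exp 0 u = 1"
  and char_exp_add: "char_exp (d + e) u = char_exp d u * char_exp e u"
  by (simp_all add: char_exp_def algebra_simps flip: exp_add)

lemma char_exp_word_weight:
  "(\<Prod>b\<leftarrow>w. char_exp (c b) u) = char_exp (word_weight c w) u"
  by (induction w) (simp_all add: char_exp_add)

lemma char_exp_power: "char_exp d u ^ j = char_exp (int j * d) u"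
  by (induction j) (simp_all add: char_exp_add algebra_simps)

lemma schur_eq_char_exp:
  "schur a b (exp (2 * pi * \<i> * u)) (exp (- (2 * pi * \<i> * complex_of_real u)))
    = (\<Sum>j\<le>a - b. char_exp (int (a - b) - 2 * int j) u)"
proof -
  have pos: "exp (2 * pi * \<i> * u) = char_exp 1 u" and neg: "exp (- (2 * pi * \<i> * u))
      = char_exp (- 1) u"
    by (simp_all add: char_exp_def)
  show ?thesis
    unfolding schur_def pos neg char_exp_power char_exp_add[symmetric]
  proof -
    have "int (a - b - j) * 1 + int j * - 1 = int (a - b) - 2 * int j" if "j \<le> a - b" for j
      using that by (simp add: of_nat_diff)
    then have sum: "(\<Sum>j\<le>a - b. char_exp (int (a - b - j) * 1 + int j * - 1) u)
        = (\<Sum>j\<le>a - b. char_exp (int (a - b) - 2 * int j) u)"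
      by (intro sum.cong refl) (simp only: atMost_iff)
    show "char_exp (int b * (1 + - 1)) u * (\<Sum>j\<le>a - b. char_exp (int (a - b - j) * 1
        + int j * - 1) u)
        = (\<Sum>j\<le>a - b. char_exp (int (a - b) - 2 * int j) u)"
      unfolding sum by simp
  qed
qed

lemma integral_char_exp: "((\<lambda>u. char_exp d u) has_integral (if d = 0 then 1 else 0)) {0..1}"
proof (cases "d = 0")
  case True
  then show ?thesis using has_integral_const_real[of "1::complex" 0 1] by simp
next
  case False
  let ?c = "2 * pi * \<i> * of_int d :: complex"
  have c: "?c \<noteq> 0" using False by simp
  have "((\<lambda>u. char_exp d u) has_integral (exp (?c * of_real 1) / ?c
      - exp (?c * of_real 0) / ?c)) {0..1}"
  proof (rule fundamental_theorem_of_calculus)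
    fix u :: real
    have "((\<lambda>z. exp (?c * z) / ?c) has_field_derivative exp (?c * of_real u)) (at (of_real u))"
      using c by (auto intro!: derivative_eq_intros)
    then show "((\<lambda>u. exp (?c * of_real u) / ?c) has_vector_derivative char_exp d u) (at u within {0..1})"
      unfolding char_exp_def
      by (rule has_vector_derivative_real_field)
  qed simp
  moreover have "exp ?c = 1"
    by (simp add: exp_eq_1)
  ultimately show ?thesis using False by simp
qed

lemma sin_squared_char_exp:
  "2 * complex_of_real ((sin (2 * pi * u))\<^sup>2) = 1 - (char_exp 2 u + char_exp (- 2) u) / 2"
proof -
  have "char_exp 2 u + char_exp (- 2) u = 2 * complex_of_real (cos (2 * (2 * pi * u)))"
    by (simp add: char_exp_def cos_exp_eq algebra_simps flip: cos_of_real)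
  moreover have "complex_of_real (2 * (sin (2 * pi * u))\<^sup>2)
      = complex_of_real (1 - cos (2 * (2 * pi * u)))"
    by (simp only: cos_double_sin) simp
  ultimately show ?thesis by simp
qed

lemma integral_sin_squared_char_exp:
  "((\<lambda>u. 2 * complex_of_real ((sin (2 * pi * u))\<^sup>2) * char_exp d u) has_integral
    (if d = 0 then 1 else 0) - ((if d = 2 then 1 else 0) + (if d = - 2 then 1 else 0)) / 2) {0..1}"
proof -
  have "((\<lambda>u. char_exp d u - (char_exp (d + 2) u + char_exp (d + - 2) u) / 2) has_integral
      (if d = 0 then 1 else 0) - ((if d + 2 = 0 then 1 else 0) + (if d + - 2
          = 0 then 1 else 0)) / 2) {0..1}"
    by (intro has_integral_diff has_integral_divide has_integral_add integral_char_exp)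
  also have "(\<lambda>u. char_exp d u - (char_exp (d + 2) u + char_exp (d + - 2) u) / 2)
      = (\<lambda>u. 2 * complex_of_real ((sin (2 * pi * u))\<^sup>2) * char_exp d u)"
    unfolding sin_squared_char_exp char_exp_add by (simp add: fun_eq_iff algebra_simps)
  finally show ?thesis by (simp add: eq_neg_iff_add_eq_0 add.commute)
qed

text \<open>Expanding the power writes the integrand as a sum over words, and orthogonality of the characters
\<open>z\<^sup>d\<close> leaves only the words of weight \<open>0\<close>, \<open>2\<close> and \<open>-2\<close>.\<close>

lemma integral_sin_squared_character_power:
  fixes c :: "'b \<Rightarrow> int" and m :: nat
  assumes "finite Y"
  defines "N \<equiv> \<lambda>d. card {w \<in> words Y m. word_weight c w = d}"
  shows "((\<lambda>u. 2 * complex_of_real ((sin (2 * pi * u))\<^sup>2)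
      * (\<Sum>b\<in>Y. char_exp (c b) u) ^ m) has_integral
    of_nat (N 0) - (of_nat (N 2) + of_nat (N (- 2))) / 2) {0..1}"
proof -
  have count: "(\<Sum>w\<in>words Y m. if word_weight c w = d then 1 else 0)
      = (of_nat (N d) :: complex)" for d
    using finite_words[OF assms(1), of m] by (simp add: N_def sum.If_cases Int_def conj_ac)
  have "((\<lambda>u. \<Sum>w\<in>words Y m. 2 * complex_of_real ((sin (2 * pi * u))\<^sup>2)
      * char_exp (word_weight c w) u)
      has_integral (\<Sum>w\<in>words Y m. (if word_weight c w = 0 then 1 else 0)
        - ((if word_weight c w = 2 then 1 else 0) + (if word_weight c w
            = - 2 then 1 else 0)) / 2)) {0..1}"
    by (intro has_integral_sum finite_words assms(1) integral_sin_squared_char_exp)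
  moreover have "(\<Sum>w\<in>words Y m. (if word_weight c w = 0 then 1 else 0)
        - ((if word_weight c w = 2 then 1 else 0) + (if word_weight c w = - 2 then 1 else 0)) / 2)
      = of_nat (N 0) - (of_nat (N 2) + of_nat (N (- 2))) / (2::complex)"
    unfolding count[symmetric] by (simp only: sum_subtractf sum.distrib sum_divide_distrib[symmetric])
  ultimately show ?thesis
    by (simp only: sum_power_eq_sum_words char_exp_word_weight sum_distrib_left)
qed

text \<open>The Weyl group acts on the monomial basis by \<open>j \<mapsto> n - j\<close>, which negates weights.\<close>

lemma weight_count_symmetric:
  "card {w \<in> words (weight_basis k n) m. word_weight (basis_weight n) w = - d}
    = card {w \<in> words (weight_basis k n) m. word_weight (basis_weight n) w = d}"
proof (rule bij_betw_same_card)
  let ?\<sigma> = "\<lambda>y :: nat \<times> nat. (fst y, n (fst y) - snd y)"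
  let ?Y = "weight_basis k n"
  have wt: "word_weight (basis_weight n) (map ?\<sigma> w) = - word_weight (basis_weight n) w"
    if "set w \<subseteq> ?Y" for w
    using that by (induction w) (auto simp: weight_basis_def basis_weight_def of_nat_diff)
  have inv: "map ?\<sigma> (map ?\<sigma> w) = w" if "set w \<subseteq> ?Y" for w
    using that by (induction w) (auto simp: weight_basis_def)
  have in_Y: "set (map ?\<sigma> w) \<subseteq> ?Y" if "set w \<subseteq> ?Y" for w
    using that by (auto simp: weight_basis_def)
  show "bij_betw (map ?\<sigma>) {w \<in> words ?Y m. word_weight (basis_weight n) w = - d}
      {w \<in> words ?Y m. word_weight (basis_weight n) w = d}"
    by (rule bij_betw_byWitness[where f' = "map ?\<sigma>"])
      (use wt inv in_Y in \<open>auto simp del: set_map map_map\<close>)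
qed

lemma sum_weight_basis: "(\<Sum>b\<in>weight_basis k n. g b) = (\<Sum>i=1..k. \<Sum>j\<le>n i. g (i, j))"
  by (simp add: weight_basis_def sum.Sigma case_prod_unfold)

lemma sin_eq_char_exp:
  "2 * \<i> * complex_of_real (sin (2 * pi * real m * u)) = char_exp (int m) u - char_exp (- int m) u"
proof -
  have "2 * \<i> * complex_of_real (sin x) = exp (\<i> * x) - exp (- (\<i> * x))" for x :: real
    by (simp add: sin_exp_eq flip: sin_of_real)
  from this[of "2 * pi * real m * u"] show ?thesis by (simp add: char_exp_def mult_ac)
qed

text \<open>Where the denominator does not vanish, this is the quotient formula for the Schur function. The zeros
of the denominator are isolated, and there the continuous function on the left is the limit of the
quotient; the limit is real because the quotient is.\<close>

lemma schur_eq_sin_quotient: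
  "schur a b (exp (2 * pi * \<i> * u)) (exp (- (2 * pi * \<i> * complex_of_real u)))
    = complex_of_real (sin_quotient (a - b + 1) u)"
proof -
  let ?m = "a - b + 1"
  let ?S = "\<lambda>u. schur a b (exp (2 * pi * \<i> * u)) (exp (- (2 * pi * \<i> * complex_of_real u)))"
  let ?Q = "\<lambda>v. sin (2 * pi * real ?m * v) / sin (2 * pi * v)"
  have generic: "?S v = complex_of_real (?Q v)" if "sin (2 * pi * v) \<noteq> 0" for v
  proof -
    have pos: "exp (2 * pi * \<i> * v) = char_exp 1 v" and neg: "exp (- (2 * pi * \<i> * v))
        = char_exp (- 1) v"
      by (simp_all add: char_exp_def)
    have ne: "char_exp 1 v \<noteq> char_exp (- 1) v" using that sin_eq_char_exp[of 1 v] by auto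
    have "?S v = (char_exp (int ?m) v - char_exp (- int ?m) v) / (char_exp 1 v - char_exp (- 1) v)"
      unfolding pos neg schur_quotient[OF ne] char_exp_power char_exp_add[symmetric] by simp
    also have "\<dots> = 2 * \<i> * complex_of_real (sin (2 * pi * real ?m * v))
        / (2 * \<i> * complex_of_real (sin (2 * pi * v)))"
      using sin_eq_char_exp[of ?m v] sin_eq_char_exp[of 1 v] by simp
    also have "\<dots> = complex_of_real (?Q v)" by simp
    finally show ?thesis .
  qed
  show ?thesis
  proof (cases "sin (2 * pi * u) = 0")
    case False then show ?thesis using generic by (simp add: sin_quotient_def)
  next
    case True
    have "continuous (at u) ?S" unfolding schur_def by (intro continuous_intros)
    then have S: "(?S \<longlongrightarrow> ?S u) (at u)" by (simp add: continuous_at)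
    have nz: "sin (2 * pi * v) \<noteq> 0" if v: "v \<noteq> u" "dist v u < 1 / 2" for v
    proof
      assume "sin (2 * pi * v) = 0"
      moreover have "sin (2 * pi * v) = cos (2 * pi * u) * sin (2 * pi * (v - u))"
        using True sin_add[of "2 * pi * u" "2 * pi * (v - u)"] by (simp add: algebra_simps)
      moreover have "cos (2 * pi * u) \<noteq> 0"
        using True sin_cos_squared_add[of "2 * pi * u"] by auto
      ultimately have sin0: "sin (2 * pi * (v - u)) = 0" by simp
      have "2 * pi * \<bar>v - u\<bar> < 2 * pi * (1 / 2)"
        by (rule mult_strict_left_mono) (use v(2) in \<open>simp_all add: dist_real_def\<close>)
      then have "\<bar>2 * pi * (v - u)\<bar> < pi" by (simp add: abs_mult)
      then have "2 * pi * (v - u) = 0"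
        unfolding abs_less_iff using sin0 sin_eq_0_pi[of "2 * pi * (v - u)"] by linarith
      then show False using v(1) by simp
    qed
    have "eventually (\<lambda>v. v \<noteq> u \<and> dist v u < 1 / 2) (at u)"
      by (auto simp: eventually_at intro!: exI[of _ "1 / 2"])
    then have "eventually (\<lambda>v. ?S v = complex_of_real (?Q v)) (at u)"
    proof (rule eventually_mono)
      fix v assume "v \<noteq> u \<and> dist v u < 1 / 2"
      then have "sin (2 * pi * v) \<noteq> 0" using nz by blast
      then show "?S v = complex_of_real (?Q v)" by (rule generic)
    qed
    then have Q: "((\<lambda>v. complex_of_real (?Q v)) \<longlongrightarrow> ?S u) (at u)"
      by (rule Lim_transform_eventually[OF S])
    have "(?Q \<longlongrightarrow> Re (?S u)) (at u)" using tendsto_Re[OF Q] by simp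
    then have "Lim (at u) ?Q = Re (?S u)" by (rule tendsto_Lim[OF trivial_limit_at])
    moreover have "Im (?S u) = 0"
      using tendsto_Im[OF Q] by (simp add: tendsto_const_iff)
    ultimately show ?thesis using True by (simp add: sin_quotient_def complex_eq_iff)
  qed
qed

section \<open>The Hilbert series of the invariants\<close>

theorem theorem5p4:
  fixes p :: "nat \<Rightarrow> nat"
    and X :: "'x set"
    and \<rho> :: "'k::field_char_0 ^ 2 ^ 2 \<Rightarrow> ('x expr \<Rightarrow>\<^sub>0 'k) \<Rightarrow> ('x expr \<Rightarrow>\<^sub>0 'k)"
    and k :: nat
    and l1 l2 :: "nat \<Rightarrow> nat"
    and x :: 'y
  assumes "finite X"
    and "polynomial_GL2_module X \<rho>"
    and "\<forall>i\<in>{1..k}. l2 i \<le> l1 i"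
    and "iso_sum_W X \<rho> k l1 l2"
  shows "hilbert_series (SL2_invariants p X \<rho>)
      = 2 * fps_integral01 (\<lambda>u. fps_const (complex_of_real ((sin (2 * pi * u))\<^sup>2)) *
          (hilbert_series (free_algebra p {x} :: ('y expr \<Rightarrow>\<^sub>0 'k) set) oo
            (fps_X * fps_const (\<Sum>i=1..k.
               schur (l1 i) (l2 i) (exp (2 * pi * \<i> * u)) (exp (- (2 * pi * \<i> * u)))))))
    \<and> 2 * fps_integral01 (\<lambda>u. fps_const (complex_of_real ((sin (2 * pi * u))\<^sup>2)) *
          (hilbert_series (free_algebra p {x} :: ('y expr \<Rightarrow>\<^sub>0 'k) set) oo
            (fps_X * fps_const (\<Sum>i=1..k.
               schur (l1 i) (l2 i) (exp (2 * pi * \<i> * u)) (exp (- (2 * pi * \<i> * u)))))))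
      = 2 * fps_integral01 (\<lambda>u. fps_const (complex_of_real ((sin (2 * pi * u))\<^sup>2)) *
          (hilbert_series (free_algebra p {x} :: ('y expr \<Rightarrow>\<^sub>0 'k) set) oo
            (fps_X * fps_const (complex_of_real (\<Sum>i=1..k.
               sin_quotient (l1 i - l2 i + 1) u)))))"
proof -
  obtain T :: "('x expr \<Rightarrow>\<^sub>0 'k) \<Rightarrow> nat \<Rightarrow> ('k ^ 2 \<Rightarrow> 'k)" where
    "bij_betw T (KX X) (\<Pi>\<^sub>E i\<in>{1..k}. W (l1 i) (l2 i))"
    "\<forall>v\<in>KX X. \<forall>w\<in>KX X. \<forall>i\<in>{1..k}. T (v + w) i = (\<lambda>a. T v i a + T w i a)"
    "\<forall>c. \<forall>v\<in>KX X. \<forall>i\<in>{1..k}. T (pscale c v) i = (\<lambda>a. c * T v i a)"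
    "\<forall>g\<in>GL2. \<forall>v\<in>KX X. \<forall>i\<in>{1..k}. T (\<rho> g v) i = W_act (l2 i) g (T v i)"
    using assms(4) unfolding iso_sum_W_def by blast
  then interpret V: decomposed_module X \<rho> k l1 l2 T
    using assms(1,2) by unfold_locales blast+
  let ?n = "\<lambda>i. l1 i - l2 i"
  let ?Y = "weight_basis k ?n"
  let ?N = "\<lambda>m d. card {w \<in> words ?Y m. word_weight (basis_weight ?n) w = d}"
  let ?H = "hilbert_series (free_algebra p {x} :: ('y expr \<Rightarrow>\<^sub>0 'k) set)"
  define ch where "ch u = (\<Sum>i=1..k. schur (l1 i) (l2 i)
    (exp (2 * pi * \<i> * u)) (exp (- (2 * pi * \<i> * complex_of_real u))))" for u :: real
  have form_degree: "V.form_degree = ?n" by (simp add: fun_eq_iff V.form_degree_def)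
  have ch: "ch u = (\<Sum>b\<in>?Y. char_exp (basis_weight ?n b) u)" for u
    unfolding ch_def schur_eq_char_exp by (simp add: sum_weight_basis basis_weight_def)
  have ch_sin: "ch u = complex_of_real (\<Sum>i=1..k. sin_quotient (?n i + 1) u)" for u
    unfolding ch_def schur_eq_sin_quotient by simp
  let ?R = "2 * fps_integral01 (\<lambda>u. fps_const (complex_of_real ((sin (2 * pi * u))\<^sup>2)) *
          (?H oo (fps_X * fps_const (ch u))))"
  have "hilbert_series (SL2_invariants p X \<rho>) = ?R"
  proof (rule fps_ext)
    fix m
    let ?h = "fps_nth ?H m"
    have "fps_nth ?R m
        = 2 * integral {0..1} (\<lambda>u. complex_of_real ((sin (2 * pi * u))\<^sup>2) * (ch u ^ m * ?h))"
      by (simp add: fps_integral01_def numeral_fps_const mult.commute[of fps_X])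
    also have "\<dots> = integral {0..1}
        (\<lambda>u. ?h * (2 * complex_of_real ((sin (2 * pi * u))\<^sup>2)
            * (\<Sum>b\<in>?Y. char_exp (basis_weight ?n b) u) ^ m))"
      by (subst integral_mult_right[symmetric]) (simp add: ch mult_ac)
    also have "\<dots> = ?h * (of_nat (?N m 0) - (of_nat (?N m 2) + of_nat (?N m (- 2))) / 2)"
      by (intro integral_unique has_integral_mult_right integral_sin_squared_character_power
          finite_weight_basis)
    also have "\<dots> = ?h * (of_nat (?N m 0) - of_nat (?N m 2))"
      by (simp only: weight_count_symmetric) simp
    also have "\<dots> = fps_nth (hilbert_series (SL2_invariants p X \<rho>)) m"
    proof (cases "1 \<le> m")
      case True
      have "of_nat (poly_space.dim (graded_part (SL2_invariants p X \<rho>) m))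
          + of_nat (card (shapes p m)) * of_nat (?N m 2)
        = (of_nat (card (shapes p m)) * of_nat (?N m 0) :: complex)"
        unfolding of_nat_mult[symmetric] of_nat_add[symmetric]
        using V.dim_graded_invariants[of p m] by (simp only: form_degree)
      then show ?thesis
        using True hilbert_series_free_one_generator[of p x m, where 'k = 'k]
        by (simp add: hilbert_series_def algebra_simps)
    next
      case False
      (* Hilbert series have no constant term, so both sides vanish for m = 0. *)
      then show ?thesis by (simp add: hilbert_series_def)
    qed
    finally show "fps_nth (hilbert_series (SL2_invariants p X \<rho>)) m = fps_nth ?R m" by simp
  qed
  then show ?thesis using ch_sin unfolding ch_def by simp
qed

end
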